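(* Let $a>0$, $l>0$, and let $b,v\in\mathbb{R}$. Let $\gamma\in C^2([0,\infty))$ satisfy $\gamma(0)=0$, $\gamma'(t)\in(-a,a)$ and $\gamma(t)<l$ for all $t\ge 0$, $\lim_{t\to+\infty}(\gamma(t)+at)=+\infty$ and $\lim_{t\to+\infty}(\gamma(t)-at)=-\infty$. Let $Q=\{(t,x): t>0,\ \gamma(t)<x<l\}$. Let $\varphi\in C^2([0,l])$, $\psi\in C^1([0,l])$, $\mu_1\in C^2([0,\infty))$, $\mu_2\in C([0,\infty))$, $f\in C^1(\overline{Q})$. Let real constants $C^{(i)}$, $i=0,2,4,\dots$, be given. Consider the mixed problem $$(\partial_t^2-a^2\partial_x^2)u(t,x)=f(t,x),\quad (t,x)\in Q,$$ $$u(0,x)=\varphi(x),\qquad \partial_t u(0,x)=\psi(x)+\begin{cases}0,& x\in[0,l),\\ v,& x=l,\end{cases}\qquad x\in[0,l],$$ $$u(t,\gamma(t))=\mu_1(t),\qquad (\partial_t^2+b\,\partial_x)u(t,l)=\mu_2(t),\qquad t\in[0,\infty).$$ This problem has a unique classical solution (in the sense of the definition given in the context, with the given constants $C^{(i)}$) if and only if the following matching conditions hold: $$\mu_1(0)-\varphi(0)=0,$$ $$\mu_1'(0)-\psi(0)-\gamma'(0)\varphi'(0)=0,$$ $$\mu_1''(0)-\bigl(a^2+(\gamma'(0))^2\bigr)\varphi''(0)-f(0,0)-2\gamma'(0)\psi'(0)-\gamma''(0)\varphi'(0)=0,$$ $$\mu_2(0)-f(0,l)-b\,\varphi'(l)-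a^2\varphi''(l)=0.$$
   Context: $C^k(\overline{Q})$ denotes functions whose partial derivatives up to order $k$ exist in $Q$ and extend continuously to $\overline{Q}$. Put $\gamma_+(t)=\gamma(t)+at$ and $\gamma_-(t)=\gamma(t)-at$ for $t\ge 0$. Under the assumptions on $\gamma$, $\gamma_+$ is an increasing bijection of $[0,\infty)$ onto $[0,\infty)$ with inverse $\Phi_+$, and $\gamma_-$ is a decreasing bijection of $[0,\infty)$ onto $(-\infty,0]$ with inverse $\Phi_-$. Define $r_0=l_0=0$ and, for $i\ge 1$, $$l_i=r_{i-1}+a^{-1}(l-\gamma(r_{i-1})),\qquad r_i=\Phi_+(l+a l_{i-1}).$$ The domain is partitioned into $$Q^{(0,0)}=Q\cap\{x-at\in[0,l],\ x+at\in[0,l]\},\qquad Q^{(1,0)}=Q\cap\{x-at\in[\gamma_-(r_1),0],\ x+at\in[0,l]\},$$ $$Q^{(0,1)}=Q\cap\{x-at\in[0,l],\ x+at\in[l,l+al_1]\},$$ $$Q^{(i,j)}=Q\cap\{x-at\in[\gamma_-(r_i),\gamma_-(r_{i-1})],\ x+at\in[l+al_{j-1},l+al_j]\},\quad i,j\ge 1,$$ where only pairs with $|i-j|\le 1$ are relevant. Definition (classical solution, for given constants $C^{(i)}$, $i$ even, $i\ge 0$). A function $u$ is a classical solution of the problem if $u=u_1+u_2$, where: (1) $u_1\in C^2(\overline{Q})$ is a classical solution of the problem with $v=0$, i.e. it satisfies the equation, $u_1(0,x)=\varphi(x)$ and $\partial_tu_1(0,x)=\psi(x)$ for $x\in[0,l]$,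 and the two boundary conditions for all $t\ge0$; (2) $u_2$ is twice continuously differentiable on each $\overline{Q^{(i,j)}}$ ($|i-j|\le 1$; derivatives on a closed piece are limits from within that piece), satisfies $(\partial_t^2-a^2\partial_x^2)u_2=0$ on each $\overline{Q^{(i,j)}}$, the initial conditions $u_2(0,x)=\partial_tu_2(0,x)=0$ for $x\in[0,l]$ (as a function on $\overline{Q^{(0,0)}}$), the boundary conditions $u_2(t,\gamma(t))=0$ and $(\partial_t^2+b\,\partial_x)u_2(t,l)=0$ for $t\ge 0$ (on $x=l$, for $t\in[l_{j-1},l_j]$, the derivatives are taken within $\overline{Q^{(j-1,j)}}$, $j\ge 1$), and the conjugation conditions $$[(u_2)^+-(u_2)^-](t,\,x=\gamma_-(r_i)+at)=0,\quad i=0,1,2,\dots,$$ $$[(u_2)^+-(u_2)^-](t,\,x=l+al_i-at)=0,\quad i=0,1,2,\dots,$$ $$[(\partial_tu_2)^+-(\partial_tu_2)^-](t,\,x=l+al_i-at)=C^{(i)},\quad i\ge 0\text{ even},$$ $$[(\partial_tu_2)^+-(\partial_tu_2)^-](t,\,x=l+al_i-at)=0,\quad i\ge 1\text{ odd}.$$ Here $(h)^{\pm}(t,x=c(t))$ denotes the limits of $h(t,x)$ as $x\to c(t)\pm0$ at fixed $t$; the conditions are imposed at the points of the indicated characteristic lying in $Q$ and, for the conditions on $\partial_t u_2$, not lying on a characteristic $x-at=\gamma_-(r_k)$, $k\ge0$. *)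

theory Defs
  imports "HOL-Analysis.Analysis"
begin

subsection \<open>Functions of class \<open>C\<^sup>k\<close>\<close>

text \<open>One variable, on a (nondegenerate) closed interval \<open>S\<close>: derivatives are taken within \<open>S\<close>,
  hence one-sided at the end points.\<close>

definition deriv_on :: "real set \<Rightarrow> (real \<Rightarrow> real) \<Rightarrow> real \<Rightarrow> real" where
  "deriv_on S g t = vector_derivative g (at t within S)"

fun Ck_on :: "nat \<Rightarrow> real set \<Rightarrow> (real \<Rightarrow> real) \<Rightarrow> bool" where
  "Ck_on 0 S g \<longleftrightarrow> continuous_on S g"
| "Ck_on (Suc k) S g \<longleftrightarrow> g differentiable_on S \<and> Ck_on k S (deriv_on S g)"

text \<open>Two variables, in the order \<open>(t, x)\<close>.\<close>

definition pd_t :: "(real \<times> real \<Rightarrow> real) \<Rightarrow> real \<times> real \<Rightarrow> real" where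
  "pd_t u = (\<lambda>(t, x). deriv (\<lambda>s. u (s, x)) t)"

definition pd_x :: "(real \<times> real \<Rightarrow> real) \<Rightarrow> real \<times> real \<Rightarrow> real" where
  "pd_x u = (\<lambda>(t, x). deriv (\<lambda>y. u (t, y)) x)"

text \<open>A function \<open>h\<close> on the interior of \<open>S\<close> extends continuously to the closure of \<open>S\<close> (for \<open>S\<close>
  contained in the closure of its interior) iff \<open>bd_ext S h\<close> is continuous on \<open>closure S\<close>.\<close>

definition bd_ext :: "(real \<times> real) set \<Rightarrow> (real \<times> real \<Rightarrow> real) \<Rightarrow> real \<times> real \<Rightarrow> real" where
  "bd_ext S h p = (if p \<in> interior S then h p else Lim (at p within interior S) h)"

text \<open>Partial derivatives on \<open>closure S\<close>: ordinary ones in the interior, and their limits from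
  the interior at the remaining points. Iterating these gives the higher derivatives.\<close>

definition D_t :: "(real \<times> real) set \<Rightarrow> (real \<times> real \<Rightarrow> real) \<Rightarrow> real \<times> real \<Rightarrow> real" where
  "D_t S u = bd_ext S (pd_t u)"

definition D_x :: "(real \<times> real) set \<Rightarrow> (real \<times> real \<Rightarrow> real) \<Rightarrow> real \<times> real \<Rightarrow> real" where
  "D_x S u = bd_ext S (pd_x u)"

text \<open>\<open>Ck_closure k S u\<close>: \<open>u\<close> is continuous on \<open>closure S\<close>, and its partial derivatives up to
  order \<open>k\<close> exist in the interior of \<open>S\<close> and extend continuously to \<open>closure S\<close>.\<close>

fun Ck_closure :: "nat \<Rightarrow> (real \<times> real) set \<Rightarrow> (real \<times> real \<Rightarrow> real) \<Rightarrow> bool" where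
  "Ck_closure 0 S u \<longleftrightarrow> continuous_on (closure S) u"
| "Ck_closure (Suc k) S u \<longleftrightarrow>
     continuous_on (closure S) u \<and>
     (\<forall>(t, x) \<in> interior S.
        (\<lambda>s. u (s, x)) differentiable (at t) \<and> (\<lambda>y. u (t, y)) differentiable (at x)) \<and>
     Ck_closure k S (D_t S u) \<and> Ck_closure k S (D_x S u)"


subsection \<open>The domain and its partition by characteristics\<close>

definition Qdom :: "real \<Rightarrow> (real \<Rightarrow> real) \<Rightarrow> (real \<times> real) set" where
  "Qdom l \<gamma> = {(t, x). t > 0 \<and> \<gamma> t < x \<and> x < l}"

definition gamma_plus :: "real \<Rightarrow> (real \<Rightarrow> real) \<Rightarrow> real \<Rightarrow> real" where
  "gamma_plus a \<gamma> t = \<gamma> t + a * t"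

definition gamma_minus :: "real \<Rightarrow> (real \<Rightarrow> real) \<Rightarrow> real \<Rightarrow> real" where
  "gamma_minus a \<gamma> t = \<gamma> t - a * t"

definition Phi_plus :: "real \<Rightarrow> (real \<Rightarrow> real) \<Rightarrow> real \<Rightarrow> real" where
  "Phi_plus a \<gamma> = inv_into {0..} (gamma_plus a \<gamma>)"

fun lseq rseq :: "real \<Rightarrow> real \<Rightarrow> (real \<Rightarrow> real) \<Rightarrow> nat \<Rightarrow> real" where
  "lseq a l \<gamma> 0 = 0"
| "lseq a l \<gamma> (Suc i) = rseq a l \<gamma> i + (l - \<gamma> (rseq a l \<gamma> i)) / a"
| "rseq a l \<gamma> 0 = 0"
| "rseq a l \<gamma> (Suc i) = Phi_plus a \<gamma> (l + a * lseq a l \<gamma> i)"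

definition char_rect :: "real \<Rightarrow> real set \<Rightarrow> real set \<Rightarrow> (real \<times> real) set" where
  "char_rect a I J = {(t, x). x - a * t \<in> I \<and> x + a * t \<in> J}"

text \<open>The index pairs \<open>(i, 0)\<close> and \<open>(0, j)\<close> with \<open>i, j \<ge> 2\<close> do not occur in the partition.\<close>

fun Qpart :: "real \<Rightarrow> real \<Rightarrow> (real \<Rightarrow> real) \<Rightarrow> nat \<Rightarrow> nat \<Rightarrow> (real \<times> real) set" where
  "Qpart a l \<gamma> 0 0 = Qdom l \<gamma> \<inter> char_rect a {0..l} {0..l}"
| "Qpart a l \<gamma> (Suc 0) 0 =
     Qdom l \<gamma> \<inter> char_rect a {gamma_minus a \<gamma> (rseq a l \<gamma> 1)..0} {0..l}"
| "Qpart a l \<gamma> 0 (Suc 0) =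
     Qdom l \<gamma> \<inter> char_rect a {0..l} {l..l + a * lseq a l \<gamma> 1}"
| "Qpart a l \<gamma> (Suc i) (Suc j) =
     Qdom l \<gamma> \<inter> char_rect a
       {gamma_minus a \<gamma> (rseq a l \<gamma> (Suc i))..gamma_minus a \<gamma> (rseq a l \<gamma> i)}
       {l + a * lseq a l \<gamma> j..l + a * lseq a l \<gamma> (Suc j)}"
| "Qpart a l \<gamma> (Suc (Suc i)) 0 = {}"
| "Qpart a l \<gamma> 0 (Suc (Suc j)) = {}"


subsection \<open>The mixed problem and its classical solutions\<close>

text \<open>\<open>C\<^sup>2\<close> solutions of the mixed problem itself, where \<open>v\<close> is the defect of the initial velocity
  at \<open>x = l\<close>.\<close>

definition C2_solution ::
  "real \<Rightarrow> real \<Rightarrow> real \<Rightarrow> real \<Rightarrow> (real \<Rightarrow> real) \<Rightarrow> (real \<Rightarrow> real) \<Rightarrow> (real \<Rightarrow> real) \<Rightarrow>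
   (real \<Rightarrow> real) \<Rightarrow> (real \<Rightarrow> real) \<Rightarrow> (real \<times> real \<Rightarrow> real) \<Rightarrow> (real \<times> real \<Rightarrow> real) \<Rightarrow> bool" where
  "C2_solution a l b v \<gamma> \<phi> \<psi> \<mu>1 \<mu>2 f u \<longleftrightarrow> (let Q = Qdom l \<gamma> in
     Ck_closure 2 Q u \<and>
     (\<forall>p \<in> Q. D_t Q (D_t Q u) p - a\<^sup>2 * D_x Q (D_x Q u) p = f p) \<and>
     (\<forall>x \<in> {0..l}. u (0, x) = \<phi> x) \<and>
     (\<forall>x \<in> {0..l}. D_t Q u (0, x) = \<psi> x + (if x = l then v else 0)) \<and>
     (\<forall>t \<ge> 0. u (t, \<gamma> t) = \<mu>1 t) \<and>
     (\<forall>t \<ge> 0. D_t Q (D_t Q u) (t, l) + b * D_x Q u (t, l) = \<mu>2 t))"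

text \<open>The one-sided limits of \<open>h (t, x)\<close> as \<open>x\<close> tends to \<open>c\<close> at fixed \<open>t\<close> exist, and
  right limit minus left limit is \<open>J\<close>.\<close>

definition has_jump :: "(real \<times> real \<Rightarrow> real) \<Rightarrow> real \<Rightarrow> real \<Rightarrow> real \<Rightarrow> bool" where
  "has_jump h t c J \<longleftrightarrow>
     (\<exists>hp hm. ((\<lambda>x. h (t, x)) \<longlongrightarrow> hp) (at_right c) \<and> ((\<lambda>x. h (t, x)) \<longlongrightarrow> hm) (at_left c) \<and>
              hp - hm = J)"

text \<open>The singular part \<open>u\<^sub>2\<close>. Only the values of \<open>C\<close> at even indices are used.\<close>

definition singular_part ::
  "real \<Rightarrow> real \<Rightarrow> real \<Rightarrow> (real \<Rightarrow> real) \<Rightarrow> (nat \<Rightarrow> real) \<Rightarrow> (real \<times> real \<Rightarrow> real) \<Rightarrow> bool" where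
  "singular_part a l b \<gamma> C u \<longleftrightarrow>
     (let Q = Qdom l \<gamma>; P = Qpart a l \<gamma>; L = lseq a l \<gamma>;
          \<rho> = (\<lambda>i. gamma_minus a \<gamma> (rseq a l \<gamma> i))
      in
     (\<forall>i j. i \<le> j + 1 \<and> j \<le> i + 1 \<longrightarrow>
        Ck_closure 2 (P i j) u \<and>
        (\<forall>p \<in> closure (P i j).
           D_t (P i j) (D_t (P i j) u) p - a\<^sup>2 * D_x (P i j) (D_x (P i j) u) p = 0)) \<and>
     (\<forall>x \<in> {0..l}. u (0, x) = 0 \<and> D_t (P 0 0) u (0, x) = 0) \<and>
     (\<forall>t \<ge> 0. u (t, \<gamma> t) = 0) \<and>
     (\<forall>j. \<forall>t \<in> {L j..L (Suc j)}.
        D_t (P j (Suc j)) (D_t (P j (Suc j)) u) (t, l) + b * D_x (P j (Suc j)) u (t, l) = 0) \<and>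
     (\<forall>i t. (t, \<rho> i + a * t) \<in> Q \<longrightarrow> has_jump u t (\<rho> i + a * t) 0) \<and>
     (\<forall>i t. (t, l + a * L i - a * t) \<in> Q \<longrightarrow> has_jump u t (l + a * L i - a * t) 0) \<and>
     (\<forall>i t. (t, l + a * L i - a * t) \<in> Q \<and>
            (\<forall>k. (l + a * L i - a * t) - a * t \<noteq> \<rho> k) \<longrightarrow>
        has_jump (pd_t u) t (l + a * L i - a * t) (if even i then C i else 0)))"

text \<open>The regular part \<open>u\<^sub>1\<close> solves the problem with \<open>v = 0\<close>. The velocity defect \<open>v\<close> of the problem
  enters the notion of classical solution only through the prescribed jumps \<open>C\<close>, which are
  arbitrary here; hence \<open>v\<close> does not occur on the right-hand side.\<close>

definition classical_solution ::
  "real \<Rightarrow> real \<Rightarrow> real \<Rightarrow> real \<Rightarrow> (real \<Rightarrow> real) \<Rightarrow> (real \<Rightarrow> real) \<Rightarrow> (real \<Rightarrow> real) \<Rightarrow>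
   (real \<Rightarrow> real) \<Rightarrow> (real \<Rightarrow> real) \<Rightarrow> (real \<times> real \<Rightarrow> real) \<Rightarrow> (nat \<Rightarrow> real) \<Rightarrow>
   (real \<times> real \<Rightarrow> real) \<Rightarrow> bool" where
  "classical_solution a l b v \<gamma> \<phi> \<psi> \<mu>1 \<mu>2 f C u \<longleftrightarrow>
     (\<exists>u1 u2. C2_solution a l b 0 \<gamma> \<phi> \<psi> \<mu>1 \<mu>2 f u1 \<and> singular_part a l b \<gamma> C u2 \<and>
        (\<forall>p \<in> closure (Qdom l \<gamma>). u p = u1 p + u2 p))"

text \<open>Functions are total in HOL, so uniqueness is equality on the closure of the domain.\<close>

definition has_unique_classical_solution ::
  "real \<Rightarrow> real \<Rightarrow> real \<Rightarrow> real \<Rightarrow> (real \<Rightarrow> real) \<Rightarrow> (real \<Rightarrow> real) \<Rightarrow> (real \<Rightarrow> real) \<Rightarrow>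
   (real \<Rightarrow> real) \<Rightarrow> (real \<Rightarrow> real) \<Rightarrow> (real \<times> real \<Rightarrow> real) \<Rightarrow> (nat \<Rightarrow> real) \<Rightarrow> bool" where
  "has_unique_classical_solution a l b v \<gamma> \<phi> \<psi> \<mu>1 \<mu>2 f C \<longleftrightarrow>
     (\<exists>u. classical_solution a l b v \<gamma> \<phi> \<psi> \<mu>1 \<mu>2 f C u) \<and>
     (\<forall>u w. classical_solution a l b v \<gamma> \<phi> \<psi> \<mu>1 \<mu>2 f C u \<and>
            classical_solution a l b v \<gamma> \<phi> \<psi> \<mu>1 \<mu>2 f C w \<longrightarrow>
        (\<forall>p \<in> closure (Qdom l \<gamma>). u p = w p))"

end

theory Submission
  imports Defs
begin

text \<open>Write \<open>\<xi> = x - a t\<close> and \<open>\<eta> = x + a t\<close>. Duhamel's integral for an extension of \<open>f\<close> to the whole plane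
gives a C2 function \<open>v\<close> with vanishing Cauchy data that solves the inhomogeneous equation (lemma
\<open>duhamel\<close>), so what remains to be found is a superposition \<open>p(\<xi>) + g(\<eta>)\<close>. The characteristics that
start at the corners \<open>(0, 0)\<close> and \<open>(0, l)\<close> and are reflected at the two ends cut the domain into
cells: row \<open>i\<close> is a range of \<open>\<xi>\<close> and column \<open>j\<close> a range of \<open>\<eta>\<close>, and on them one looks for functions
\<open>p\<^sub>i\<close> and \<open>g\<^sub>j\<close>. The initial data determine \<open>p\<^sub>0\<close> and \<open>g\<^sub>0\<close>; the condition at the moving wall
determines \<open>p\<^sub>i\<^sub>+\<^sub>1\<close> from \<open>g\<^sub>i\<close>; the condition at \<open>x = l\<close> is a linear second-order equation for
\<open>g\<^sub>j\<^sub>+\<^sub>1\<close> with \<open>p\<^sub>j\<close> as a source, and continuity together with the prescribed jump of the time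
derivative supplies its two initial values (lemma \<open>wave_sequence\<close>). Thus a piecewise C2 solution
exists for arbitrary jumps as soon as \<open>\<mu>\<^sub>1(0) = \<phi>(0)\<close> (lemma \<open>U_piecewise_solution\<close>); for zero data
it is the singular part.

It is also the only one (lemma \<open>piecewise_solution_zero\<close>). A solution of the homogeneous equation
satisfies the parallelogram identity on characteristic rectangles, so on a cell it is determined by
its values on two edges, and with zero data it vanishes on one cell after the other. Consequently
the singular part always exists and is unique, the regular part is unique, and the theorem is a
statement about the existence of the regular part (lemma \<open>has_unique_classical_solution_iff\<close>).

Take the piecewise solution with all jumps zero. It is a regular part if neighbouring pieces agree
to second order at the nodes of the grid. Agreement is passed on by the reflections (lemma
\<open>pieces_agree\<close>), so it suffices to have it at the first nodes \<open>\<xi> = 0\<close> and \<open>\<eta> = l\<close>, where it amounts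
to the matching conditions at \<open>(0, 0)\<close> and at \<open>(0, l)\<close> (lemmas \<open>agree_wall_iff\<close> and
\<open>agree_right_iff\<close>). Conversely a regular part is a piecewise solution with zero jumps, hence equal to
the constructed one, and its smoothness across the two characteristics \<open>\<xi> = 0\<close> and \<open>\<eta> = l\<close> forces
the pieces to agree there (lemma \<open>C2_solution_forces_agreement\<close>).\<close>

section \<open>Functions of class C2 on the real line\<close>

lemma DERIV_continuous_UNIV:
  assumes "\<And>x. (h has_real_derivative h' x) (at x)"
  shows "continuous_on S h"
  using assms by (meson DERIV_isCont continuous_at_imp_continuous_on)

text \<open>The antiderivative vanishing at 0; the case distinction makes it correct on both sides of 0.\<close>

definition prim :: "(real \<Rightarrow> real) \<Rightarrow> real \<Rightarrow> real" where
  "prim h x = (if 0 \<le> x then integral {0..x} h else - integral {x..0} h)"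

lemma prim_0 [simp]: "prim h 0 = 0"
  by (simp add: prim_def)

lemma DERIV_prim:
  assumes "continuous_on UNIV h"
  shows "(prim h has_real_derivative h x) (at x)"
proof -
  define M where "M = \<bar>x\<bar> + 1"
  have cont: "continuous_on S h" for S
    using assms continuous_on_subset by blast
  have int: "h integrable_on {u..v}" for u v
    by (rule integrable_continuous_real) (rule cont)
  have eq: "prim h y = integral {-M..y} h - integral {-M..0} h" if "y \<in> {-M<..<M}" for y
  proof (cases "0 \<le> y")
    case True
    have "integral {-M..0} h + integral {0..y} h = integral {-M..y} h"
      using True M_def by (intro Henstock_Kurzweil_Integration.integral_combine int) auto
    then show ?thesis using True by (simp add: prim_def)
  next
    case False
    have "integral {-M..y} h + integral {y..0} h = integral {-M..0} h"
      using False that by (intro Henstock_Kurzweil_Integration.integral_combine int) auto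
    then show ?thesis using False by (simp add: prim_def)
  qed
  have x: "x \<in> {-M<..<M}" by (auto simp: M_def)
  have "((\<lambda>y. integral {-M..y} h) has_real_derivative h x) (at x within {-M..M})"
    using x by (intro integral_has_real_derivative cont) auto
  then have "((\<lambda>y. integral {-M..y} h) has_real_derivative h x) (at x)"
    using x by (subst (asm) at_within_interior) auto
  then have "((\<lambda>y. integral {-M..y} h - integral {-M..0} h) has_real_derivative h x - 0) (at x)"
    by (intro DERIV_diff DERIV_const)
  from has_field_derivative_transform_within_open[OF this _ x, of "prim h"] eq
  show ?thesis by simp
qed

text \<open>Substituting \<open>s x\<close> for the integration variable moves the variable bound into the integrand, so that
the theorems on parameter integrals over a fixed interval become applicable.\<close>

lemma prim_unit_interval:
  assumes "continuous_on UNIV h"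
  shows "prim h x = x * integral {0..1} (\<lambda>s. h (s * x))"
proof -
  have d: "((\<lambda>s. prim h (s * x)) has_real_derivative h (s * x) * x) (at s within {0..1})" for s
    by (rule DERIV_chain2[OF DERIV_prim[OF assms]]) (auto intro!: derivative_eq_intros)
  have "((\<lambda>s. h (s * x) * x) has_integral (prim h (1 * x) - prim h (0 * x))) {0..1}"
    by (rule fundamental_theorem_of_calculus)
       (simp_all add: d flip: has_real_derivative_iff_has_vector_derivative)
  from integral_unique[OF this] show ?thesis by (simp add: mult.commute)
qed

definition C2_line :: "(real \<Rightarrow> real) \<Rightarrow> bool" where
  "C2_line h \<longleftrightarrow> (\<forall>x. (h has_real_derivative deriv h x) (at x)) \<and>
     (\<forall>x. (deriv h has_real_derivative deriv (deriv h) x) (at x)) \<and>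
     continuous_on UNIV (deriv (deriv h))"

lemma C2_lineI:
  assumes "\<And>x. (h has_real_derivative h1 x) (at x)" "\<And>x. (h1 has_real_derivative h2 x) (at x)"
    and "continuous_on UNIV h2"
  shows "C2_line h" "deriv h = h1" "deriv (deriv h) = h2"
proof -
  show 1: "deriv h = h1" by (rule ext, rule DERIV_imp_deriv, rule assms(1))
  moreover have 2: "deriv h1 = h2" by (rule ext, rule DERIV_imp_deriv, rule assms(2))
  ultimately show "deriv (deriv h) = h2" by simp
  show "C2_line h" using assms by (simp add: C2_line_def 1 2)
qed

lemma C2_lineD:
  assumes "C2_line h"
  shows "(h has_real_derivative deriv h x) (at x)"
    "(deriv h has_real_derivative deriv (deriv h) x) (at x)"
    "continuous_on UNIV (deriv (deriv h))" "continuous_on UNIV (deriv h)" "continuous_on UNIV h"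
proof -
  show 1: "(h has_real_derivative deriv h x) (at x)" for x using assms by (simp add: C2_line_def)
  show 2: "(deriv h has_real_derivative deriv (deriv h) x) (at x)" for x
    using assms by (simp add: C2_line_def)
  show "continuous_on UNIV (deriv (deriv h))" using assms by (simp add: C2_line_def)
  show "continuous_on UNIV (deriv h)" by (rule DERIV_continuous_UNIV[OF 2])
  show "continuous_on UNIV h" by (rule DERIV_continuous_UNIV[OF 1])
qed

lemma C2_line_continuous_comp:
  assumes "C2_line h" "continuous_on S k"
  shows "continuous_on S (\<lambda>x. h (k x))" "continuous_on S (\<lambda>x. deriv h (k x))"
    "continuous_on S (\<lambda>x. deriv (deriv h) (k x))"
  using assms C2_lineD(3-5)[OF assms(1)] by (auto intro: continuous_on_compose2)

lemma C2_line_DERIV_comp: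
  assumes "C2_line h" "(k has_real_derivative k') (at x)"
  shows "((\<lambda>x. h (k x)) has_real_derivative deriv h (k x) * k') (at x)"
    "((\<lambda>x. deriv h (k x)) has_real_derivative deriv (deriv h) (k x) * k') (at x)"
  using assms C2_lineD(1,2)[OF assms(1)] by (auto intro: DERIV_chain2)

lemma C2_line_add:
  assumes "C2_line h" "C2_line k"
  shows "C2_line (\<lambda>x. h x + k x)" "deriv (\<lambda>x. h x + k x) = (\<lambda>x. deriv h x + deriv k x)"
    "deriv (deriv (\<lambda>x. h x + k x)) = (\<lambda>x. deriv (deriv h) x + deriv (deriv k) x)"
  by (rule C2_lineI[of "\<lambda>x. h x + k x" "\<lambda>x. deriv h x + deriv k x"
      "\<lambda>x. deriv (deriv h) x + deriv (deriv k) x"];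
      use assms in \<open>auto intro!: derivative_eq_intros continuous_intros C2_lineD[OF assms(1)]
        C2_lineD[OF assms(2)]\<close>)+

lemma C2_line_cmul:
  assumes "C2_line h"
  shows "C2_line (\<lambda>x. c * h x)" "deriv (\<lambda>x. c * h x) = (\<lambda>x. c * deriv h x)"
    "deriv (deriv (\<lambda>x. c * h x)) = (\<lambda>x. c * deriv (deriv h) x)"
  by (rule C2_lineI[of "\<lambda>x. c * h x" "\<lambda>x. c * deriv h x"
      "\<lambda>x. c * deriv (deriv h) x"];
      use assms in \<open>auto intro!: derivative_eq_intros continuous_intros C2_lineD[OF assms]\<close>)+

lemma C2_line_diff:
  assumes "C2_line h" "C2_line k"
  shows "C2_line (\<lambda>x. h x - k x)" "deriv (\<lambda>x. h x - k x) = (\<lambda>x. deriv h x - deriv k x)"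
    "deriv (deriv (\<lambda>x. h x - k x)) = (\<lambda>x. deriv (deriv h) x - deriv (deriv k) x)"
  using C2_line_add[OF assms(1) C2_line_cmul(1)[OF assms(2), of "-1"]]
    C2_line_cmul(2,3)[OF assms(2), of "-1"] by simp_all

lemma C2_line_comp:
  assumes "C2_line h" "C2_line k"
  shows "C2_line (\<lambda>x. h (k x))" "deriv (\<lambda>x. h (k x)) = (\<lambda>x. deriv h (k x) * deriv k x)"
    "deriv (deriv (\<lambda>x. h (k x))) =
      (\<lambda>x. deriv (deriv h) (k x) * (deriv k x)\<^sup>2 + deriv h (k x) * deriv (deriv k) x)"
  by (rule C2_lineI[of "\<lambda>x. h (k x)" "\<lambda>x. deriv h (k x) * deriv k x"
      "\<lambda>x. deriv (deriv h) (k x) * (deriv k x)\<^sup>2 + deriv h (k x) * deriv (deriv k) x"];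
      use assms in \<open>auto intro!: derivative_eq_intros continuous_intros C2_line_DERIV_comp[OF assms(1)]
          C2_line_continuous_comp[OF assms(1)] C2_lineD[OF assms(2)] simp: power2_eq_square\<close>)+

lemma C2_line_affine:
  shows "C2_line (\<lambda>x. m * x + c)" "deriv (\<lambda>x. m * x + c) = (\<lambda>x. m)"
    "deriv (deriv (\<lambda>x. m * x + c)) = (\<lambda>x. 0)"
  by (rule C2_lineI[of "\<lambda>x. m * x + c" "\<lambda>x. m" "\<lambda>x. 0"];
      auto intro!: derivative_eq_intros)+

lemma C2_line_prim:
  assumes "\<And>x. (h has_real_derivative h1 x) (at x)" "continuous_on UNIV h1"
  shows "C2_line (prim h)" "deriv (prim h) = h" "deriv (deriv (prim h)) = h1"
proof -
  have "continuous_on UNIV h"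
    by (rule DERIV_continuous_UNIV[OF assms(1)])
  note I = C2_lineI[of "prim h" h h1, OF DERIV_prim[OF this] assms(1,2)]
  show "C2_line (prim h)" "deriv (prim h) = h" "deriv (deriv (prim h)) = h1" by (fact I)+
qed

lemma C2_line_inverse:
  assumes h: "C2_line h" and neg: "\<And>x. deriv h x < 0" and surj: "surj h"
  obtains k where "C2_line k" "\<And>x. k (h x) = x" "\<And>y. h (k y) = y"
proof
  \<comment> \<open>a decreasing bijection; the inverse function theorem applies because the slope never vanishes\<close>
  define k where "k = inv h"
  have dec: "h x > h y" if "x < y" for x y
    using DERIV_neg_imp_decreasing[OF that, of h] C2_lineD(1)[OF h] neg by metis
  have "inj h" by (metis dec injI less_irrefl linorder_less_linear)
  then show kh: "k (h x) = x" for x by (simp add: k_def)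
  show hk: "h (k y) = y" for y by (simp add: k_def surj surj_f_inv_f)
  have contk: "isCont k y" for y
  proof -
    have "isCont k (h (k y))"
      by (rule isCont_inverse_function[where d=1 and x="k y" and g=k and f=h])
         (use kh C2_lineD(1)[OF h] in \<open>auto intro: DERIV_isCont\<close>)
    then show ?thesis by (simp add: hk)
  qed
  have d1: "(k has_real_derivative inverse (deriv h (k y))) (at y)" for y
    by (rule DERIV_inverse_function[where f=h and g=k and a="y - 1" and b="y + 1"])
       (use contk hk neg C2_lineD(1)[OF h] in \<open>auto simp: less_imp_neq\<close>)
  have ne: "deriv h x \<noteq> 0" for x using neg[of x] by auto
  have ck: "continuous_on UNIV k" using contk by (simp add: continuous_on_eq_continuous_at)
  show "C2_line k"
    by (rule C2_lineI(1)[of k "\<lambda>y. inverse (deriv h (k y))"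
          "\<lambda>y. - (inverse (deriv h (k y)) *
             (deriv (deriv h) (k y) * inverse (deriv h (k y))) * inverse (deriv h (k y)))"])
       (use ne h ck in \<open>auto intro!: derivative_eq_intros d1 continuous_intros C2_line_DERIV_comp[OF h]
          C2_line_continuous_comp[OF h]\<close>)
qed

text \<open>Variation of constants for \<open>w = g'\<close>, with the integrating factor \<open>exp (\<kappa> x)\<close>. This is the equation
to which the dynamic boundary condition at \<open>x = l\<close> reduces.\<close>

lemma damped_equation_solvable:
  assumes q: "continuous_on UNIV q"
  obtains g where "C2_line g" "g c = y0" "deriv g c = y1"
    "\<And>x. deriv (deriv g) x + \<kappa> * deriv g x = q x"
proof
  define E where "E x = exp (\<kappa> * x)" for x
  have E: "(E has_real_derivative \<kappa> * E x) (at x)" for x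
    unfolding E_def by (auto intro!: derivative_eq_intros)
  have cE: "continuous_on UNIV E" unfolding E_def by (intro continuous_intros)
  have Epos: "E x \<noteq> 0" for x by (simp add: E_def)
  define P where "P = prim (\<lambda>s. E s * q s)"
  have P: "(P has_real_derivative E x * q x) (at x)" for x
    unfolding P_def by (rule DERIV_prim) (intro continuous_intros cE q)
  define w where "w x = (E c * y1 + P x - P c) / E x" for x
  have w: "(w has_real_derivative q x - \<kappa> * w x) (at x)" for x
    unfolding w_def
    by (rule derivative_eq_intros P E refl | use Epos[of x] in \<open>simp add: field_simps\<close>)+
  define g where "g x = y0 + prim w x - prim w c" for x
  have cw: "continuous_on UNIV w"
    by (rule DERIV_continuous_UNIV[OF w])
  have g: "(g has_real_derivative w x) (at x)" for x
    unfolding g_def by (auto intro!: derivative_eq_intros DERIV_prim cw)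
  note I = C2_lineI[OF g w, OF continuous_on_diff[OF q continuous_on_mult_left[OF cw]]]
  show "C2_line g" by (fact I(1))
  show "g c = y0" by (simp add: g_def)
  show "deriv g c = y1" using Epos by (simp add: I(2) w_def)
  show "deriv (deriv g) x + \<kappa> * deriv g x = q x" for x
    by (simp add: I(3)) (simp add: I(2))
qed

text \<open>Both sides have the same derivative within the convex set \<open>S\<close> and agree at 0. Any continuous
extension \<open>K\<close> of the derivative of \<open>h\<close> therefore yields a differentiable extension of \<open>h\<close>; the next
lemmas iterate this to turn data of class C1 and C2 on an interval into functions on the whole line.\<close>

lemma extend_primitive:
  assumes S: "convex S" "0 \<in> S" and h: "h differentiable_on S"
    and K: "continuous_on UNIV K" "\<And>x. x \<in> S \<Longrightarrow> K x = deriv_on S h x" and x: "x \<in> S"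
  shows "h 0 + prim K x = h x"
proof -
  have "((\<lambda>y. h 0 + prim K y - h y) has_real_derivative 0) (at y within S)" if "y \<in> S" for y
  proof -
    have "(h has_vector_derivative deriv_on S h y) (at y within S)"
      using h that unfolding deriv_on_def differentiable_on_def
      by (metis vector_derivative_works)
    then have "(h has_real_derivative K y) (at y within S)"
      using K(2)[OF that] by (simp add: has_real_derivative_iff_has_vector_derivative)
    then show ?thesis
      by (auto intro!: derivative_eq_intros DERIV_subset[OF DERIV_prim[OF K(1)]])
  qed
  from has_field_derivative_zero_constant[OF S(1) this]
  obtain c where c: "\<And>x. x \<in> S \<Longrightarrow> h 0 + prim K x - h x = c" by blast
  from c[OF S(2)] c[OF x] show ?thesis by simp
qed

lemma clamp_extension:
  fixes k :: "real \<Rightarrow> real"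
  assumes "convex S" "closed S" "0 \<in> S" "continuous_on S k"
  obtains K where "continuous_on UNIV K" "\<And>x. x \<in> S \<Longrightarrow> K x = k x"
proof
  show "continuous_on UNIV (\<lambda>x. k (closest_point S x))"
    by (rule continuous_on_compose2[OF assms(4) continuous_on_closest_point])
       (use assms closest_point_in_set in auto)
qed (auto simp: closest_point_self)

lemma extend_C1:
  assumes S: "convex S" "closed S" "0 \<in> S" and h: "Ck_on 1 S h"
  obtains H where "\<And>x. (H has_real_derivative deriv H x) (at x)" "continuous_on UNIV (deriv H)"
    "\<And>x. x \<in> S \<Longrightarrow> H x = h x" "\<And>x. x \<in> S \<Longrightarrow> deriv H x = deriv_on S h x"
proof -
  have h': "h differentiable_on S" "continuous_on S (deriv_on S h)" using h by auto
  obtain K where K: "continuous_on UNIV K" "\<And>x. x \<in> S \<Longrightarrow> K x = deriv_on S h x"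
    using clamp_extension[OF S h'(2)] by blast
  define H where "H x = h 0 + prim K x" for x
  have d: "(H has_real_derivative K x) (at x)" for x
    unfolding H_def by (auto intro!: derivative_eq_intros DERIV_prim K)
  have "deriv H = K" by (rule ext, rule DERIV_imp_deriv, rule d)
  with d K extend_primitive[OF S(1,3) h'(1) K] show thesis
    by (intro that[of H]) (auto simp: H_def)
qed

lemma extend_C2:
  assumes S: "convex S" "closed S" "0 \<in> S" and h: "Ck_on 2 S h"
  obtains H where "C2_line H" "\<And>x. x \<in> S \<Longrightarrow> H x = h x"
    "\<And>x. x \<in> S \<Longrightarrow> deriv H x = deriv_on S h x"
    "\<And>x. x \<in> S \<Longrightarrow> deriv (deriv H) x = deriv_on S (deriv_on S h) x"
proof -
  have h': "h differentiable_on S" "Ck_on 1 S (deriv_on S h)"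
    using h by (simp_all add: numeral_2_eq_2)
  obtain K where K: "\<And>x. (K has_real_derivative deriv K x) (at x)" "continuous_on UNIV (deriv K)"
    "\<And>x. x \<in> S \<Longrightarrow> K x = deriv_on S h x"
    "\<And>x. x \<in> S \<Longrightarrow> deriv K x = deriv_on S (deriv_on S h) x"
    using extend_C1[OF S h'(2)] by blast
  have cK: "continuous_on UNIV K"
    by (rule DERIV_continuous_UNIV[OF K(1)])
  define H where "H x = h 0 + prim K x" for x
  have d: "(H has_real_derivative K x) (at x)" for x
    unfolding H_def by (auto intro!: derivative_eq_intros DERIV_prim cK)
  note I = C2_lineI[OF d K(1,2)]
  from I K(3,4) extend_primitive[OF S(1,3) h'(1) cK K(3)] show thesis
    by (intro that[of H]) (auto simp: H_def)
qed

section \<open>Functions of class C2 on closures of plane sets, and the wave equation\<close>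

text \<open>The relational counterpart of \<open>Ck_closure 1\<close>: the extended partial derivatives are arguments, so
that they can be given by formulas. The two notions are connected by the lemmas on \<open>D_t\<close> and \<open>D_x\<close>
below.\<close>

definition C1_on :: "(real \<times> real) set \<Rightarrow> (real \<times> real \<Rightarrow> real) \<Rightarrow> (real \<times> real \<Rightarrow> real) \<Rightarrow>
    (real \<times> real \<Rightarrow> real) \<Rightarrow> bool" where
  "C1_on S u ut ux \<longleftrightarrow> continuous_on (closure S) u \<and> continuous_on (closure S) ut \<and>
     continuous_on (closure S) ux \<and>
     (\<forall>t x. (t, x) \<in> interior S \<longrightarrow> ((\<lambda>s. u (s, x)) has_real_derivative ut (t, x)) (at t) \<and>
        ((\<lambda>y. u (t, y)) has_real_derivative ux (t, x)) (at x))"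

definition C2_on :: "(real \<times> real) set \<Rightarrow> (real \<times> real \<Rightarrow> real) \<Rightarrow> (real \<times> real \<Rightarrow> real) \<Rightarrow>
    (real \<times> real \<Rightarrow> real) \<Rightarrow> (real \<times> real \<Rightarrow> real) \<Rightarrow> (real \<times> real \<Rightarrow> real) \<Rightarrow>
    (real \<times> real \<Rightarrow> real) \<Rightarrow> (real \<times> real \<Rightarrow> real) \<Rightarrow> bool" where
  "C2_on S u ut ux utt utx uxt uxx \<longleftrightarrow>
     C1_on S u ut ux \<and> C1_on S ut utt utx \<and> C1_on S ux uxt uxx"

lemma C1_on_D:
  assumes "C1_on S u ut ux"
  shows "continuous_on (closure S) u" "continuous_on (closure S) ut" "continuous_on (closure S) ux"
    "(t, x) \<in> interior S \<Longrightarrow> ((\<lambda>s. u (s, x)) has_real_derivative ut (t, x)) (at t)"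
    "(t, x) \<in> interior S \<Longrightarrow> ((\<lambda>y. u (t, y)) has_real_derivative ux (t, x)) (at x)"
  using assms by (auto simp: C1_on_def)

lemma C2_on_D:
  assumes "C2_on S u ut ux utt utx uxt uxx"
  shows "C1_on S u ut ux" "C1_on S ut utt utx" "C1_on S ux uxt uxx"
  using assms by (auto simp: C2_on_def)

lemma open_slices:
  fixes U :: "('a::topological_space \<times> 'b::topological_space) set"
  assumes "open U"
  shows "open {s. (s, x) \<in> U}" "open {y. (t, y) \<in> U}"
proof -
  have "open ((\<lambda>s. (s, x)) -` U)" "open ((\<lambda>y. (t, y)) -` U)"
    using assms by (auto intro!: open_vimage continuous_intros)
  then show "open {s. (s, x) \<in> U}" "open {y. (t, y) \<in> U}" by (simp_all add: vimage_def)
qed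

lemma C1_on_cong:
  assumes "C1_on S u ut ux"
    and "\<And>p. p \<in> closure S \<Longrightarrow> u' p = u p" "\<And>p. p \<in> closure S \<Longrightarrow> ut' p = ut p"
    and "\<And>p. p \<in> closure S \<Longrightarrow> ux' p = ux p"
  shows "C1_on S u' ut' ux'"
proof -
  have sub: "interior S \<subseteq> closure S"
    using interior_subset closure_subset by blast
  have "((\<lambda>s. u' (s, x)) has_real_derivative ut' (t, x)) (at t) \<and>
        ((\<lambda>y. u' (t, y)) has_real_derivative ux' (t, x)) (at x)" if p: "(t, x) \<in> interior S" for t x
  proof -
    have eq: "u (s, y) = u' (s, y)" if "(s, y) \<in> interior S" for s y
      using that assms(2) sub by auto
    have 1: "((\<lambda>s. u' (s, x)) has_real_derivative ut (t, x)) (at t)"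
      by (rule has_field_derivative_transform_within_open[OF C1_on_D(4)[OF assms(1) p]
            open_slices(1)[OF open_interior[of S]]]) (use p eq in auto)
    have 2: "((\<lambda>y. u' (t, y)) has_real_derivative ux (t, x)) (at x)"
      by (rule has_field_derivative_transform_within_open[OF C1_on_D(5)[OF assms(1) p]
            open_slices(2)[OF open_interior[of S]]]) (use p eq in auto)
    show ?thesis using 1 2 assms(3,4) sub p by auto
  qed
  then show ?thesis
    using C1_on_D(1-3)[OF assms(1)] assms(2-4) unfolding C1_on_def
    by (auto cong: continuous_on_cong)
qed

lemma C1_on_subset:
  assumes "C1_on S u ut ux" "T \<subseteq> S"
  shows "C1_on T u ut ux"
  using assms closure_mono[OF assms(2)] interior_mono[OF assms(2)] unfolding C1_on_def
  by (meson continuous_on_subset subsetD)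

lemma C2_on_subset:
  assumes "C2_on S u ut ux utt utx uxt uxx" "T \<subseteq> S"
  shows "C2_on T u ut ux utt utx uxt uxx"
  using assms C1_on_subset by (auto simp: C2_on_def)

lemma C1_on_add:
  assumes "C1_on S u ut ux" "C1_on S w wt wx"
  shows "C1_on S (\<lambda>p. u p + w p) (\<lambda>p. ut p + wt p) (\<lambda>p. ux p + wx p)"
  using assms unfolding C1_on_def by (auto intro!: continuous_intros DERIV_add)

lemma C1_on_diff:
  assumes "C1_on S u ut ux" "C1_on S w wt wx"
  shows "C1_on S (\<lambda>p. u p - w p) (\<lambda>p. ut p - wt p) (\<lambda>p. ux p - wx p)"
  using assms unfolding C1_on_def by (auto intro!: continuous_intros DERIV_diff)

lemma C2_on_add:
  assumes "C2_on S u ut ux utt utx uxt uxx" "C2_on S w wt wx wtt wtx wxt wxx"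
  shows "C2_on S (\<lambda>p. u p + w p) (\<lambda>p. ut p + wt p) (\<lambda>p. ux p + wx p) (\<lambda>p. utt p + wtt p)
    (\<lambda>p. utx p + wtx p) (\<lambda>p. uxt p + wxt p) (\<lambda>p. uxx p + wxx p)"
  using assms unfolding C2_on_def by (intro conjI C1_on_add) auto

lemma C2_on_diff:
  assumes "C2_on S u ut ux utt utx uxt uxx" "C2_on S w wt wx wtt wtx wxt wxx"
  shows "C2_on S (\<lambda>p. u p - w p) (\<lambda>p. ut p - wt p) (\<lambda>p. ux p - wx p) (\<lambda>p. utt p - wtt p)
    (\<lambda>p. utx p - wtx p) (\<lambda>p. uxt p - wxt p) (\<lambda>p. uxx p - wxx p)"
  using assms unfolding C2_on_def by (intro conjI C1_on_diff) auto

text \<open>At a point of the closure that is not interior the value of \<open>D_t\<close> is a limit along the interior; by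
continuity of the candidate on the closure this limit is the candidate's value. The hypothesis on \<open>S\<close>
makes the limit nontrivial, hence unique.\<close>

lemma D_eq_of_C1_on:
  assumes reg: "S \<subseteq> closure (interior S)" and u: "C1_on S u ut ux"
    and eq: "\<And>p. p \<in> closure S \<Longrightarrow> u' p = u p" and p: "p \<in> closure S"
  shows "D_t S u' p = ut p" "D_x S u' p = ux p"
proof -
  have sub: "interior S \<subseteq> closure S"
    using interior_subset closure_subset by blast
  have u': "C1_on S u' ut ux" using C1_on_cong[OF u eq] by blast
  have int: "pd_t u' q = ut q" "pd_x u' q = ux q" if "q \<in> interior S" for q
    using C1_on_D(4,5)[OF u', of "fst q" "snd q"] that
    by (auto simp: pd_t_def pd_x_def split_beta intro!: DERIV_imp_deriv)
  have ext: "bd_ext S h p = k p"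
    if hk: "\<And>q. q \<in> interior S \<Longrightarrow> h q = k q" and k: "continuous_on (closure S) k" for h k
  proof (cases "p \<in> interior S")
    case True
    then show ?thesis using hk by (simp add: bd_ext_def)
  next
    case False
    have "p \<in> closure (interior S)"
      using p reg by (meson closed_closure closure_minimal subsetD)
    then have nt: "\<not> trivial_limit (at p within interior S)"
      using False by (simp add: closure_def trivial_limit_within)
    have "(k \<longlongrightarrow> k p) (at p within interior S)"
      using k p sub by (meson continuous_on_def tendsto_within_subset)
    then have "(h \<longlongrightarrow> k p) (at p within interior S)"
      by (rule Lim_transform_eventually) (auto simp: hk eventually_at_filter)
    then show ?thesis using False nt by (simp add: bd_ext_def tendsto_Lim)
  qed
  show "D_t S u' p = ut p" unfolding D_t_def
    by (rule ext) (use int C1_on_D(2)[OF u] in auto)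
  show "D_x S u' p = ux p" unfolding D_x_def
    by (rule ext) (use int C1_on_D(3)[OF u] in auto)
qed

lemma Ck_closure_1_iff: "Ck_closure 1 S u \<longleftrightarrow> C1_on S u (D_t S u) (D_x S u)"
proof -
  have 1: "D_t S u (t, x) = deriv (\<lambda>s. u (s, x)) t" "D_x S u (t, x) = deriv (\<lambda>y. u (t, y)) x"
    if "(t, x) \<in> interior S" for t x
    using that by (auto simp: D_t_def D_x_def bd_ext_def pd_t_def pd_x_def)
  have 2: "((\<lambda>s. u (s, x)) differentiable (at t) \<and> (\<lambda>y. u (t, y)) differentiable (at x)) \<longleftrightarrow>
     ((\<lambda>s. u (s, x)) has_real_derivative D_t S u (t, x)) (at t) \<and>
        ((\<lambda>y. u (t, y)) has_real_derivative D_x S u (t, x)) (at x)"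
    if "(t, x) \<in> interior S" for t x
    using 1[OF that] by (metis DERIV_imp_deriv real_differentiable_def)
  show ?thesis unfolding C1_on_def by (simp add: Ball_def 2 cong: imp_cong) blast
qed

lemma Ck_closure_2_iff: "Ck_closure 2 S u \<longleftrightarrow>
  C2_on S u (D_t S u) (D_x S u) (D_t S (D_t S u)) (D_x S (D_t S u)) (D_t S (D_x S u)) (D_x S (D_x S u))"
proof -
  have "Ck_closure 2 S u \<longleftrightarrow>
    Ck_closure 1 S u \<and> Ck_closure 1 S (D_t S u) \<and> Ck_closure 1 S (D_x S u)"
    by (auto simp: numeral_2_eq_2)
  then show ?thesis unfolding C2_on_def Ck_closure_1_iff .
qed

lemma C2_on_imp_Ck_closure:
  assumes reg: "S \<subseteq> closure (interior S)" and u: "C2_on S u ut ux utt utx uxt uxx"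
    and eq: "\<And>p. p \<in> closure S \<Longrightarrow> u' p = u p"
  shows "Ck_closure 2 S u'"
    and "\<And>p. p \<in> closure S \<Longrightarrow> D_t S u' p = ut p" "\<And>p. p \<in> closure S \<Longrightarrow> D_x S u' p = ux p"
    and "\<And>p. p \<in> closure S \<Longrightarrow> D_t S (D_t S u') p = utt p"
    and "\<And>p. p \<in> closure S \<Longrightarrow> D_x S (D_x S u') p = uxx p"
proof -
  note 0 = D_eq_of_C1_on[OF reg C2_on_D(1)[OF u] eq]
  note t = D_eq_of_C1_on[OF reg C2_on_D(2)[OF u] 0(1)]
  note x = D_eq_of_C1_on[OF reg C2_on_D(3)[OF u] 0(2)]
  show "Ck_closure 2 S u'" unfolding Ck_closure_2_iff C2_on_def
    using C1_on_cong[OF C2_on_D(1)[OF u] eq 0] C1_on_cong[OF C2_on_D(2)[OF u] 0(1) t]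
      C1_on_cong[OF C2_on_D(3)[OF u] 0(2) x] by blast
qed (use D_eq_of_C1_on[OF reg C2_on_D(1)[OF u] eq]
       D_eq_of_C1_on[OF reg C2_on_D(2)[OF u] D_eq_of_C1_on(1)[OF reg C2_on_D(1)[OF u] eq]]
       D_eq_of_C1_on[OF reg C2_on_D(3)[OF u] D_eq_of_C1_on(2)[OF reg C2_on_D(1)[OF u] eq]] in auto)

lemma C1_on_has_derivative:
  assumes u: "C1_on S u ut ux" and p: "(t, x) \<in> interior S"
  shows "(u has_derivative (\<lambda>(s, y). ut (t, x) * s + ux (t, x) * y)) (at (t, x))"
proof -
  obtain A B where AB: "open A" "open B" "t \<in> A" "x \<in> B" "A \<times> B \<subseteq> interior S"
    using open_prod_elim[OF open_interior p] by (metis mem_Sigma_iff)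
  obtain e where e: "e > 0" "ball x e \<subseteq> B" using AB openE by blast
  define Y where "Y = ball x e"
  have sub: "A \<times> Y \<subseteq> interior S" using AB e Y_def by auto
  have op: "open (A \<times> Y)" "(t, x) \<in> A \<times> Y" using AB e by (auto simp: Y_def open_Times)
  define fy where "fy s y = ux (s, y) *\<^sub>R (id_blinfun :: real \<Rightarrow>\<^sub>L real)" for s y
  have "((\<lambda>(s, y). u (s, y)) has_derivative (\<lambda>(s, y). ut (t, x) * s + fy t x y))
      (at (t, x) within A \<times> Y)"
  proof (rule has_derivative_partialsI)
    show "((\<lambda>s. u (s, x)) has_derivative (*) (ut (t, x))) (at t within A)"
      using C1_on_D(4)[OF u p] by (simp add: has_field_derivative_def has_derivative_at_withinI)
    show "((\<lambda>y. u (s, y)) has_derivative blinfun_apply (fy s y)) (at y within Y)"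
      if "s \<in> A" "y \<in> Y" for s y
    proof -
      have "blinfun_apply (fy s y) = (*) (ux (s, y))" by (auto simp: fy_def scaleR_blinfun.rep_eq)
      then show ?thesis using C1_on_D(5)[OF u, of s y] sub that
        by (auto simp: has_field_derivative_def intro: has_derivative_at_withinI)
    qed
    have "continuous_on (A \<times> Y) ux"
      using C1_on_D(3)[OF u] sub by (meson closure_subset continuous_on_subset interior_subset order_trans)
    then have "continuous_on (A \<times> Y) (\<lambda>(s, y). fy s y)"
      unfolding fy_def split_beta by (auto intro!: continuous_intros)
    then show "continuous (at (t, x) within A \<times> Y) (\<lambda>(s, y). fy s y)"
      using op by (simp add: continuous_on_eq_continuous_within)
    show "x \<in> Y" "convex Y" using e by (auto simp: Y_def)
  qed
  then show ?thesis
    unfolding at_within_open[OF op(2,1)] by (simp add: fy_def split_beta scaleR_blinfun.rep_eq)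
qed

text \<open>Continuity of the partial derivatives gives total differentiability, hence derivatives along curves.
This is what allows differentiation along characteristics.\<close>

lemma C1_on_chain:
  assumes u: "C1_on S u ut ux" and p: "(\<tau> s, \<sigma> s) \<in> interior S"
    and d: "(\<tau> has_real_derivative \<tau>') (at s)" "(\<sigma> has_real_derivative \<sigma>') (at s)"
  shows "((\<lambda>r. u (\<tau> r, \<sigma> r)) has_real_derivative ut (\<tau> s, \<sigma> s) * \<tau>' + ux (\<tau> s, \<sigma> s) * \<sigma>') (at s)"
proof -
  have "((\<lambda>r. (\<tau> r, \<sigma> r)) has_derivative (\<lambda>h. (\<tau>' * h, \<sigma>' * h))) (at s)"
    using d by (auto simp: has_field_derivative_def intro!: has_derivative_Pair)
  from has_derivative_compose[OF this C1_on_has_derivative[OF u p]]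
  show ?thesis unfolding has_field_derivative_def
    by (rule has_derivative_eq_rhs) (auto simp: fun_eq_iff algebra_simps)
qed

text \<open>Schwarz: the second difference over a small square equals, by the mean value theorem applied in the
two possible orders, the area times a value of either mixed derivative in the square.\<close>

lemma mixed_partials_equal:
  assumes u: "C2_on S u ut ux utt utx uxt uxx" and p: "(t, x) \<in> interior S"
  shows "utx (t, x) = uxt (t, x)"
proof (rule ccontr)
  assume neq: "utx (t, x) \<noteq> uxt (t, x)"
  define e where "e = \<bar>utx (t, x) - uxt (t, x)\<bar> / 2"
  have e: "e > 0" using neq by (simp add: e_def)
  have sub: "interior S \<subseteq> closure S" using interior_subset closure_subset by blast
  have cont: "continuous_on (interior S) utx" "continuous_on (interior S) uxt"
    using C1_on_D(3)[OF C2_on_D(2)[OF u]] C1_on_D(2)[OF C2_on_D(3)[OF u]] sub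
    by (auto intro: continuous_on_subset)
  have ev: "\<forall>\<^sub>F q in nhds (t, x). q \<in> interior S \<and> dist (utx q) (utx (t, x)) < e \<and>
      dist (uxt q) (uxt (t, x)) < e"
  proof (intro eventually_conj)
    show "\<forall>\<^sub>F q in nhds (t, x). q \<in> interior S" using p by (intro eventually_nhds_in_open) auto
    have "isCont utx (t, x)" "isCont uxt (t, x)"
      using cont p by (auto simp: continuous_on_eq_continuous_at)
    then show "\<forall>\<^sub>F q in nhds (t, x). dist (utx q) (utx (t, x)) < e"
      "\<forall>\<^sub>F q in nhds (t, x). dist (uxt q) (uxt (t, x)) < e"
      using e unfolding continuous_at tendsto_at_iff_tendsto_nhds by (blast dest: tendstoD)+
  qed
  then obtain d where d: "d > 0" "\<And>q. dist q (t, x) < d \<Longrightarrow> q \<in> interior S \<and>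
      dist (utx q) (utx (t, x)) < e \<and> dist (uxt q) (uxt (t, x)) < e"
    unfolding eventually_nhds_metric by blast
  define h where "h = d / 3"
  have h: "h > 0" using d by (simp add: h_def)
  have sq: "dist (s, y) (t, x) < d" if "t \<le> s" "s \<le> t + h" "x \<le> y" "y \<le> x + h" for s y
  proof -
    have "dist (s, y) (t, x) \<le> \<bar>s - t\<bar> + \<bar>y - x\<bar>"
      unfolding dist_Pair_Pair dist_real_def using sqrt_sum_squares_le_sum_abs by simp
    then show ?thesis using that d(1) by (simp add: h_def)
  qed
  note int = sq[THEN d(2), THEN conjunct1]
  note du = C1_on_D(4,5)[OF C2_on_D(1)[OF u]]
  note dtx = C1_on_D(5)[OF C2_on_D(2)[OF u]] and dxt = C1_on_D(4)[OF C2_on_D(3)[OF u]]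
  have "\<exists>s. t < s \<and> s < t + h \<and> (u (t + h, x + h) - u (t + h, x)) - (u (t, x + h) - u (t, x)) =
      (t + h - t) * (ut (s, x + h) - ut (s, x))"
    by (rule MVT2) (use h int in \<open>auto intro!: DERIV_diff du\<close>)
  then obtain s1 where s1: "t < s1" "s1 < t + h"
    "(u (t + h, x + h) - u (t + h, x)) - (u (t, x + h) - u (t, x)) = h * (ut (s1, x + h) - ut (s1, x))"
    by auto
  have "\<exists>y. x < y \<and> y < x + h \<and> ut (s1, x + h) - ut (s1, x) = (x + h - x) * utx (s1, y)"
    by (rule MVT2) (use h int s1 in \<open>auto intro!: dtx\<close>)
  then obtain y1 where y1: "x < y1" "y1 < x + h" "ut (s1, x + h) - ut (s1, x) = h * utx (s1, y1)"
    by auto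
  have "\<exists>y. x < y \<and> y < x + h \<and> (u (t + h, x + h) - u (t, x + h)) - (u (t + h, x) - u (t, x)) =
      (x + h - x) * (ux (t + h, y) - ux (t, y))"
    by (rule MVT2) (use h int in \<open>auto intro!: DERIV_diff du\<close>)
  then obtain y2 where y2: "x < y2" "y2 < x + h"
    "(u (t + h, x + h) - u (t, x + h)) - (u (t + h, x) - u (t, x)) = h * (ux (t + h, y2) - ux (t, y2))"
    by auto
  have "\<exists>s. t < s \<and> s < t + h \<and> ux (t + h, y2) - ux (t, y2) = (t + h - t) * uxt (s, y2)"
    by (rule MVT2) (use h int y2 in \<open>auto intro!: dxt\<close>)
  then obtain s2 where s2: "t < s2" "s2 < t + h" "ux (t + h, y2) - ux (t, y2) = h * uxt (s2, y2)"
    by auto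
  have "h * (h * utx (s1, y1)) = h * (h * uxt (s2, y2))"
    using s1(3) y2(3) unfolding y1(3) s2(3) by linarith
  then have eq: "utx (s1, y1) = uxt (s2, y2)" using h by simp
  have "dist (utx (s1, y1)) (utx (t, x)) < e" "dist (uxt (s2, y2)) (uxt (t, x)) < e"
    using d(2)[OF sq[of s1 y1]] d(2)[OF sq[of s2 y2]] s1 y1 s2 y2 by auto
  then show False using eq unfolding e_def dist_real_def by (smt (verit) field_sum_of_halves)
qed

definition char_pt :: "real \<Rightarrow> real \<Rightarrow> real \<Rightarrow> real \<times> real" where
  "char_pt a \<xi> \<eta> = ((\<eta> - \<xi>) / (2 * a), (\<xi> + \<eta>) / 2)"

lemma char_pt_self: "a \<noteq> 0 \<Longrightarrow> char_pt a (x - a * t) (x + a * t) = (t, x)"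
  by (simp add: char_pt_def field_simps)

lemma char_pt_coords:
  assumes "a \<noteq> 0"
  shows "snd (char_pt a \<xi> \<eta>) - a * fst (char_pt a \<xi> \<eta>) = \<xi>"
    "snd (char_pt a \<xi> \<eta>) + a * fst (char_pt a \<xi> \<eta>) = \<eta>"
  using assms by (simp_all add: char_pt_def field_simps)

lemma C1_on_char_derivs:
  assumes u: "C1_on S u ut ux" and a: "a > 0" and p: "char_pt a \<xi> \<eta> \<in> interior S"
  shows "((\<lambda>r. u (char_pt a \<xi> r)) has_real_derivative
          ut (char_pt a \<xi> \<eta>) / (2 * a) + ux (char_pt a \<xi> \<eta>) / 2) (at \<eta>)"
    "((\<lambda>r. u (char_pt a r \<eta>)) has_real_derivative
          - ut (char_pt a \<xi> \<eta>) / (2 * a) + ux (char_pt a \<xi> \<eta>) / 2) (at \<xi>)"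
proof -
  have "((\<lambda>r. u ((r - \<xi>) / (2 * a), (\<xi> + r) / 2)) has_real_derivative
      ut ((\<eta> - \<xi>) / (2 * a), (\<xi> + \<eta>) / 2) * (1 / (2 * a)) +
      ux ((\<eta> - \<xi>) / (2 * a), (\<xi> + \<eta>) / 2) * (1 / 2)) (at \<eta>)"
    using a p by (intro C1_on_chain[OF u]) (auto simp: char_pt_def intro!: derivative_eq_intros)
  then show "((\<lambda>r. u (char_pt a \<xi> r)) has_real_derivative
          ut (char_pt a \<xi> \<eta>) / (2 * a) + ux (char_pt a \<xi> \<eta>) / 2) (at \<eta>)"
    by (simp add: char_pt_def)
  have "((\<lambda>r. u ((\<eta> - r) / (2 * a), (r + \<eta>) / 2)) has_real_derivative
      ut ((\<eta> - \<xi>) / (2 * a), (\<xi> + \<eta>) / 2) * (- 1 / (2 * a)) +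
      ux ((\<eta> - \<xi>) / (2 * a), (\<xi> + \<eta>) / 2) * (1 / 2)) (at \<xi>)"
    using a p by (intro C1_on_chain[OF u]) (auto simp: char_pt_def intro!: derivative_eq_intros)
  then show "((\<lambda>r. u (char_pt a r \<eta>)) has_real_derivative
          - ut (char_pt a \<xi> \<eta>) / (2 * a) + ux (char_pt a \<xi> \<eta>) / 2) (at \<xi>)"
    by (simp add: char_pt_def)
qed

text \<open>Write the solution as a function of \<open>\<xi>\<close> and \<open>\<eta>\<close>. Its derivative in \<open>\<eta>\<close> is a multiple of
\<open>u\<^sub>t + a u\<^sub>x\<close>, and by the wave equation this does not change with \<open>\<xi>\<close>; hence the difference over
an interval of \<open>\<xi>\<close> is constant in \<open>\<eta>\<close>. The equation is required in the open rectangle and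
continuity on the closed one, so the identity can be used up to the edges of a cell.\<close>

lemma parallelogram_identity:
  assumes a: "a > 0" and u: "C2_on S u ut ux utt utx uxt uxx"
    and wave: "\<And>p. p \<in> interior S \<Longrightarrow> utt p = a\<^sup>2 * uxx p"
    and lt: "\<xi>1 < \<xi>2" "\<eta>1 < \<eta>2"
    and int: "\<And>\<xi> \<eta>. \<xi>1 < \<xi> \<Longrightarrow> \<xi> < \<xi>2 \<Longrightarrow> \<eta>1 < \<eta> \<Longrightarrow> \<eta> < \<eta>2 \<Longrightarrow> char_pt a \<xi> \<eta> \<in> interior S"
    and cl: "\<And>\<xi> \<eta>. \<xi>1 \<le> \<xi> \<Longrightarrow> \<xi> \<le> \<xi>2 \<Longrightarrow> \<eta>1 \<le> \<eta> \<Longrightarrow> \<eta> \<le> \<eta>2 \<Longrightarrow> char_pt a \<xi> \<eta> \<in> closure S"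
  shows "u (char_pt a \<xi>1 \<eta>1) + u (char_pt a \<xi>2 \<eta>2) = u (char_pt a \<xi>1 \<eta>2) + u (char_pt a \<xi>2 \<eta>1)"
proof -
  define U where "U \<xi> \<eta> = u (char_pt a \<xi> \<eta>)" for \<xi> \<eta>
  define V where "V \<xi> \<eta> = ut (char_pt a \<xi> \<eta>) / (2 * a) + ux (char_pt a \<xi> \<eta>) / 2" for \<xi> \<eta>
  have dU: "((\<lambda>r. U \<xi> r) has_real_derivative V \<xi> \<eta>) (at \<eta>)"
    if "\<xi>1 < \<xi>" "\<xi> < \<xi>2" "\<eta>1 < \<eta>" "\<eta> < \<eta>2" for \<xi> \<eta>
    unfolding U_def V_def by (rule C1_on_char_derivs(1)[OF C2_on_D(1)[OF u] a int[OF that]])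
  have dV: "((\<lambda>r. V r \<eta>) has_real_derivative 0) (at \<xi>)"
    if b: "\<xi>1 < \<xi>" "\<xi> < \<xi>2" "\<eta>1 < \<eta>" "\<eta> < \<eta>2" for \<xi> \<eta>
  proof -
    let ?p = "char_pt a \<xi> \<eta>"
    note p = int[OF b]
    have "((\<lambda>r. V r \<eta>) has_real_derivative
        (- utt ?p / (2 * a) + utx ?p / 2) / (2 * a) + (- uxt ?p / (2 * a) + uxx ?p / 2) / 2) (at \<xi>)"
      unfolding V_def
      by (intro DERIV_add DERIV_cdivide C1_on_char_derivs(2)[OF C2_on_D(2)[OF u] a p]
          C1_on_char_derivs(2)[OF C2_on_D(3)[OF u] a p])
    moreover have "(- utt ?p / (2 * a) + utx ?p / 2) / (2 * a) + (- uxt ?p / (2 * a) + uxx ?p / 2) / 2 = 0"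
      using wave[OF p] mixed_partials_equal[OF u, of "fst ?p" "snd ?p"] p a
      by (simp add: field_simps power2_eq_square)
    ultimately show ?thesis by simp
  qed
  have cont: "continuous_on A (\<lambda>r. U (f r) (g r))"
    if "continuous_on A f" "continuous_on A g"
      "\<And>r. r \<in> A \<Longrightarrow> \<xi>1 \<le> f r \<and> f r \<le> \<xi>2 \<and> \<eta>1 \<le> g r \<and> g r \<le> \<eta>2" for A :: "real set" and f g
    unfolding U_def
    by (rule continuous_on_compose2[OF C1_on_D(1)[OF C2_on_D(1)[OF u]]])
       (use that a cl in \<open>auto simp: char_pt_def intro!: continuous_intros\<close>)
  have const: "U \<xi> \<eta>2 - U \<xi> \<eta>1 = U \<xi>' \<eta>2 - U \<xi>' \<eta>1"
    if b: "\<xi>1 < \<xi>" "\<xi> < \<xi>2" "\<xi>1 < \<xi>'" "\<xi>' < \<xi>2" for \<xi> \<xi>'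
  proof -
    have "U \<xi> \<eta>2 - U \<xi>' \<eta>2 = U \<xi> \<eta>1 - U \<xi>' \<eta>1"
    proof (rule DERIV_isconst_end[OF lt(2)])
      show "continuous_on {\<eta>1..\<eta>2} (\<lambda>r. U \<xi> r - U \<xi>' r)"
        using b by (intro continuous_intros cont) auto
      show "((\<lambda>r. U \<xi> r - U \<xi>' r) has_real_derivative 0) (at \<eta>)" if "\<eta>1 < \<eta>" "\<eta> < \<eta>2" for \<eta>
      proof -
        have "V \<xi> \<eta> = V \<xi>' \<eta>"
          by (rule DERIV_isconst3[OF lt(1)]) (use b dV that in auto)
        then show ?thesis using DERIV_diff[OF dU[of \<xi> \<eta>] dU[of \<xi>' \<eta>]] b that by simp
      qed
    qed
    then show ?thesis by simp
  qed
  define m where "m = (\<xi>1 + \<xi>2) / 2"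
  have m: "\<xi>1 < m" "m < \<xi>2" using lt by (auto simp: m_def)
  have "U \<xi>2 \<eta>2 - U \<xi>2 \<eta>1 = U \<xi>1 \<eta>2 - U \<xi>1 \<eta>1"
  proof (rule DERIV_isconst_end[OF lt(1)])
    show "continuous_on {\<xi>1..\<xi>2} (\<lambda>r. U r \<eta>2 - U r \<eta>1)"
      using lt by (intro continuous_intros cont) auto
    show "((\<lambda>r. U r \<eta>2 - U r \<eta>1) has_real_derivative 0) (at \<xi>)" if "\<xi>1 < \<xi>" "\<xi> < \<xi>2" for \<xi>
    proof (rule has_field_derivative_transform_within_open[OF DERIV_const])
      show "open {\<xi>1<..<\<xi>2}" "\<xi> \<in> {\<xi>1<..<\<xi>2}" using that by auto
      show "U m \<eta>2 - U m \<eta>1 = U r \<eta>2 - U r \<eta>1" if "r \<in> {\<xi>1<..<\<xi>2}" for r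
        by (rule const) (use that m in auto)
    qed
  qed
  then show ?thesis by (simp add: U_def)
qed

section \<open>Duhamel's integral and the extension of the data\<close>

lemma in_closure_at_right:
  fixes p :: "real \<Rightarrow> 'a::t2_space"
  assumes "(p \<longlongrightarrow> q) (at_right 0)" "d > 0" "\<And>s. 0 < s \<Longrightarrow> s < d \<Longrightarrow> p s \<in> S"
  shows "q \<in> closure S"
proof (rule Lim_in_closed_set[OF closed_closure _ _ assms(1)])
  have "\<forall>\<^sub>F s in at_right 0. s \<in> {0<..<d}" using assms(2) by (rule eventually_at_right_real)
  then show "\<forall>\<^sub>F s in at_right 0. p s \<in> closure S"
    by (rule eventually_mono) (use assms(3) closure_subset in auto)
qed auto

lemma C1_on_UNIV_I:
  assumes "continuous_on UNIV u" "continuous_on UNIV ut" "continuous_on UNIV ux"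
    and "\<And>t x. ((\<lambda>s. u (s, x)) has_real_derivative ut (t, x)) (at t)"
    and "\<And>t x. ((\<lambda>y. u (t, y)) has_real_derivative ux (t, x)) (at x)"
  shows "C1_on UNIV u ut ux"
  using assms by (simp add: C1_on_def)

lemma C1_on_cmul:
  assumes "C1_on S u ut ux"
  shows "C1_on S (\<lambda>p. c * u p) (\<lambda>p. c * ut p) (\<lambda>p. c * ux p)"
  using assms unfolding C1_on_def by (auto intro!: continuous_intros DERIV_cmult)

lemma C1_on_shift:
  assumes u: "C1_on UNIV u ut ux"
  shows "C1_on UNIV (\<lambda>(t, x). u (t, x + c * t)) (\<lambda>(t, x). ut (t, x + c * t) + c * ux (t, x + c * t))
    (\<lambda>(t, x). ux (t, x + c * t))"
proof (rule C1_on_UNIV_I)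
  have cont: "continuous_on UNIV (\<lambda>(t, x). h (t, x + c * t))" if "continuous_on UNIV h"
    for h :: "real \<times> real \<Rightarrow> real"
    unfolding split_beta
    by (rule continuous_on_compose2[OF that]) (auto intro!: continuous_intros)
  note c = cont[OF C1_on_D(1)[OF u, simplified]] cont[OF C1_on_D(2)[OF u, simplified]]
    cont[OF C1_on_D(3)[OF u, simplified]]
  show "continuous_on UNIV (\<lambda>(t, x). u (t, x + c * t))" by (rule c)
  show "continuous_on UNIV (\<lambda>(t, x). ux (t, x + c * t))" by (rule c)
  show "continuous_on UNIV (\<lambda>(t, x). ut (t, x + c * t) + c * ux (t, x + c * t))"
    using c unfolding split_beta by (intro continuous_intros)
  show "((\<lambda>s. case (s, x) of (t, x) \<Rightarrow> u (t, x + c * t)) has_real_derivative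
      (case (t, x) of (t, x) \<Rightarrow> ut (t, x + c * t) + c * ux (t, x + c * t))) (at t)" for t x
  proof -
    have "((\<lambda>s. x + c * s) has_real_derivative c) (at t)" by (auto intro!: derivative_eq_intros)
    from C1_on_chain[OF u _ DERIV_ident this] show ?thesis by (simp add: mult.commute)
  qed
  show "((\<lambda>y. case (t, y) of (t, x) \<Rightarrow> u (t, x + c * t)) has_real_derivative
      (case (t, x) of (t, x) \<Rightarrow> ux (t, x + c * t))) (at x)" for t x
  proof -
    have "((\<lambda>s. s + c * t) has_real_derivative 1) (at x)" by (auto intro!: derivative_eq_intros)
    from C1_on_chain[OF u _ DERIV_const this] show ?thesis by simp
  qed
qed

lemma C2_on_travelling_wave:
  assumes p: "C2_line p"
  shows "C2_on UNIV (\<lambda>(t, x). p (x + c * t)) (\<lambda>(t, x). c * deriv p (x + c * t))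
    (\<lambda>(t, x). deriv p (x + c * t)) (\<lambda>(t, x). c\<^sup>2 * deriv (deriv p) (x + c * t))
    (\<lambda>(t, x). c * deriv (deriv p) (x + c * t)) (\<lambda>(t, x). c * deriv (deriv p) (x + c * t))
    (\<lambda>(t, x). deriv (deriv p) (x + c * t))"
proof -
  have one: "C1_on UNIV (\<lambda>(t, x). q (x + c * t)) (\<lambda>(t, x). c * q' (x + c * t)) (\<lambda>(t, x). q' (x + c * t))"
    if q: "\<And>x. (q has_real_derivative q' x) (at x)" "continuous_on UNIV q'" for q q'
  proof -
    have "C1_on UNIV (\<lambda>(t, x). q x) (\<lambda>_. 0) (\<lambda>(t, x). q' x)"
      using q DERIV_continuous_UNIV[OF q(1)]
      by (intro C1_on_UNIV_I)
         (auto simp: split_beta intro!: continuous_intros intro: continuous_on_compose2)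
    from C1_on_shift[OF this, of c] show ?thesis by simp
  qed
  note o = one[OF C2_lineD(1)[OF p] C2_lineD(4)[OF p]] one[OF C2_lineD(2)[OF p] C2_lineD(3)[OF p]]
  have "C1_on UNIV (\<lambda>(t, x). c * deriv p (x + c * t)) (\<lambda>(t, x). c\<^sup>2 * deriv (deriv p) (x + c * t))
    (\<lambda>(t, x). c * deriv (deriv p) (x + c * t))"
    using C1_on_cmul[OF o(2), of c] by (simp add: split_beta' power2_eq_square mult.assoc)
  with o show ?thesis by (simp add: C2_on_def)
qed

text \<open>Leibniz rule for \<open>\<integral> h(s, y) ds\<close> from 0 to \<open>t\<close>.\<close>

lemma C1_on_prim:
  assumes h: "continuous_on UNIV h" and hy: "continuous_on UNIV hy"
    and d: "\<And>s y. ((\<lambda>z. h (s, z)) has_real_derivative hy (s, y)) (at y)"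
  shows "C1_on UNIV (\<lambda>(t, y). prim (\<lambda>s. h (s, y)) t) h (\<lambda>(t, y). prim (\<lambda>s. hy (s, y)) t)"
proof (rule C1_on_UNIV_I)
  have cont1: "continuous_on UNIV (\<lambda>s. k (s, y))" if "continuous_on UNIV k"
    for k :: "real \<times> real \<Rightarrow> real" and y
    by (rule continuous_on_compose2[OF that]) (auto intro!: continuous_intros)
  have unit: "prim (\<lambda>s. k (s, y)) t = t * integral (cbox 0 1) (\<lambda>r. k (r * t, y))"
    if "continuous_on UNIV k" for k :: "real \<times> real \<Rightarrow> real" and y t
    using prim_unit_interval[OF cont1[OF that]] by simp
  have cont: "continuous_on UNIV (\<lambda>(t, y). prim (\<lambda>s. k (s, y)) t)" if k: "continuous_on UNIV k"
    for k :: "real \<times> real \<Rightarrow> real"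
  proof -
    have "continuous_on UNIV (\<lambda>p. integral (cbox 0 1) (\<lambda>r. k (r * fst p, snd p)))"
      by (rule integral_continuous_on_param, unfold split_beta, rule continuous_on_compose2[OF k])
         (auto intro!: continuous_intros)
    then show ?thesis unfolding unit[OF k] split_beta by (intro continuous_intros)
  qed
  show "continuous_on UNIV (\<lambda>(t, y). prim (\<lambda>s. h (s, y)) t)" by (rule cont[OF h])
  show "continuous_on UNIV (\<lambda>(t, y). prim (\<lambda>s. hy (s, y)) t)" by (rule cont[OF hy])
  show "continuous_on UNIV h" by (rule h)
  show "((\<lambda>s. case (s, y) of (t, y) \<Rightarrow> prim (\<lambda>s. h (s, y)) t) has_real_derivative h (t, y)) (at t)" for t y
    using DERIV_prim[OF cont1[OF h]] by simp
  show "((\<lambda>z. case (t, z) of (t, y) \<Rightarrow> prim (\<lambda>s. h (s, y)) t) has_real_derivative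
      (case (t, y) of (t, y) \<Rightarrow> prim (\<lambda>s. hy (s, y)) t)) (at y)" for t y
  proof -
    have "((\<lambda>z. integral (cbox 0 1) (\<lambda>r. h (r * t, z))) has_real_derivative
        integral (cbox 0 1) (\<lambda>r. hy (r * t, y))) (at y within UNIV)"
    proof (rule leibniz_rule_field_derivative)
      show "((\<lambda>z. h (r * t, z)) has_real_derivative hy (r * t, z)) (at z within UNIV)" for r z
        using d by simp
      show "(\<lambda>r. h (r * t, z)) integrable_on cbox 0 1" for z
        by (rule integrable_continuous, rule continuous_on_compose2[OF h]) (auto intro!: continuous_intros)
      show "continuous_on (UNIV \<times> cbox 0 1) (\<lambda>(z, r). hy (r * t, z))"
        unfolding split_beta by (rule continuous_on_compose2[OF hy]) (auto intro!: continuous_intros)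
    qed auto
    then show ?thesis unfolding split unit[OF h] unit[OF hy] by (intro DERIV_cmult) simp
  qed
qed

text \<open>With the integrals \<open>\<alpha>(t, \<eta>)\<close> of \<open>f(s, \<eta> - a s)\<close> and \<open>\<beta>(t, \<xi>)\<close> of \<open>f(s, \<xi> + a s)\<close> over
\<open>0 \<le> s \<le> t\<close>, the solution has \<open>v\<^sub>t = (\<alpha> + \<beta>) / 2\<close> and \<open>v\<^sub>x = (\<alpha> - \<beta>) / (2 a)\<close>, taken at
\<open>\<eta> = x + a t\<close> and \<open>\<xi> = x - a t\<close>. Only the \<open>x\<close>-derivative of \<open>f\<close> enters the second derivatives of
\<open>v\<close>; this is why the source may be extended as in the lemma \<open>extend_source\<close> below.\<close>

lemma duhamel:
  fixes a :: real
  assumes a: "a > 0" and f: "continuous_on UNIV f" and fx: "continuous_on UNIV fx"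
    and d: "\<And>t x. ((\<lambda>y. f (t, y)) has_real_derivative fx (t, x)) (at x)"
  obtains v vt vx vtt vtx vxx where "C2_on UNIV v vt vx vtt vtx vtx vxx"
    "\<And>p. vtt p - a\<^sup>2 * vxx p = f p"
    "\<And>x. v (0, x) = 0" "\<And>x. vt (0, x) = 0" "\<And>x. vx (0, x) = 0" "\<And>x. vtx (0, x) = 0"
    "\<And>x. vxx (0, x) = 0"
proof -
  define A where "A c = (\<lambda>(t, y). prim (\<lambda>s. f (s, y + c * s)) t)" for c :: real
  define A' where "A' c = (\<lambda>(t, y). prim (\<lambda>s. fx (s, y + c * s)) t)" for c :: real
  have A: "C1_on UNIV (A c) (\<lambda>(t, y). f (t, y + c * t)) (A' c)" for c
  proof -
    have "C1_on UNIV (\<lambda>(t, y). prim (\<lambda>s. (\<lambda>(s, y). f (s, y + c * s)) (s, y)) t)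
       (\<lambda>(s, y). f (s, y + c * s)) (\<lambda>(t, y). prim (\<lambda>s. (\<lambda>(s, y). fx (s, y + c * s)) (s, y)) t)"
    proof (rule C1_on_prim)
      show "continuous_on UNIV (\<lambda>(s, y). f (s, y + c * s))"
        unfolding split_beta by (rule continuous_on_compose2[OF f]) (auto intro!: continuous_intros)
      show "continuous_on UNIV (\<lambda>(s, y). fx (s, y + c * s))"
        unfolding split_beta by (rule continuous_on_compose2[OF fx]) (auto intro!: continuous_intros)
      show "((\<lambda>z. case (s, z) of (s, y) \<Rightarrow> f (s, y + c * s)) has_real_derivative
          (case (s, y) of (s, y) \<Rightarrow> fx (s, y + c * s))) (at y)" for s y
      proof -
        have "((\<lambda>z. z + c * s) has_real_derivative 1) (at y)" by (auto intro!: derivative_eq_intros)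
        from DERIV_chain2[OF d this] show ?thesis by simp
      qed
    qed
    then show ?thesis by (simp add: A_def A'_def)
  qed
  define al where "al = (\<lambda>(t, x). A (-a) (t, x + a * t))"
  define be where "be = (\<lambda>(t, x). A a (t, x + (-a) * t))"
  define al' where "al' = (\<lambda>(t, x). A' (-a) (t, x + a * t))"
  define be' where "be' = (\<lambda>(t, x). A' a (t, x + (-a) * t))"
  have al: "C1_on UNIV al (\<lambda>p. f p + a * al' p) al'"
    using C1_on_shift[OF A, of "-a" a] unfolding al_def al'_def by (simp add: split_beta')
  have be: "C1_on UNIV be (\<lambda>p. f p + (-a) * be' p) be'"
    using C1_on_shift[OF A, of a "-a"] unfolding be_def be'_def by (simp add: split_beta')
  define h where "h p = 1 / 2 * (al p + be p)" for p
  define hx where "hx p = 1 / 2 * (al' p + be' p)" for p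
  define ht where "ht p = 1 / 2 * ((f p + a * al' p) + (f p + (-a) * be' p))" for p
  define w where "w p = 1 / (2 * a) * (al p - be p)" for p
  define wx where "wx p = 1 / (2 * a) * (al' p - be' p)" for p
  have h: "C1_on UNIV h ht hx"
    using C1_on_cmul[OF C1_on_add[OF al be], of "1 / 2"]
    by (simp add: h_def[abs_def] ht_def[abs_def] hx_def[abs_def])
  have w: "C1_on UNIV w hx wx"
  proof -
    have "hx = (\<lambda>p. 1 / (2 * a) * ((f p + a * al' p) - (f p + (-a) * be' p)))"
      using a by (auto simp: hx_def fun_eq_iff field_simps)
    then show ?thesis using C1_on_cmul[OF C1_on_diff[OF al be], of "1 / (2 * a)"]
      by (simp add: w_def[abs_def] wx_def[abs_def])
  qed
  define v where "v = (\<lambda>(t, x). prim (\<lambda>s. h (s, x)) t)"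
  have zero: "al (0, x) = 0" "be (0, x) = 0" "al' (0, x) = 0" "be' (0, x) = 0" for x
    by (simp_all add: al_def be_def al'_def be'_def A_def A'_def)
  have "(\<lambda>(t, x). prim (\<lambda>s. hx (s, x)) t) = w"
  proof (clarify intro!: ext)
    fix t x
    have c: "continuous_on UNIV (\<lambda>s. hx (s, x))"
      by (rule continuous_on_compose2[OF C1_on_D(3)[OF h, simplified]]) (auto intro!: continuous_intros)
    have "((\<lambda>t. prim (\<lambda>s. hx (s, x)) t - w (t, x)) has_real_derivative hx (t, x) - hx (t, x)) (at t)" for t
      using DERIV_diff[OF DERIV_prim[OF c] C1_on_D(4)[OF w, of t x]] by simp
    then have "prim (\<lambda>s. hx (s, x)) t - w (t, x) = prim (\<lambda>s. hx (s, x)) 0 - w (0, x)"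
      by (intro DERIV_isconst_all) simp
    then show "prim (\<lambda>s. hx (s, x)) t = w (t, x)" by (simp add: w_def zero)
  qed
  moreover have "C1_on UNIV v h (\<lambda>(t, x). prim (\<lambda>s. hx (s, x)) t)"
    unfolding v_def using h by (intro C1_on_prim) (auto dest: C1_on_D)
  ultimately have v: "C1_on UNIV v h w" by simp
  show thesis
  proof (rule that)
    show "C2_on UNIV v h w ht hx hx wx" using v h w by (simp add: C2_on_def)
    show "ht p - a\<^sup>2 * wx p = f p" for p
      using a by (simp add: ht_def wx_def field_simps power2_eq_square)
    show "v (0, x) = 0" "h (0, x) = 0" "w (0, x) = 0" "hx (0, x) = 0" "wx (0, x) = 0" for x
      by (simp_all add: v_def h_def w_def hx_def wx_def zero)
  qed
qed

text \<open>For negative times the slope is continued as \<open>c + e sin (d t / e)\<close>, where \<open>c\<close> and \<open>d\<close> are the first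
two derivatives at 0. This has the right derivative at 0 and, for the chosen \<open>e\<close>, stays away from
\<open>\<plusminus>a\<close>; so the characteristic map \<open>t \<mapsto> G t - a t\<close> becomes a C2 diffeomorphism of the line.\<close>

lemma extend_wall:
  fixes a :: real
  assumes a: "a > 0" and g: "Ck_on 2 {0..} \<gamma>"
    and slope: "\<And>t. t \<ge> 0 \<Longrightarrow> deriv_on {0..} \<gamma> t \<in> {-a<..<a}"
    and lim: "filterlim (\<lambda>t. \<gamma> t - a * t) at_bot at_top"
  obtains G where "C2_line G" "\<And>t. t \<ge> 0 \<Longrightarrow> G t = \<gamma> t"
    "\<And>t. t \<ge> 0 \<Longrightarrow> deriv G t = deriv_on {0..} \<gamma> t"
    "\<And>t. t \<ge> 0 \<Longrightarrow> deriv (deriv G) t = deriv_on {0..} (deriv_on {0..} \<gamma>) t"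
    "\<And>t. deriv G t \<in> {-a<..<a}" "surj (\<lambda>t. G t - a * t)"
proof -
  have g': "\<gamma> differentiable_on {0..}" "deriv_on {0..} \<gamma> differentiable_on {0..}"
    "continuous_on {0..} (deriv_on {0..} (deriv_on {0..} \<gamma>))"
    using g by (simp_all add: numeral_2_eq_2)
  define c where "c = deriv_on {0..} \<gamma> 0"
  define d where "d = deriv_on {0..} (deriv_on {0..} \<gamma>) 0"
  \<comment> \<open>half of the margin that the slope at time 0 leaves below the wave speed\<close>
  define e where "e = (a - \<bar>c\<bar>) / 2"
  have e: "e > 0" using slope[of 0] by (auto simp: e_def c_def)
  define K2 where "K2 t = deriv_on {0..} (deriv_on {0..} \<gamma>) (max 0 t) * cos (d * min 0 t / e)" for t
  have K2: "continuous_on UNIV K2"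
    unfolding K2_def using e
    by (intro continuous_intros continuous_on_compose2[OF g'(3)]) auto
  have K2_pos: "K2 t = deriv_on {0..} (deriv_on {0..} \<gamma>) t" if "t \<in> {0..}" for t
    using that by (simp add: K2_def)
  define K1 where "K1 t = c + prim K2 t" for t
  have dK1: "(K1 has_real_derivative K2 t) (at t)" for t
    unfolding K1_def by (auto intro!: derivative_eq_intros DERIV_prim K2)
  have cK1: "continuous_on UNIV K1" by (rule DERIV_continuous_UNIV[OF dK1])
  have K1_pos: "K1 t = deriv_on {0..} \<gamma> t" if "t \<in> {0..}" for t
    unfolding K1_def c_def by (rule extend_primitive[OF _ _ g'(2) K2 K2_pos]) (use that in auto)
  have K1_neg: "K1 t = c + e * sin (d * t / e)" if "t \<le> 0" for t
  proof -
    have "((\<lambda>t. prim K2 t - e * sin (d * t / e)) has_real_derivative 0) (at t within {..0})"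
      if "t \<in> {..0}" for t
    proof -
      have "K2 t = d * cos (d * t / e)" using that by (simp add: K2_def d_def min_def max_def)
      then show ?thesis
        using e by (auto intro!: derivative_eq_intros DERIV_subset[OF DERIV_prim[OF K2]])
    qed
    from has_field_derivative_zero_constant[OF _ this]
    obtain k where k: "\<And>t. t \<in> {..0} \<Longrightarrow> prim K2 t - e * sin (d * t / e) = k" by auto
    from k[of 0] k[of t] that show ?thesis by (simp add: K1_def)
  qed
  have K1_neg_bound: "\<bar>K1 t\<bar> \<le> \<bar>c\<bar> + e" if "t \<le> 0" for t
  proof -
    have "\<bar>e * sin (d * t / e)\<bar> \<le> e" using e by (simp add: abs_mult)
    then show ?thesis unfolding K1_neg[OF that] by linarith
  qed
  have ce: "\<bar>c\<bar> + e = a - e" by (simp add: e_def field_simps)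
  define G where "G t = \<gamma> 0 + prim K1 t" for t
  have dG: "(G has_real_derivative K1 t) (at t)" for t
    unfolding G_def by (auto intro!: derivative_eq_intros DERIV_prim cK1)
  note G = C2_lineI[OF dG dK1 K2]
  have slopeG: "K1 t \<in> {-a<..<a}" for t
  proof (cases "t \<ge> 0")
    case True
    then show ?thesis using slope K1_pos by simp
  next
    case False
    then show ?thesis using K1_neg_bound[of t] ce e by auto
  qed
  have Gpos: "G t = \<gamma> t" if "t \<ge> 0" for t
    unfolding G_def by (rule extend_primitive[OF _ _ g'(1) cK1 K1_pos]) (use that in auto)
  have cont: "continuous_on S (\<lambda>t. G t - a * t)" for S
    by (intro continuous_intros DERIV_continuous_UNIV[OF dG])
  have "\<exists>t. y = G t - a * t" for y
  proof -
    have "\<forall>\<^sub>F t in at_top. \<gamma> t - a * t \<le> y"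
      using lim by (simp add: filterlim_at_bot)
    then obtain N where "\<And>t. t \<ge> N \<Longrightarrow> \<gamma> t - a * t \<le> y"
      unfolding eventually_at_top_linorder by blast
    then have hi: "G (max N 0) - a * max N 0 \<le> y" using Gpos by auto
    define s where "s = - \<bar>y - \<gamma> 0\<bar> / e"
    have s: "s \<le> 0" using e by (simp add: s_def)
    have "G s - a * s + e * s \<ge> G 0 - a * 0 + e * 0"
    proof (rule DERIV_nonpos_imp_nonincreasing[OF s])
      fix t assume "s \<le> t" "t \<le> 0"
      then have "K1 t - a + e \<le> 0" using K1_neg_bound[of t] ce by auto
      moreover have "((\<lambda>t. G t - a * t + e * t) has_real_derivative K1 t - a + e) (at t)"
        by (auto intro!: derivative_eq_intros dG)
      ultimately show "\<exists>y. ((\<lambda>t. G t - a * t + e * t) has_real_derivative y) (at t) \<and> y \<le> 0"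
        by blast
    qed
    moreover have "e * s = - \<bar>y - \<gamma> 0\<bar>" using e by (simp add: s_def)
    ultimately have lo: "y \<le> G s - a * s" using Gpos[of 0] by simp
    have "\<exists>t\<ge>s. t \<le> max N 0 \<and> G t - a * t = y"
      by (rule IVT2'[OF hi lo _ cont]) (use s in auto)
    then show ?thesis by auto
  qed
  then have "surj (\<lambda>t. G t - a * t)" unfolding surj_def by blast
  then show thesis
    using that[OF G(1) Gpos] slopeG K1_pos K2_pos unfolding G(3) unfolding G(2) by auto
qed

lemma in_closure_Qdom:
  assumes G: "continuous_on UNIV G" and eq: "\<And>t. t \<ge> 0 \<Longrightarrow> G t = \<gamma> t"
    and gl: "\<And>t. t \<ge> 0 \<Longrightarrow> \<gamma> t < l" and t: "t \<ge> 0" and x: "\<gamma> t \<le> x" "x \<le> l"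
  shows "(t, x) \<in> closure (Qdom l \<gamma>)"
proof (rule in_closure_at_right[where d=1])
  define k where "k = (x - \<gamma> t) / (l - \<gamma> t)"
  have k: "0 \<le> k" "k \<le> 1" using x gl[OF t] by (auto simp: k_def divide_simps)
  have xk: "G t + k * (l - G t) = x" using gl[OF t] eq[OF t] by (simp add: k_def)
  \<comment> \<open>keep the relative position between the ends up to a small push towards the middle, and move forward in time\<close>
  define p where "p s = (t + s, G (t + s) + ((1 - s) * k + s / 2) * (l - G (t + s)))" for s
  have "continuous_on UNIV p"
    unfolding p_def by (intro continuous_intros continuous_on_compose2[OF G]) auto
  then have "isCont p 0" by (simp add: continuous_on_eq_continuous_at)
  moreover have "p 0 = (t, x)" using xk by (simp add: p_def)
  ultimately show "(p \<longlongrightarrow> (t, x)) (at_right 0)"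
    by (metis continuous_at filterlim_at_split)
  show "p s \<in> Qdom l \<gamma>" if s: "0 < s" "s < 1" for s
  proof -
    define m where "m = (1 - s) * k + s / 2"
    have "0 \<le> (1 - s) * k" "(1 - s) * k \<le> 1 - s" using s k by (simp_all add: mult_left_le)
    then have m: "0 < m" "m < 1" unfolding m_def using s by linarith+
    have w: "l - \<gamma> (t + s) > 0" using gl[of "t + s"] t s by auto
    have "0 < m * (l - \<gamma> (t + s))" "m * (l - \<gamma> (t + s)) < 1 * (l - \<gamma> (t + s))"
      using m w by (auto intro!: mult_strict_right_mono)
    then show ?thesis using s t by (auto simp: p_def Qdom_def eq m_def[symmetric])
  qed
qed auto

lemma open_Qdom:
  assumes G: "continuous_on UNIV G" and eq: "\<And>t. t \<ge> 0 \<Longrightarrow> G t = \<gamma> t"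
  shows "open (Qdom l \<gamma>)"
proof -
  have "Qdom l \<gamma> = {p. 0 < fst p} \<inter> {p. G (fst p) < snd p} \<inter> {p. snd p < l}"
    by (auto simp: Qdom_def eq)
  also have "open \<dots>"
    by (intro open_Int open_Collect_less continuous_intros continuous_on_compose2[OF G]) auto
  finally show ?thesis .
qed

text \<open>The \<open>x\<close>-derivative is continued to the left of the wall, to the right of \<open>l\<close> and to negative times by
its value at the nearest admissible argument (the map \<open>q\<close>), and then integrated from \<open>x = l\<close>. The
result is continuous with continuous \<open>x\<close>-derivative, as Duhamel's integral requires.\<close>

lemma extend_source:
  assumes G: "continuous_on UNIV G" and eq: "\<And>t. t \<ge> 0 \<Longrightarrow> G t = \<gamma> t"
    and gl: "\<And>t. t \<ge> 0 \<Longrightarrow> \<gamma> t < l" and f: "Ck_closure 1 (Qdom l \<gamma>) f"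
  obtains F Fx where "continuous_on UNIV F" "continuous_on UNIV Fx"
    "\<And>t x. ((\<lambda>y. F (t, y)) has_real_derivative Fx (t, x)) (at x)"
    "\<And>p. p \<in> closure (Qdom l \<gamma>) \<Longrightarrow> F p = f p"
proof -
  let ?Q = "Qdom l \<gamma>"
  have f: "C1_on ?Q f (D_t ?Q f) (D_x ?Q f)" using f by (simp only: Ck_closure_1_iff)
  have opQ: "interior ?Q = ?Q" by (rule interior_open[OF open_Qdom[OF G eq]])
  define q where "q p = (max 0 (fst p), max (G (max 0 (fst p))) (min (snd p) l))" for p :: "real \<times> real"
  have q: "q p \<in> closure ?Q" for p
    unfolding q_def
    by (rule in_closure_Qdom[OF G eq gl]) (use gl[of "max 0 (fst p)"] eq[of "max 0 (fst p)"] in auto)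
  have cq: "continuous_on UNIV q"
    unfolding q_def by (intro continuous_intros continuous_on_compose2[OF G]) auto
  define Fx where "Fx p = D_x ?Q f (q p)" for p
  have Fx: "continuous_on UNIV Fx"
    unfolding Fx_def by (rule continuous_on_compose2[OF C1_on_D(3)[OF f] cq]) (use q in auto)
  define A where "A = (\<lambda>(y, t). prim (\<lambda>x. Fx (t, x)) y)"
  define F where "F p = f (q (fst p, l)) + (A (snd p, fst p) - A (l, fst p))" for p
  have cFx: "continuous_on UNIV (\<lambda>x. Fx (t, x))" for t
    by (rule continuous_on_compose2[OF Fx]) (auto intro!: continuous_intros)
  have cA: "continuous_on UNIV A"
  proof -
    have "A = (\<lambda>p. fst p * integral (cbox 0 1) (\<lambda>r. Fx (snd p, r * fst p)))"
      unfolding A_def using prim_unit_interval[OF cFx] by (auto simp: fun_eq_iff)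
    moreover have "continuous_on UNIV (\<lambda>p. integral (cbox 0 1) (\<lambda>r. Fx (snd p, r * fst p)))"
      by (rule integral_continuous_on_param, unfold split_beta, rule continuous_on_compose2[OF Fx])
         (auto intro!: continuous_intros)
    ultimately show ?thesis by (simp add: continuous_on_mult continuous_on_fst)
  qed
  have cfq: "continuous_on UNIV (\<lambda>p. f (q p))"
    by (rule continuous_on_compose2[OF C1_on_D(1)[OF f] cq]) (use q in auto)
  have cF: "continuous_on UNIV F"
    unfolding F_def
    by (intro continuous_intros continuous_on_compose2[OF cfq] continuous_on_compose2[OF cA]) auto
  have dF: "((\<lambda>y. F (t, y)) has_real_derivative Fx (t, x)) (at x)" for t x
    unfolding F_def A_def by (auto intro!: derivative_eq_intros DERIV_prim cFx)
  have FQ: "F (t, x) = f (t, x)" if p: "(t, x) \<in> ?Q" for t x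
  proof -
    have tx: "0 < t" "\<gamma> t < x" "x < l" using p by (auto simp: Qdom_def)
    have "f (t, l) - F (t, l) = f (t, x) - F (t, x)"
    proof (rule DERIV_isconst_end[OF tx(3)])
      show "continuous_on {x..l} (\<lambda>y. f (t, y) - F (t, y))"
        by (intro continuous_intros continuous_on_compose2[OF C1_on_D(1)[OF f]]
              continuous_on_compose2[OF cF])
           (use tx in \<open>auto intro!: in_closure_Qdom[OF G eq gl]\<close>)
      show "((\<lambda>y. f (t, y) - F (t, y)) has_real_derivative 0) (at y)" if y: "x < y" "y < l" for y
      proof -
        have "(t, y) \<in> interior ?Q" unfolding opQ using y tx by (auto simp: Qdom_def)
        moreover have "q (t, y) = (t, y)" using y tx eq[of t] by (auto simp: q_def)
        ultimately show ?thesis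
          using DERIV_diff[OF C1_on_D(5)[OF f, of t y] dF[of t y]] by (simp add: Fx_def)
      qed
    qed
    moreover have "F (t, l) = f (t, l)" using tx eq[of t] by (simp add: F_def q_def)
    ultimately show ?thesis by simp
  qed
  have "F p - f p = 0" if "p \<in> closure ?Q" for p
    by (rule continuous_constant_on_closure[OF _ _ that])
       (use FQ C1_on_D(1)[OF f] in \<open>auto intro!: continuous_intros continuous_on_subset[OF cF]\<close>)
  then show thesis using that[OF cF Fx dF] by simp
qed

section \<open>Geometry of the characteristic cells\<close>

lemma in_closure_eventually_at_right:
  fixes p :: "real \<Rightarrow> 'a::t2_space"
  assumes "(p \<longlongrightarrow> q) (at_right 0)" "\<forall>\<^sub>F s in at_right 0. p s \<in> S"
  shows "q \<in> closure S"
  by (rule Lim_in_closed_set[OF closed_closure _ _ assms(1)])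
     (use closure_subset in \<open>auto intro: eventually_mono[OF assms(2)]\<close>)

lemma convex_step:
  fixes x c y s :: real
  assumes "0 < s" "s < 1"
  shows "y \<le> x \<Longrightarrow> y < c \<Longrightarrow> y < x + s * (c - x)" "x \<le> y \<Longrightarrow> c < y \<Longrightarrow> x + s * (c - x) < y"
proof -
  have eq: "x + s * (c - x) - y = (1 - s) * (x - y) + s * (c - y)" by (simp add: algebra_simps)
  show "y < x + s * (c - x)" if "y \<le> x" "y < c"
  proof -
    have "0 \<le> (1 - s) * (x - y)" "0 < s * (c - y)" using assms that by simp_all
    then show ?thesis using eq by linarith
  qed
  show "x + s * (c - x) < y" if "x \<le> y" "c < y"
  proof -
    have "(1 - s) * (x - y) \<le> 0" "s * (c - y) < 0"
      using assms that by (simp_all add: mult_nonneg_nonpos mult_pos_neg)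
    then show ?thesis using eq by linarith
  qed
qed

text \<open>\<open>G\<close> is a C2 continuation of the wall \<open>\<gamma>\<close> to all real times. The maps \<open>gp\<close> and \<open>gm\<close> below are then
\<open>\<gamma>\<^sub>+\<close> and \<open>\<gamma>\<^sub>-\<close> for all times, and \<open>gm\<close> has a globally smooth inverse.\<close>

locale moving_wall =
  fixes a l :: real and \<gamma> G :: "real \<Rightarrow> real"
  assumes a_pos: "a > 0" and l_pos: "l > 0"
    and G_C2: "C2_line G" and G_eq: "\<And>t. t \<ge> 0 \<Longrightarrow> G t = \<gamma> t" and G_0: "G 0 = 0"
    and G_slope: "\<And>t. deriv G t \<in> {-a<..<a}"
    and G_less: "\<And>t. t \<ge> 0 \<Longrightarrow> G t < l"
    and G_top: "filterlim (\<lambda>t. G t + a * t) at_top at_top"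
    and G_surj: "surj (\<lambda>t. G t - a * t)"
begin

definition gp :: "real \<Rightarrow> real" where "gp t = G t + a * t"
definition gm :: "real \<Rightarrow> real" where "gm t = G t - a * t"

abbreviation "Q \<equiv> Qdom l \<gamma>"
abbreviation "P \<equiv> Qpart a l \<gamma>"
abbreviation "r \<equiv> rseq a l \<gamma>"
abbreviation "L \<equiv> lseq a l \<gamma>"
abbreviation "ch \<equiv> char_pt a"

lemma cont_G: "continuous_on S G"
  using C2_lineD(5)[OF G_C2] continuous_on_subset by blast

lemma gp_C2: "C2_line gp" "deriv gp = (\<lambda>t. deriv G t + a)" "deriv (deriv gp) = deriv (deriv G)"
  and gm_C2: "C2_line gm" "deriv gm = (\<lambda>t. deriv G t - a)" "deriv (deriv gm) = deriv (deriv G)"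
proof -
  have "(gp has_real_derivative deriv G t + a) (at t)" "(gm has_real_derivative deriv G t - a) (at t)"
    "((\<lambda>t. deriv G t + a) has_real_derivative deriv (deriv G) t) (at t)"
    "((\<lambda>t. deriv G t - a) has_real_derivative deriv (deriv G) t) (at t)" for t
    unfolding gp_def[abs_def] gm_def[abs_def]
    by (auto intro!: derivative_eq_intros C2_lineD(1,2)[OF G_C2])
  note p = C2_lineI[OF this(1,3) C2_lineD(3)[OF G_C2]] and m = C2_lineI[OF this(2,4) C2_lineD(3)[OF G_C2]]
  show "C2_line gp" "deriv gp = (\<lambda>t. deriv G t + a)" "deriv (deriv gp) = deriv (deriv G)" by (fact p)+
  show "C2_line gm" "deriv gm = (\<lambda>t. deriv G t - a)" "deriv (deriv gm) = deriv (deriv G)" by (fact m)+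
qed

lemma gp_strict: "s < t \<Longrightarrow> gp s < gp t"
proof (erule DERIV_pos_imp_increasing)
  show "\<exists>y. (gp has_real_derivative y) (at x) \<and> 0 < y" for x
    using C2_lineD(1)[OF gp_C2(1), of x] G_slope[of x] unfolding gp_C2(2)
    by (intro exI[of _ "deriv G x + a"]) auto
qed

lemma gm_strict: "s < t \<Longrightarrow> gm t < gm s"
proof (erule DERIV_neg_imp_decreasing)
  show "\<exists>y. (gm has_real_derivative y) (at x) \<and> y < 0" for x
    using C2_lineD(1)[OF gm_C2(1), of x] G_slope[of x] unfolding gm_C2(2)
    by (intro exI[of _ "deriv G x - a"]) auto
qed

lemma gp_less_iff [simp]: "gp s < gp t \<longleftrightarrow> s < t"
  using gp_strict by (metis not_less_iff_gr_or_eq)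

lemma gm_less_iff [simp]: "gm s < gm t \<longleftrightarrow> t < s"
  using gm_strict by (metis not_less_iff_gr_or_eq)

lemma gp_le_iff [simp]: "gp s \<le> gp t \<longleftrightarrow> s \<le> t" and gm_le_iff [simp]: "gm s \<le> gm t \<longleftrightarrow> t \<le> s"
  by (simp_all flip: not_less)

lemma gp_0 [simp]: "gp 0 = 0" and gm_0 [simp]: "gm 0 = 0"
  by (simp_all add: gp_def gm_def G_0)

lemma gm_nonpos: "t \<ge> 0 \<Longrightarrow> gm t \<le> 0" and gp_nonneg: "t \<ge> 0 \<Longrightarrow> gp t \<ge> 0"
  using gm_le_iff[of t 0] gp_le_iff[of 0 t] by simp_all

lemma Phi_plus_inverse:
  assumes "y \<ge> 0"
  shows "Phi_plus a \<gamma> y \<ge> 0" "gp (Phi_plus a \<gamma> y) = y"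
proof -
  have "\<forall>\<^sub>F t in at_top. gp t \<ge> y"
    using G_top by (simp add: filterlim_at_top gp_def)
  then obtain N where "\<And>t. t \<ge> N \<Longrightarrow> gp t \<ge> y" unfolding eventually_at_top_linorder by blast
  then have "gp (max N 0) \<ge> y" by simp
  then have "\<exists>t\<ge>0. t \<le> max N 0 \<and> gp t = y"
    using assms DERIV_continuous_UNIV[OF C2_lineD(1)[OF gp_C2(1)]] by (intro IVT') simp_all
  then obtain t where t: "t \<ge> 0" "gp t = y" by blast
  have "gamma_plus a \<gamma> t = y" using t G_eq by (simp add: gamma_plus_def gp_def)
  then have "y \<in> gamma_plus a \<gamma> ` {0..}" using t by auto
  from inv_into_into[OF this] f_inv_into_f[OF this]
  show "Phi_plus a \<gamma> y \<ge> 0" "gp (Phi_plus a \<gamma> y) = y"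
    using G_eq by (auto simp: Phi_plus_def gamma_plus_def gp_def)
qed

lemma r_L_nonneg: "r i \<ge> 0 \<and> L i \<ge> 0"
proof (induction i)
  case (Suc i)
  have "l + a * L i \<ge> 0" using Suc a_pos l_pos by simp
  then have "r (Suc i) \<ge> 0" using Phi_plus_inverse by simp
  moreover have "L (Suc i) \<ge> 0" using Suc a_pos G_less[of "r i"] G_eq[of "r i"] by simp
  ultimately show ?case by blast
qed simp

lemma r_nonneg [simp]: "r i \<ge> 0" and L_nonneg [simp]: "L i \<ge> 0"
  using r_L_nonneg by auto

declare rseq.simps [simp del] lseq.simps [simp del]

lemma r_0 [simp]: "r 0 = 0" and L_0 [simp]: "L 0 = 0"
  by (simp_all add: rseq.simps lseq.simps)

lemma gp_r_Suc: "gp (r (Suc i)) = l + a * L i"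
  using Phi_plus_inverse(2)[of "l + a * L i"] a_pos l_pos by (simp add: rseq.simps)

text \<open>Together with \<open>gp_r_Suc\<close> this makes the grid uniform: row \<open>i\<close> is \<open>gm (r i) \<le> \<xi> \<le> l - a * L i\<close> and
column \<open>j\<close> is \<open>gp (r j) \<le> \<eta> \<le> l + a * L j\<close> for all \<open>i\<close> and \<open>j\<close>, including the first ones.\<close>

lemma gm_r: "gm (r i) = l - a * L (Suc i)"
  using a_pos by (simp add: lseq.simps gm_def G_eq field_simps)

lemma r_less_L: "r i < L (Suc i)"
  using a_pos G_less[of "r i"] by (simp add: lseq.simps G_eq)

lemma L_less_r: "L i < r (Suc i)"
proof -
  have "gp (L i) < l + a * L i" using G_less[of "L i"] by (simp add: gp_def)
  then have "gp (L i) < gp (r (Suc i))" by (simp only: gp_r_Suc)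
  then show ?thesis by simp
qed

lemma r_L_step: "r i < r (Suc i) \<and> L i < L (Suc i)"
proof (induction i)
  case 0
  show ?case using L_less_r[of 0] r_less_L[of 0] by simp
next
  case (Suc i)
  have "gm (r (Suc i)) < gm (r i)" using Suc by simp
  then have L: "L (Suc i) < L (Suc (Suc i))" using a_pos unfolding gm_r by simp
  have "l + a * L i < l + a * L (Suc i)" using Suc a_pos by simp
  then have "gp (r (Suc i)) < gp (r (Suc (Suc i)))" by (simp only: gp_r_Suc)
  with L show ?case by simp
qed

lemma r_less_iff [simp]: "r i < r j \<longleftrightarrow> i < j" and L_less_iff [simp]: "L i < L j \<longleftrightarrow> i < j"
  using r_L_step by (simp_all add: strict_mono_less strict_mono_Suc_iff)

lemma r_le_iff [simp]: "r i \<le> r j \<longleftrightarrow> i \<le> j" and L_le_iff [simp]: "L i \<le> L j \<longleftrightarrow> i \<le> j"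
  by (simp_all flip: not_less)

text \<open>On a bounded time interval the distance of the two ends has a positive minimum, so that a
characteristic needs at least a fixed time \<open>d\<close> to cross; the reflection times cannot accumulate.\<close>

lemma r_unbounded: "\<exists>i. r i > N"
proof (rule ccontr)
  assume "\<nexists>i. r i > N"
  then have bd: "r i \<le> N" for i by (meson not_le)
  have N: "N \<ge> 0" using bd[of 0] by simp
  have "\<exists>x\<in>{0..N}. \<forall>y\<in>{0..N}. (l - G x) / a \<le> (l - G y) / a"
    using N a_pos by (intro continuous_attains_inf continuous_intros cont_G) auto
  then obtain x where x: "x \<in> {0..N}" "\<And>y. y \<in> {0..N} \<Longrightarrow> (l - G x) / a \<le> (l - G y) / a" by blast
  define d where "d = (l - G x) / a"
  have d: "d > 0" using x(1) G_less[of x] a_pos by (simp add: d_def)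
  have "r (2 * n) \<ge> n * d" for n
  proof (induction n)
    case (Suc n)
    have "d \<le> (l - G (r (2 * n))) / a" unfolding d_def using bd by (intro x(2)) auto
    then have "r (2 * n) + d \<le> L (Suc (2 * n))" by (simp add: lseq.simps G_eq)
    also have "\<dots> < r (2 * Suc n)" using L_less_r by simp
    finally show ?case using Suc by (simp add: algebra_simps)
  qed simp
  then have "real n * d \<le> N" for n using bd order_trans by blast
  moreover obtain n where "real n * d > N" using d by (metis reals_Archimedean3)
  ultimately show False by (meson not_le)
qed

lemma L_unbounded: "\<exists>i. L i > N"
  using r_unbounded[of N] r_less_L by (meson less_trans)

text \<open>The index pairs of the cells that occur in the partition.\<close>

definition adj :: "nat \<Rightarrow> nat \<Rightarrow> bool" where "adj i j \<longleftrightarrow> i \<le> j + 1 \<and> j \<le> i + 1"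

lemma P_eq:
  assumes "adj i j"
  shows "P i j = Q \<inter> char_rect a {gm (r i)..l - a * L i} {gp (r j)..l + a * L j}"
proof -
  have gmr: "gamma_minus a \<gamma> (r i) = gm (r i)" for i by (simp add: gamma_minus_def gm_def G_eq)
  have L1: "l - a * L 1 = 0" using gm_r[of 0] by simp
  consider "i = 0" "j = 0" | "i = 1" "j = 0" | "i = 0" "j = 1" | m n where "i = Suc m" "j = Suc n"
    using assms unfolding adj_def by (cases i; cases j) auto
  then show ?thesis
  proof cases
    case 4
    then show ?thesis by (simp add: gmr gp_r_Suc) (simp add: gm_r)
  qed (use L1 in \<open>simp_all add: gmr gp_r_Suc\<close>)
qed

declare Qpart.simps [simp del]

lemma char_rect_iff: "ch \<xi> \<eta> \<in> char_rect a I J \<longleftrightarrow> \<xi> \<in> I \<and> \<eta> \<in> J"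
  using char_pt_coords[of a \<xi> \<eta>] a_pos by (simp add: char_rect_def split_beta)

lemma ch_self: "ch (x - a * t) (x + a * t) = (t, x)"
  using char_pt_self a_pos by simp

lemma ch_cases: obtains \<xi> \<eta> where "p = ch \<xi> \<eta>" "\<xi> = snd p - a * fst p" "\<eta> = snd p + a * fst p"
  using ch_self[of "snd p" "fst p"] by (metis prod.collapse)

lemma cont_ch: "continuous_on S (\<lambda>s. ch (f s) (g s))"
  if "continuous_on S f" "continuous_on S g" for f g :: "'b::topological_space \<Rightarrow> real"
  using that a_pos unfolding char_pt_def by (intro continuous_intros) auto

text \<open>A point that lies, in both characteristic coordinates, above the wall point of time \<open>\<tau>\<close> lies to the
right of the wall: before time \<open>\<tau>\<close> compare \<open>\<eta>\<close> with \<open>gp\<close>, afterwards compare \<open>\<xi>\<close> with \<open>gm\<close>.\<close>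

lemma ch_in_Q:
  assumes "\<xi> < \<eta>" "\<xi> + \<eta> < 2 * l" "gm \<tau> \<le> \<xi>" "gp \<tau> \<le> \<eta>" "gm \<tau> < \<xi> \<or> gp \<tau> < \<eta>"
  shows "ch \<xi> \<eta> \<in> Q"
proof -
  define t where "t = (\<eta> - \<xi>) / (2 * a)"
  define x where "x = (\<xi> + \<eta>) / 2"
  have t: "t > 0" using assms a_pos by (simp add: t_def)
  have at: "a * t = (\<eta> - \<xi>) / 2" using a_pos by (simp add: t_def)
  have \<xi>: "\<xi> = x - a * t" and \<eta>: "\<eta> = x + a * t" unfolding at by (simp_all add: x_def field_simps)
  have "G t < x"
  proof (cases "\<tau> < t")
    case True
    then have "gm t < \<xi>" using assms(3) gm_strict[OF True] by linarith
    then show ?thesis by (simp add: gm_def \<xi>)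
  next
    case False
    then have le: "t \<le> \<tau>" by simp
    show ?thesis
    proof (cases "t = \<tau>")
      case True
      then show ?thesis using assms(5) by (auto simp: gm_def gp_def \<xi> \<eta>)
    next
      case False
      with le have "t < \<tau>" by simp
      then have "gp t < \<eta>" using assms(4) gp_strict[of t \<tau>] by linarith
      then show ?thesis by (simp add: gp_def \<eta>)
    qed
  qed
  then have "(t, x) \<in> Q" using t assms G_eq[of t] by (simp add: Qdom_def x_def)
  then show ?thesis by (simp add: char_pt_def t_def x_def)
qed

lemma Q_D:
  assumes "ch \<xi> \<eta> \<in> Q"
  shows "\<xi> < \<eta>" "\<xi> + \<eta> < 2 * l"
    "\<xi> > gm ((\<eta> - \<xi>) / (2 * a))" "\<eta> > gp ((\<eta> - \<xi>) / (2 * a))"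
proof -
  have t: "(\<eta> - \<xi>) / (2 * a) > 0" using assms by (simp add: char_pt_def Qdom_def)
  then show "\<xi> < \<eta>" using a_pos by (simp add: zero_less_divide_iff)
  show "\<xi> + \<eta> < 2 * l" using assms by (simp add: char_pt_def Qdom_def)
  define T where "T = (\<eta> - \<xi>) / (2 * a)"
  have 1: "G T < (\<xi> + \<eta>) / 2" using assms t G_eq[of T] by (simp add: char_pt_def Qdom_def T_def)
  have 2: "a * T = (\<eta> - \<xi>) / 2" using a_pos by (simp add: T_def)
  show "\<xi> > gm ((\<eta> - \<xi>) / (2 * a))" using 1 unfolding gm_def T_def[symmetric] 2 by (simp add: field_simps)
  show "\<eta> > gp ((\<eta> - \<xi>) / (2 * a))" using 1 unfolding gp_def T_def[symmetric] 2 by (simp add: field_simps)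
qed

lemma open_Q: "open Q"
  by (rule open_Qdom[OF cont_G G_eq])

lemma in_P_iff:
  assumes "adj i j"
  shows "ch \<xi> \<eta> \<in> P i j \<longleftrightarrow> ch \<xi> \<eta> \<in> Q \<and> gm (r i) \<le> \<xi> \<and> \<xi> \<le> l - a * L i \<and>
     gp (r j) \<le> \<eta> \<and> \<eta> \<le> l + a * L j"
  using P_eq[OF assms] char_rect_iff by auto

definition open_cell :: "nat \<Rightarrow> nat \<Rightarrow> (real \<times> real) set" where
  "open_cell i j = Q \<inter> char_rect a {gm (r i)<..<l - a * L i} {gp (r j)<..<l + a * L j}"

lemma in_open_cell_iff:
  "ch \<xi> \<eta> \<in> open_cell i j \<longleftrightarrow> ch \<xi> \<eta> \<in> Q \<and> gm (r i) < \<xi> \<and> \<xi> < l - a * L i \<and>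
     gp (r j) < \<eta> \<and> \<eta> < l + a * L j"
  by (auto simp: open_cell_def char_rect_iff)

lemma open_open_cell: "open (open_cell i j)"
proof -
  have "open_cell i j = Q \<inter> {p. gm (r i) < snd p - a * fst p} \<inter> {p. snd p - a * fst p < l - a * L i} \<inter>
     {p. gp (r j) < snd p + a * fst p} \<inter> {p. snd p + a * fst p < l + a * L j}"
    by (auto simp: open_cell_def char_rect_def)
  also have "open \<dots>" by (intro open_Int open_Q open_Collect_less continuous_intros)
  finally show ?thesis .
qed

lemma open_cell_subset_interior:
  assumes ij: "adj i j"
  shows "open_cell i j \<subseteq> interior (P i j)"
  by (rule interior_maximal[OF _ open_open_cell])
     (auto simp: P_eq[OF ij] open_cell_def char_rect_def)

lemma closure_P_D:
  assumes ij: "adj i j" and p: "(t, x) \<in> closure (P i j)"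
  shows "gm (r i) \<le> x - a * t" "x - a * t \<le> l - a * L i" "gp (r j) \<le> x + a * t" "x + a * t \<le> l + a * L j"
proof -
  let ?C = "{p. gm (r i) \<le> snd p - a * fst p} \<inter> {p. snd p - a * fst p \<le> l - a * L i} \<inter>
     {p. gp (r j) \<le> snd p + a * fst p} \<inter> {p. snd p + a * fst p \<le> l + a * L j}"
  have "closed ?C" by (intro closed_Int closed_Collect_le continuous_intros)
  moreover have "P i j \<subseteq> ?C" unfolding P_eq[OF ij] by (auto simp: char_rect_def)
  ultimately have "(t, x) \<in> ?C" using p by (meson closure_minimal subsetD)
  then show "gm (r i) \<le> x - a * t" "x - a * t \<le> l - a * L i" "gp (r j) \<le> x + a * t"
    "x + a * t \<le> l + a * L j" by auto
qed

lemma gp_r_less: "gp (r j) < l + a * L j"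
  unfolding gp_r_Suc[symmetric] by simp

lemma gm_r_less: "gm (r i) < l - a * L i"
  unfolding gm_r using a_pos by simp

lemma ch_path_tendsto:
  "((\<lambda>s. ch (\<xi> + s * \<xi>') (\<eta> + s * \<eta>')) \<longlongrightarrow> ch \<xi> \<eta>) (at_right 0)"
proof -
  have "isCont (\<lambda>s. ch (\<xi> + s * \<xi>') (\<eta> + s * \<eta>')) 0"
    using cont_ch[of UNIV "\<lambda>s. \<xi> + s * \<xi>'" "\<lambda>s. \<eta> + s * \<eta>'"]
    by (auto simp: continuous_on_eq_continuous_at intro!: continuous_intros)
  then show ?thesis
    by (simp add: isCont_def filterlim_at_split)
qed

text \<open>Move a point of the cell straight towards the centre of the characteristic rectangle. The path enters
the open rectangle at once and, the domain being open, stays in it for a short time.\<close>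

lemma open_cell_dense:
  assumes ij: "adj i j"
  shows "P i j \<subseteq> closure (open_cell i j)"
proof
  fix p assume p: "p \<in> P i j"
  obtain \<xi> \<eta> where pc: "p = ch \<xi> \<eta>" using ch_cases .
  define \<xi>c where "\<xi>c = (gm (r i) + (l - a * L i)) / 2"
  define \<eta>c where "\<eta>c = (gp (r j) + (l + a * L j)) / 2"
  have c: "gm (r i) < \<xi>c" "\<xi>c < l - a * L i" "gp (r j) < \<eta>c" "\<eta>c < l + a * L j"
    using gm_r_less[of i] gp_r_less[of j] by (simp_all add: \<xi>c_def \<eta>c_def)
  have b: "gm (r i) \<le> \<xi>" "\<xi> \<le> l - a * L i" "gp (r j) \<le> \<eta>" "\<eta> \<le> l + a * L j" "ch \<xi> \<eta> \<in> Q"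
    using p in_P_iff[OF ij] pc by auto
  note lim = ch_path_tendsto[of \<xi> "\<xi>c - \<xi>" \<eta> "\<eta>c - \<eta>"]
  have "\<forall>\<^sub>F s in at_right 0. ch (\<xi> + s * (\<xi>c - \<xi>)) (\<eta> + s * (\<eta>c - \<eta>)) \<in> open_cell i j"
    using topological_tendstoD[OF lim open_Q b(5)] eventually_at_right_real[of 0 1, OF zero_less_one]
  proof eventually_elim
    case (elim s)
    then show ?case
      using b c unfolding in_open_cell_iff by (intro conjI convex_step) auto
  qed
  from in_closure_eventually_at_right[OF lim this] show "p \<in> closure (open_cell i j)"
    by (simp add: pc)
qed

lemma P_regular: "adj i j \<Longrightarrow> P i j \<subseteq> closure (interior (P i j))"
  using open_cell_dense closure_mono[OF open_cell_subset_interior] by blast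

lemma initial_in_closure_P:
  assumes x: "x \<in> {0..l}"
  shows "(0, x) \<in> closure (P 0 0)"
proof -
  have "ch x x \<in> closure (P 0 0)"
  proof (rule in_closure_at_right[OF ch_path_tendsto, of 1 x "l / 3 - x" x "2 * l / 3 - x"])
    fix s :: real assume s: "0 < s" "s < 1"
    have b: "0 < x + s * (l / 3 - x)" "x + s * (l / 3 - x) < l"
      "0 < x + s * (2 * l / 3 - x)" "x + s * (2 * l / 3 - x) < l"
      using x l_pos by (auto intro!: convex_step s)
    have "x + s * (l / 3 - x) < x + s * (2 * l / 3 - x)" using s l_pos by simp
    moreover from this have "ch (x + s * (l / 3 - x)) (x + s * (2 * l / 3 - x)) \<in> Q"
      using b by (intro ch_in_Q[where \<tau>=0]) auto
    ultimately show "ch (x + s * (l / 3 - x)) (x + s * (2 * l / 3 - x)) \<in> P 0 0"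
      using b by (subst in_P_iff) (auto simp: adj_def)
  qed simp
  then show ?thesis using ch_self[of x 0] by simp
qed

text \<open>On the side \<open>x = l\<close> the cell is a triangle in the characteristic coordinates, and the segment from the
boundary point to a point near the corner \<open>(gm (r j), l + a * L j)\<close> stays inside it.\<close>

lemma right_in_closure_P:
  assumes t: "t \<in> {L j..L (Suc j)}"
  shows "(t, l) \<in> closure (P j (Suc j))"
proof -
  have adj: "adj j (Suc j)" by (simp add: adj_def)
  define d where "d = a * (L (Suc j) - L j) / 4"
  have d: "d > 0" using a_pos by (simp add: d_def)
  \<comment> \<open>a point of the open triangle close to its right angle\<close>
  define \<xi>c where "\<xi>c = gm (r j) + d"
  define \<eta>c where "\<eta>c = l + a * L j + d"
  have "a * (L (Suc j) - L j) = 4 * d" by (simp add: d_def)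
  then have aL: "a * L (Suc j) = a * L j + 4 * d" by (simp add: algebra_simps)
  have b: "gm (r j) \<le> l - a * t" "l - a * t \<le> l - a * L j" "l + a * L j \<le> l + a * t"
    "l + a * t \<le> l + a * L (Suc j)"
    using t a_pos by (simp_all add: gm_r)
  have c: "gm (r j) < \<xi>c" "\<xi>c < l - a * L j" "l + a * L j < \<eta>c" "\<eta>c < l + a * L (Suc j)"
    "\<xi>c + \<eta>c < 2 * l"
    using d aL by (simp_all add: \<xi>c_def \<eta>c_def gm_r)
  have "ch (l - a * t) (l + a * t) \<in> closure (P j (Suc j))"
  proof (rule in_closure_at_right[OF ch_path_tendsto, of 1 _ "\<xi>c - (l - a * t)" _ "\<eta>c - (l + a * t)"])
    fix s :: real assume s: "0 < s" "s < 1"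
    define \<xi> where "\<xi> = (l - a * t) + s * (\<xi>c - (l - a * t))"
    define \<eta> where "\<eta> = (l + a * t) + s * (\<eta>c - (l + a * t))"
    have e: "gm (r j) < \<xi>" "\<xi> < l - a * L j" "l + a * L j < \<eta>" "\<eta> < l + a * L (Suc j)"
      unfolding \<xi>_def \<eta>_def by (rule convex_step[OF s] b c)+
    have "\<xi> + \<eta> = 2 * l + s * (\<xi>c + \<eta>c - 2 * l)" by (simp add: \<xi>_def \<eta>_def algebra_simps)
    also have "\<dots> < 2 * l" using c(5) s by (intro convex_step) auto
    finally have sum: "\<xi> + \<eta> < 2 * l" .
    have "0 \<le> a * L j" using a_pos by simp
    then have "\<xi> < \<eta>" using e by linarith
    moreover have "gp (r j) < l + a * L j" by (rule gp_r_less)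
    ultimately have "ch \<xi> \<eta> \<in> Q"
      using e sum by (intro ch_in_Q[where \<tau>="r j"]) auto
    then show "ch ((l - a * t) + s * (\<xi>c - (l - a * t))) ((l + a * t) + s * (\<eta>c - (l + a * t))) \<in> P j (Suc j)"
      using e unfolding \<xi>_def[symmetric] \<eta>_def[symmetric]
      by (subst in_P_iff[OF adj]) (auto simp: gp_r_Suc)
  qed simp
  then show ?thesis by (simp add: ch_self)
qed

lemma row_exists:
  assumes "\<xi> \<le> l"
  obtains i where "gm (r i) \<le> \<xi>" "\<xi> \<le> l - a * L i" "i = 0 \<or> \<xi> < l - a * L i"
proof -
  obtain k where "L k > (l - \<xi>) / a" using L_unbounded by blast
  then have "l - \<xi> < a * L k" using a_pos by (simp add: divide_less_eq mult.commute)
  also have "\<dots> < a * L (Suc k)" using a_pos by simp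
  finally have "gm (r k) \<le> \<xi>" unfolding gm_r by simp
  then have ex: "\<exists>k. gm (r k) \<le> \<xi>" by blast
  define i where "i = (LEAST k. gm (r k) \<le> \<xi>)"
  have 1: "gm (r i) \<le> \<xi>" unfolding i_def by (rule LeastI_ex[OF ex])
  show thesis
  proof (cases i)
    case 0
    then show thesis using that[of 0] 1 assms by simp
  next
    case (Suc k)
    have "\<not> gm (r k) \<le> \<xi>" using not_less_Least[of k "\<lambda>k. gm (r k) \<le> \<xi>", folded i_def] Suc by simp
    then show thesis using that[OF 1] Suc by (simp add: gm_r)
  qed
qed

lemma column_exists:
  assumes "\<eta> \<ge> 0"
  obtains j where "gp (r j) \<le> \<eta>" "\<eta> \<le> l + a * L j" "j = 0 \<or> gp (r j) < \<eta>"
proof -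
  obtain k where "L k > (\<eta> - l) / a" using L_unbounded by blast
  then have ex: "\<exists>k. \<eta> \<le> l + a * L k"
    using a_pos by (intro exI[of _ k]) (simp add: divide_less_eq mult.commute)
  define j where "j = (LEAST k. \<eta> \<le> l + a * L k)"
  have 1: "\<eta> \<le> l + a * L j" unfolding j_def by (rule LeastI_ex[OF ex])
  show thesis
  proof (cases j)
    case 0
    then show thesis using that[of 0] 1 assms by simp
  next
    case (Suc k)
    have "\<not> \<eta> \<le> l + a * L k" using not_less_Least[of k "\<lambda>k. \<eta> \<le> l + a * L k", folded j_def] Suc by simp
    then show thesis using that[OF _ 1] Suc by (simp add: gp_r_Suc)
  qed
qed

text \<open>The row and the column of a point exist because the reflection times are unbounded. If \<open>j > i + 1\<close>
the cell would lie beyond \<open>x = l\<close>, and if \<open>i > j + 1\<close> it would lie behind the wall.\<close>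

lemma Q_covered:
  assumes p: "p \<in> Q"
  obtains i j where "adj i j" "p \<in> P i j"
proof -
  obtain \<xi> \<eta> where pc: "p = ch \<xi> \<eta>" using ch_cases .
  note q = Q_D[OF p[unfolded pc]]
  define t where "t = (\<eta> - \<xi>) / (2 * a)"
  have t: "t > 0" "gm t < \<xi>" "gp t < \<eta>" using q a_pos by (simp_all add: t_def)
  obtain i where i: "gm (r i) \<le> \<xi>" "\<xi> \<le> l - a * L i" using row_exists[of \<xi>] q by auto
  obtain j where j: "gp (r j) \<le> \<eta>" "\<eta> \<le> l + a * L j"
    using column_exists[of \<eta>] gp_nonneg[of t] t by auto
  have "gp (r j) < gp (r (Suc (Suc i)))"
    using i j q(2) unfolding gp_r_Suc gm_r by simp
  then have ji: "j \<le> i + 1" by simp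
  have "i \<le> j + 1"
  proof (rule ccontr)
    assume "\<not> i \<le> j + 1"
    then obtain k where k: "i = Suc k" "Suc j \<le> k" by (cases i) auto
    have "\<xi> \<le> gm (r k)" using i k by (simp add: gm_r)
    then have "gm t < gm (r k)" using t by linarith
    then have "r k < t" by simp
    moreover have "\<eta> \<le> gp (r (Suc j))" using j by (simp add: gp_r_Suc)
    then have "gp t < gp (r (Suc j))" using t by linarith
    then have "t < r (Suc j)" by simp
    ultimately show False using k r_le_iff[of "Suc j" k] by linarith
  qed
  then have adj: "adj i j" using ji by (simp add: adj_def)
  show thesis using that[OF adj] in_P_iff[OF adj] i j p unfolding pc by blast
qed

end

section \<open>Uniqueness by propagation from cell to cell\<close>

lemma tendsto_along:
  assumes "continuous_on (closure S) w" "(p \<longlongrightarrow> q) F" "\<forall>\<^sub>F s in F. p s \<in> S" "q \<in> closure S"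
  shows "((\<lambda>s. w (p s)) \<longlongrightarrow> w q) F"
  by (rule continuous_on_tendsto_compose[OF assms(1,2,4)])
     (use closure_subset in \<open>auto intro: eventually_mono[OF assms(3)]\<close>)

context moving_wall
begin

text \<open>The common form of both parts of a classical solution, for arbitrary data and jumps. The jump
condition is expressed through the one-sided derivatives \<open>D_t\<close> of the two adjacent cells, which makes
the notion linear in \<open>u\<close>; it is imposed between the characteristics on which \<open>\<xi>\<close> is a node.\<close>

definition piecewise_solution ::
  "real \<Rightarrow> (real \<times> real \<Rightarrow> real) \<Rightarrow> (real \<Rightarrow> real) \<Rightarrow> (real \<Rightarrow> real) \<Rightarrow> (real \<Rightarrow> real) \<Rightarrow>
   (real \<Rightarrow> real) \<Rightarrow> (nat \<Rightarrow> real) \<Rightarrow> (real \<times> real \<Rightarrow> real) \<Rightarrow> bool" where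
  "piecewise_solution b F \<phi> \<psi> \<mu>1 \<mu>2 J u \<longleftrightarrow>
     (\<forall>i j. adj i j \<longrightarrow> Ck_closure 2 (P i j) u \<and> (\<forall>p \<in> open_cell i j.
        D_t (P i j) (D_t (P i j) u) p - a\<^sup>2 * D_x (P i j) (D_x (P i j) u) p = F p)) \<and>
     (\<forall>x \<in> {0..l}. u (0, x) = \<phi> x \<and> D_t (P 0 0) u (0, x) = \<psi> x) \<and>
     (\<forall>t \<ge> 0. u (t, \<gamma> t) = \<mu>1 t) \<and>
     (\<forall>j. \<forall>t \<in> {L j..L (Suc j)}.
        D_t (P j (Suc j)) (D_t (P j (Suc j)) u) (t, l) + b * D_x (P j (Suc j)) u (t, l) = \<mu>2 t) \<and>
     (\<forall>i \<xi>. gm (r i) < \<xi> \<and> \<xi> < l - a * L i \<longrightarrow>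
        D_t (P i (Suc i)) u (ch \<xi> (l + a * L i)) - D_t (P i i) u (ch \<xi> (l + a * L i)) = J i)"

lemma edge_point:
  assumes "gm (r i) \<le> \<xi>" "\<xi> < l - a * L i"
  shows "ch \<xi> (l + a * L i) \<in> P i i" "ch \<xi> (l + a * L i) \<in> P i (Suc i)"
proof -
  have aL: "0 \<le> a * L i" "a * L i \<le> a * L (Suc i)" using a_pos by simp_all
  have "ch \<xi> (l + a * L i) \<in> Q"
    using assms aL gp_r_less[of i] by (intro ch_in_Q[where \<tau>="r i"]) linarith+
  then show "ch \<xi> (l + a * L i) \<in> P i i" "ch \<xi> (l + a * L i) \<in> P i (Suc i)"
    using assms aL gp_r_less[of i] by (subst in_P_iff; simp add: adj_def gp_r_Suc)+
qed

lemma piecewise_solution_diff: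
  assumes u: "piecewise_solution b F \<phi> \<psi> \<mu>1 \<mu>2 J u"
    and w: "piecewise_solution b F' \<phi>' \<psi>' \<mu>1' \<mu>2' J' w"
  shows "piecewise_solution b (\<lambda>p. F p - F' p) (\<lambda>x. \<phi> x - \<phi>' x) (\<lambda>x. \<psi> x - \<psi>' x)
     (\<lambda>t. \<mu>1 t - \<mu>1' t) (\<lambda>t. \<mu>2 t - \<mu>2' t) (\<lambda>i. J i - J' i) (\<lambda>p. u p - w p)"
proof -
  define d where "d p = u p - w p" for p
  have C2: "Ck_closure 2 (P i j) d" "\<And>p. p \<in> closure (P i j) \<Longrightarrow>
      D_t (P i j) d p = D_t (P i j) u p - D_t (P i j) w p \<and>
      D_x (P i j) d p = D_x (P i j) u p - D_x (P i j) w p \<and>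
      D_t (P i j) (D_t (P i j) d) p = D_t (P i j) (D_t (P i j) u) p - D_t (P i j) (D_t (P i j) w) p \<and>
      D_x (P i j) (D_x (P i j) d) p = D_x (P i j) (D_x (P i j) u) p - D_x (P i j) (D_x (P i j) w) p"
    if ij: "adj i j" for i j
  proof -
    have "Ck_closure 2 (P i j) u" "Ck_closure 2 (P i j) w"
      using u w ij unfolding piecewise_solution_def by blast+
    then have "C2_on (P i j) (\<lambda>p. u p - w p) (\<lambda>p. D_t (P i j) u p - D_t (P i j) w p)
      (\<lambda>p. D_x (P i j) u p - D_x (P i j) w p)
      (\<lambda>p. D_t (P i j) (D_t (P i j) u) p - D_t (P i j) (D_t (P i j) w) p)
      (\<lambda>p. D_x (P i j) (D_t (P i j) u) p - D_x (P i j) (D_t (P i j) w) p)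
      (\<lambda>p. D_t (P i j) (D_x (P i j) u) p - D_t (P i j) (D_x (P i j) w) p)
      (\<lambda>p. D_x (P i j) (D_x (P i j) u) p - D_x (P i j) (D_x (P i j) w) p)"
      unfolding Ck_closure_2_iff by (rule C2_on_diff)
    note C = C2_on_imp_Ck_closure[OF P_regular[OF ij] this, of d, unfolded d_def, OF refl]
    show "Ck_closure 2 (P i j) d" using C(1) by (simp add: d_def[abs_def])
    show "D_t (P i j) d p = D_t (P i j) u p - D_t (P i j) w p \<and>
      D_x (P i j) d p = D_x (P i j) u p - D_x (P i j) w p \<and>
      D_t (P i j) (D_t (P i j) d) p = D_t (P i j) (D_t (P i j) u) p - D_t (P i j) (D_t (P i j) w) p \<and>
      D_x (P i j) (D_x (P i j) d) p = D_x (P i j) (D_x (P i j) u) p - D_x (P i j) (D_x (P i j) w) p"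
      if "p \<in> closure (P i j)" for p
      using C(2-5)[OF that] by (simp add: d_def[abs_def])
  qed
  have adj: "adj 0 0" "adj i i" "adj i (Suc i)" for i by (simp_all add: adj_def)
  have "piecewise_solution b (\<lambda>p. F p - F' p) (\<lambda>x. \<phi> x - \<phi>' x) (\<lambda>x. \<psi> x - \<psi>' x)
     (\<lambda>t. \<mu>1 t - \<mu>1' t) (\<lambda>t. \<mu>2 t - \<mu>2' t) (\<lambda>i. J i - J' i) d"
    unfolding piecewise_solution_def
  proof (intro conjI allI impI ballI)
    fix i j p assume ij: "adj i j" and p: "p \<in> open_cell i j"
    have pc: "p \<in> closure (P i j)"
      using p open_cell_subset_interior[OF ij] interior_subset closure_subset by blast
    have "D_t (P i j) (D_t (P i j) u) p - a\<^sup>2 * D_x (P i j) (D_x (P i j) u) p = F p"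
      "D_t (P i j) (D_t (P i j) w) p - a\<^sup>2 * D_x (P i j) (D_x (P i j) w) p = F' p"
      using u w ij p unfolding piecewise_solution_def by blast+
    then show "D_t (P i j) (D_t (P i j) d) p - a\<^sup>2 * D_x (P i j) (D_x (P i j) d) p = F p - F' p"
      using C2(2)[OF ij pc] by (simp add: right_diff_distrib)
  next
    fix x assume x: "x \<in> {0..l}"
    have "u (0, x) = \<phi> x" "D_t (P 0 0) u (0, x) = \<psi> x" "w (0, x) = \<phi>' x" "D_t (P 0 0) w (0, x) = \<psi>' x"
      using u w x unfolding piecewise_solution_def by blast+
    then show "d (0, x) = \<phi> x - \<phi>' x" "D_t (P 0 0) d (0, x) = \<psi> x - \<psi>' x"
      using C2(2)[OF adj(1) initial_in_closure_P[OF x]] by (simp_all add: d_def)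
  next
    fix t :: real assume "t \<ge> 0"
    then show "d (t, \<gamma> t) = \<mu>1 t - \<mu>1' t" using u w unfolding piecewise_solution_def d_def by simp
  next
    fix j t assume t: "t \<in> {L j..L (Suc j)}"
    have "D_t (P j (Suc j)) (D_t (P j (Suc j)) u) (t, l) + b * D_x (P j (Suc j)) u (t, l) = \<mu>2 t"
      "D_t (P j (Suc j)) (D_t (P j (Suc j)) w) (t, l) + b * D_x (P j (Suc j)) w (t, l) = \<mu>2' t"
      using u w t unfolding piecewise_solution_def by blast+
    then show "D_t (P j (Suc j)) (D_t (P j (Suc j)) d) (t, l) + b * D_x (P j (Suc j)) d (t, l) = \<mu>2 t - \<mu>2' t"
      using C2(2)[OF adj(3) right_in_closure_P[OF t]] by (simp add: right_diff_distrib)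
  next
    fix i \<xi> assume "gm (r i) < \<xi> \<and> \<xi> < l - a * L i"
    note \<xi> = this
    then have e: "ch \<xi> (l + a * L i) \<in> closure (P i i)" "ch \<xi> (l + a * L i) \<in> closure (P i (Suc i))"
      using edge_point[of i \<xi>] closure_subset[of "P i i"] closure_subset[of "P i (Suc i)"] by auto
    have "D_t (P i (Suc i)) u (ch \<xi> (l + a * L i)) - D_t (P i i) u (ch \<xi> (l + a * L i)) = J i"
      using u \<xi> unfolding piecewise_solution_def by blast
    moreover have "D_t (P i (Suc i)) w (ch \<xi> (l + a * L i)) - D_t (P i i) w (ch \<xi> (l + a * L i)) = J' i"
      using w \<xi> unfolding piecewise_solution_def by blast
    ultimately show "D_t (P i (Suc i)) d (ch \<xi> (l + a * L i)) - D_t (P i i) d (ch \<xi> (l + a * L i)) = J i - J' i"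
      using C2(2)[OF adj(2) e(1)] C2(2)[OF adj(3) e(2)] by simp
  qed (use C2 in auto)
  then show ?thesis by (simp add: d_def[abs_def])
qed

context
  fixes b u
  assumes pw: "piecewise_solution b (\<lambda>_. 0) (\<lambda>_. 0) (\<lambda>_. 0) (\<lambda>_. 0) (\<lambda>_. 0) (\<lambda>_. 0) u"
begin

lemma cell_C2:
  assumes "adj i j"
  shows "C2_on (P i j) u (D_t (P i j) u) (D_x (P i j) u) (D_t (P i j) (D_t (P i j) u))
    (D_x (P i j) (D_t (P i j) u)) (D_t (P i j) (D_x (P i j) u)) (D_x (P i j) (D_x (P i j) u))"
  using pw assms unfolding piecewise_solution_def Ck_closure_2_iff by blast

lemma cell_parallelogram:
  assumes ij: "adj i j" and lt: "\<xi>1 < \<xi>2" "\<eta>1 < \<eta>2"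
    and b: "gm (r i) \<le> \<xi>1" "\<xi>2 \<le> l - a * L i" "gp (r j) \<le> \<eta>1" "\<eta>2 \<le> l + a * L j"
    and Q: "\<And>\<xi> \<eta>. \<xi>1 \<le> \<xi> \<Longrightarrow> \<xi> \<le> \<xi>2 \<Longrightarrow> \<eta>1 \<le> \<eta> \<Longrightarrow> \<eta> \<le> \<eta>2 \<Longrightarrow> ch \<xi> \<eta> \<in> Q"
  shows "u (ch \<xi>1 \<eta>1) + u (ch \<xi>2 \<eta>2) = u (ch \<xi>1 \<eta>2) + u (ch \<xi>2 \<eta>1)"
proof -
  let ?S = "open_cell i j"
  have sub: "?S \<subseteq> P i j" using open_cell_subset_interior[OF ij] interior_subset by blast
  have opn: "interior ?S = ?S" by (rule interior_open[OF open_open_cell])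
  show ?thesis
  proof (rule parallelogram_identity[OF a_pos C2_on_subset[OF cell_C2[OF ij] sub] _ lt])
    show "D_t (P i j) (D_t (P i j) u) p = a\<^sup>2 * D_x (P i j) (D_x (P i j) u) p"
      if "p \<in> interior ?S" for p
      using pw ij that unfolding piecewise_solution_def opn by fastforce
    show "ch \<xi> \<eta> \<in> interior ?S" if "\<xi>1 < \<xi>" "\<xi> < \<xi>2" "\<eta>1 < \<eta>" "\<eta> < \<eta>2" for \<xi> \<eta>
      using Q[of \<xi> \<eta>] that b unfolding opn in_open_cell_iff by simp
    show "ch \<xi> \<eta> \<in> closure ?S" if "\<xi>1 \<le> \<xi>" "\<xi> \<le> \<xi>2" "\<eta>1 \<le> \<eta>" "\<eta> \<le> \<eta>2" for \<xi> \<eta>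
      using Q[of \<xi> \<eta>] that b in_P_iff[OF ij, of \<xi> \<eta>] open_cell_dense[OF ij]
      by (meson order_trans subsetD)
  qed
qed

text \<open>By density it suffices to show that \<open>u\<close> vanishes on the open cell.\<close>

lemma zero_on_cellI:
  assumes ij: "adj i j" and z: "\<And>\<xi> \<eta>. ch \<xi> \<eta> \<in> open_cell i j \<Longrightarrow> u (ch \<xi> \<eta>) = 0"
    and p: "p \<in> closure (P i j)"
  shows "u p = 0"
proof (rule continuous_constant_on_closure[where S="open_cell i j"])
  have cl: "closure (open_cell i j) = closure (P i j)"
    using open_cell_dense[OF ij] open_cell_subset_interior[OF ij]
    by (meson closed_closure closure_minimal closure_mono interior_subset order_trans subset_antisym)
  show "continuous_on (closure (open_cell i j)) u" unfolding cl
    by (rule C1_on_D(1)[OF C2_on_D(1)[OF cell_C2[OF ij]]])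
  show "p \<in> closure (open_cell i j)" using p cl by simp
  show "u q = 0" if "q \<in> open_cell i j" for q
    using that z ch_cases[of q] by metis
qed

text \<open>On the triangle above the initial segment the parallelogram identity and \<open>u = 0\<close> at \<open>t = 0\<close> give
\<open>u = g(\<eta>) - g(\<xi>)\<close>. The time derivative \<open>a (g'(\<eta>) + g'(\<xi>))\<close> tends to \<open>2 a g'(s)\<close> at the initial
point \<open>s\<close> and vanishes there, so \<open>g\<close> is constant.\<close>

lemma zero_first_cell:
  assumes "p \<in> closure (P 0 0)"
  shows "u p = 0"
proof (rule zero_on_cellI[OF _ _ assms])
  show adj: "adj 0 0" by (simp add: adj_def)
  let ?S = "P 0 0"
  let ?ut = "D_t ?S u" let ?ux = "D_x ?S u"
  note C1 = C2_on_D(1)[OF cell_C2[OF adj]]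
  have inQ: "ch \<xi> \<eta> \<in> Q" if "0 \<le> \<xi>" "\<xi> < \<eta>" "\<eta> \<le> l" for \<xi> \<eta>
    using that by (intro ch_in_Q[where \<tau>=0]) auto
  have inS: "ch \<xi> \<eta> \<in> ?S" if "0 \<le> \<xi>" "\<xi> < \<eta>" "\<eta> \<le> l" for \<xi> \<eta>
    using that inQ[OF that] unfolding in_P_iff[OF adj] by simp
  have inI: "ch \<xi> \<eta> \<in> interior ?S" if "0 < \<xi>" "\<xi> < \<eta>" "\<eta> < l" for \<xi> \<eta>
    using that inQ in_open_cell_iff[of \<xi> \<eta> 0 0] open_cell_subset_interior[OF adj] by auto
  define g where "g s = u (ch 0 s) - u (ch 0 l)" for s
  have rep0: "u (ch \<xi> \<eta>) = g \<eta> + u (ch \<xi> l)" if "0 < \<xi>" "\<xi> < \<eta>" "\<eta> < l" for \<xi> \<eta>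
    using cell_parallelogram[OF adj, of 0 \<xi> \<eta> l] that inQ unfolding g_def by fastforce
  have diag: "ch s s = (0, s)" for s by (simp add: char_pt_def)
  have path: "((\<lambda>h. ch s (s + h)) \<longlongrightarrow> (0, s)) (at_right 0)" for s
    using ch_path_tendsto[of s 0 s 1] by (simp add: diag)
  have evS: "\<forall>\<^sub>F h in at_right 0. ch s (s + h) \<in> interior ?S" if "0 < s" "s < l" for s
  proof -
    have "\<forall>\<^sub>F h in at_right 0. h \<in> {0<..<l - s}" using that by (intro eventually_at_right_real) simp
    then show ?thesis by (rule eventually_mono) (use that in \<open>auto intro!: inI\<close>)
  qed
  have along: "((\<lambda>h. w (ch s (s + h))) \<longlongrightarrow> w (0, s)) (at_right 0)"
    if "continuous_on (closure ?S) w" "0 < s" "s < l" for w s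
  proof (rule tendsto_along[OF that(1) path])
    show "\<forall>\<^sub>F h in at_right 0. ch s (s + h) \<in> ?S"
      by (rule eventually_mono[OF evS[OF that(2,3)]]) (use interior_subset in auto)
    show "(0, s) \<in> closure ?S" using that by (intro initial_in_closure_P) simp
  qed
  define g1 where "g1 \<xi> \<eta> = ?ut (ch \<xi> \<eta>) / (2 * a) + ?ux (ch \<xi> \<eta>) / 2" for \<xi> \<eta>
  have dg: "(g has_real_derivative g1 \<xi> \<eta>) (at \<eta>)" if b: "0 < \<xi>" "\<xi> < \<eta>" "\<eta> < l" for \<xi> \<eta>
  proof -
    have "((\<lambda>\<eta>. u (ch \<xi> \<eta>) - u (ch \<xi> l)) has_real_derivative g1 \<xi> \<eta>) (at \<eta>)"
      unfolding g1_def
      using DERIV_diff[OF C1_on_char_derivs(1)[OF C1 a_pos inI[OF b]] DERIV_const] by simp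
    then show ?thesis
      by (rule has_field_derivative_transform_within_open[where S="{\<xi><..<l}"])
         (use b rep0 in auto)
  qed
  have g_right: "((\<lambda>h. k (s + h)) \<longlongrightarrow> k s) (at_right 0)" if "isCont k s" for k :: "real \<Rightarrow> real" and s
  proof -
    have "((\<lambda>h. s + h) \<longlongrightarrow> s + 0) (at_right 0)" by (intro tendsto_intros)
    then show ?thesis using isCont_tendsto_compose[OF that] by simp
  qed
  \<comment> \<open>let \<open>t\<close> tend to 0 along \<open>\<xi> = s\<close> in the representation of \<open>u\<close>\<close>
  have trace: "u (ch s l) = - g s" if s: "0 < s" "s < l" for s
  proof -
    have "((\<lambda>h. g (s + h) + u (ch s l)) \<longlongrightarrow> g s + u (ch s l)) (at_right 0)"
      using dg[of "s / 2" s] s by (intro tendsto_intros g_right) (auto intro: DERIV_isCont)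
    moreover have "((\<lambda>h. g (s + h) + u (ch s l)) \<longlongrightarrow> u (0, s)) (at_right 0)"
    proof (rule Lim_transform_eventually[OF along[OF C1_on_D(1)[OF C1] s]])
      have "\<forall>\<^sub>F h in at_right 0. h \<in> {0<..<l - s}" using s by (intro eventually_at_right_real) simp
      then show "\<forall>\<^sub>F h in at_right 0. u (ch s (s + h)) = g (s + h) + u (ch s l)"
        by (rule eventually_mono) (use s in \<open>auto intro!: rep0\<close>)
    qed
    ultimately have "g s + u (ch s l) = u (0, s)" by (intro tendsto_unique) auto
    also have "\<dots> = 0" using pw s unfolding piecewise_solution_def by auto
    finally show ?thesis by simp
  qed
  have rep: "u (ch \<xi> \<eta>) = g \<eta> - g \<xi>" if "0 < \<xi>" "\<xi> < \<eta>" "\<eta> < l" for \<xi> \<eta>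
    using rep0[OF that] trace[of \<xi>] that by simp
  \<comment> \<open>let \<open>t\<close> tend to 0 along \<open>\<xi> = s\<close> in the time derivative of \<open>u\<close>\<close>
  have dg0: "(g has_real_derivative 0) (at s)" if s: "0 < s" "s < l" for s
  proof -
    define m where "m = s / 2"
    have m: "0 < m" "m < s" using s by (auto simp: m_def)
    \<comment> \<open>the derivative of \<open>g\<close>, read off along a fixed line \<open>\<xi> = m\<close>, where its continuity is visible\<close>
    define D where "D \<eta> = g1 m \<eta>" for \<eta>
    have D: "(g has_real_derivative D \<eta>) (at \<eta>)" if "m < \<eta>" "\<eta> < l" for \<eta>
      unfolding D_def using dg m that by simp
    have ut: "?ut (ch s (s + h)) = a * (D (s + h) + D s)" if h: "0 < h" "h < l - s" for h
    proof -
      let ?p = "ch s (s + h)"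
      have p: "?p \<in> interior ?S" using h s by (intro inI) auto
      have "((\<lambda>\<xi>. u (ch \<xi> (s + h))) has_real_derivative - ?ut ?p / (2 * a) + ?ux ?p / 2) (at s)"
        by (rule C1_on_char_derivs(2)[OF C1 a_pos p])
      then have "((\<lambda>\<xi>. g (s + h) - g \<xi>) has_real_derivative - ?ut ?p / (2 * a) + ?ux ?p / 2) (at s)"
        by (rule has_field_derivative_transform_within_open[where S="{0<..<s + h}"])
           (use h s rep in auto)
      moreover have "((\<lambda>\<xi>. g (s + h) - g \<xi>) has_real_derivative 0 - D s) (at s)"
        using s m by (intro DERIV_diff DERIV_const D)
      ultimately have 1: "- ?ut ?p / (2 * a) + ?ux ?p / 2 = - D s"
        using DERIV_unique by fastforce
      have "g1 s (s + h) = D (s + h)"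
        using DERIV_unique[OF dg[of s "s + h"] D[of "s + h"]] h s m by auto
      then have 2: "?ut ?p / (2 * a) + ?ux ?p / 2 = D (s + h)" by (simp add: g1_def)
      have "?ut ?p / a = (?ut ?p / (2 * a) + ?ux ?p / 2) - (- ?ut ?p / (2 * a) + ?ux ?p / 2)"
        by simp
      also have "\<dots> = D (s + h) + D s" unfolding 1 2 by simp
      finally show ?thesis using a_pos by (simp add: field_simps)
    qed
    have contD: "isCont D s"
    proof -
      have cut: "continuous_on {m<..<l} (\<lambda>\<eta>. w (ch m \<eta>))" if "continuous_on (closure ?S) w" for w
      proof (rule continuous_on_compose2[OF that cont_ch[OF continuous_on_const continuous_on_id]])
        show "ch m ` {m<..<l} \<subseteq> closure ?S" using inS m closure_subset[of ?S] by (force simp: less_imp_le)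
      qed
      have "continuous_on {m<..<l} D" unfolding D_def g1_def
        by (intro continuous_intros cut[OF C1_on_D(2)[OF C1]] cut[OF C1_on_D(3)[OF C1]])
           (use a_pos in simp_all)
      then show ?thesis using m s by (simp add: continuous_on_eq_continuous_at)
    qed
    have "((\<lambda>h. a * (D (s + h) + D s)) \<longlongrightarrow> a * (D s + D s)) (at_right 0)"
      by (intro tendsto_intros g_right contD)
    moreover have "((\<lambda>h. a * (D (s + h) + D s)) \<longlongrightarrow> ?ut (0, s)) (at_right 0)"
    proof (rule Lim_transform_eventually[OF along[OF C1_on_D(2)[OF C1] s]])
      have "\<forall>\<^sub>F h in at_right 0. h \<in> {0<..<l - s}" using s by (intro eventually_at_right_real) simp
      then show "\<forall>\<^sub>F h in at_right 0. ?ut (ch s (s + h)) = a * (D (s + h) + D s)"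
        by (rule eventually_mono) (use ut in auto)
    qed
    ultimately have "a * (D s + D s) = ?ut (0, s)" by (intro tendsto_unique) auto
    also have "\<dots> = 0" using pw s unfolding piecewise_solution_def by auto
    finally have "D s = 0" using a_pos by simp
    then show ?thesis using D[of s] m s by simp
  qed
  show "u (ch \<xi> \<eta>) = 0" if "ch \<xi> \<eta> \<in> open_cell 0 0" for \<xi> \<eta>
  proof -
    have b: "0 < \<xi>" "\<xi> < \<eta>" "\<eta> < l" using that Q_D(1)[of \<xi> \<eta>] unfolding in_open_cell_iff by auto
    have "g \<eta> = g \<xi>" by (rule DERIV_isconst3[of 0 l]) (use b dg0 in auto)
    then show ?thesis using rep[OF b] by simp
  qed
qed

text \<open>Since \<open>u\<close> vanishes on the edge \<open>\<xi> = gm (r i)\<close> shared with the diagonal cell, on this cell \<open>u\<close> depends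
on \<open>\<xi>\<close> only. Every line \<open>\<xi> = const\<close> ends at the wall, where \<open>u = 0\<close>.\<close>

lemma zero_wall_cell:
  assumes z: "\<And>p. p \<in> closure (P i i) \<Longrightarrow> u p = 0" and p: "p \<in> closure (P (Suc i) i)"
  shows "u p = 0"
proof (rule zero_on_cellI[OF _ _ p])
  show adj: "adj (Suc i) i" by (simp add: adj_def)
  have adj': "adj i i" by (simp add: adj_def)
  let ?e = "l + a * L i"
  have cont: "continuous_on (closure (P (Suc i) i)) u"
    by (rule C1_on_D(1)[OF C2_on_D(1)[OF cell_C2[OF adj]]])
  have gmr: "gm (r i) = l - a * L (Suc i)" by (rule gm_r)
  have sum: "gm (r i) + ?e < 2 * l" using a_pos by (simp add: gm_r)
  have z': "u (ch \<xi> \<eta>) = 0" if "ch \<xi> \<eta> \<in> P i i" for \<xi> \<eta>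
    using z that closure_subset by blast
  show "u (ch \<xi> \<eta>) = 0" if cell: "ch \<xi> \<eta> \<in> open_cell (Suc i) i" for \<xi> \<eta>
  proof -
    have c: "ch \<xi> \<eta> \<in> Q" "gm (r (Suc i)) < \<xi>" "\<xi> < gm (r i)" "gp (r i) < \<eta>" "\<eta> < ?e"
      using cell by (simp_all add: in_open_cell_iff gmr)
    \<comment> \<open>the time at which the line of constant \<open>\<xi>\<close> leaves the wall\<close>
    obtain \<tau> where \<tau>: "gm \<tau> = \<xi>" using G_surj unfolding surj_def gm_def by metis
    have \<tau>r: "r i < \<tau>" "\<tau> < r (Suc i)" using c \<tau> by auto
    then have \<tau>0: "0 < \<tau>" using r_nonneg[of i] by linarith
    then have gp\<tau>: "gp \<tau> > 0" using gp_strict[of 0 \<tau>] by simp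
    have gpe: "gp (r i) < gp \<tau>" "gp \<tau> < ?e" using \<tau>r gp_strict by (auto simp: gp_r_Suc[symmetric])
    have inQ: "ch \<xi>' \<eta>' \<in> Q" if "\<xi> \<le> \<xi>'" "\<xi>' \<le> gm (r i)" "gp \<tau> < \<eta>'" "\<eta>' \<le> ?e" for \<xi>' \<eta>'
      using that gp\<tau> sum \<tau> gm_nonpos[of "r i"] by (intro ch_in_Q[where \<tau>=\<tau>]) auto
    have corner: "ch (gm (r i)) \<eta>' \<in> P i i" if "gp \<tau> < \<eta>'" "\<eta>' \<le> ?e" for \<eta>'
    proof -
      have "ch (gm (r i)) \<eta>' \<in> Q" using that c by (intro inQ) linarith+
      then show ?thesis unfolding in_P_iff[OF adj'] using that gm_r_less[of i] gpe
        by (intro conjI; (assumption | linarith))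
    qed
    have rep: "u (ch \<xi> \<eta>') = u (ch \<xi> ?e)" if h: "gp \<tau> < \<eta>'" "\<eta>' < ?e" for \<eta>'
    proof -
      have "u (ch \<xi> \<eta>') + u (ch (gm (r i)) ?e) = u (ch \<xi> ?e) + u (ch (gm (r i)) \<eta>')"
      proof (rule cell_parallelogram[OF adj])
        show "ch \<xi>' \<eta>'' \<in> Q" if "\<xi> \<le> \<xi>'" "\<xi>' \<le> gm (r i)" "\<eta>' \<le> \<eta>''" "\<eta>'' \<le> ?e" for \<xi>' \<eta>''
          using that h by (intro inQ) auto
        show "gm (r i) \<le> l - a * L (Suc i)" by (simp add: gmr)
        show "gp (r i) \<le> \<eta>'" using h gpe by linarith
      qed (use c h in auto)
      then show ?thesis using z'[OF corner] h gpe by simp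
    qed
    have wall: "ch \<xi> (gp \<tau>) = (\<tau>, G \<tau>)"
      using ch_self[of "G \<tau>" \<tau>] \<tau> by (simp add: gm_def gp_def)
    have ev: "\<forall>\<^sub>F h in at_right 0. h \<in> {0<..<?e - gp \<tau>}"
      using gpe by (intro eventually_at_right_real) simp
    have path: "((\<lambda>h. ch \<xi> (gp \<tau> + h)) \<longlongrightarrow> (\<tau>, G \<tau>)) (at_right 0)"
      using ch_path_tendsto[of \<xi> 0 "gp \<tau>" 1] by (simp add: wall)
    have evP: "\<forall>\<^sub>F h in at_right 0. ch \<xi> (gp \<tau> + h) \<in> P (Suc i) i"
      using ev
    proof eventually_elim
      case (elim h)
      then have "ch \<xi> (gp \<tau> + h) \<in> Q" using c by (intro inQ) auto
      moreover have "gm (r (Suc i)) \<le> \<xi>" "\<xi> \<le> gm (r i)" "gp (r i) \<le> gp \<tau> + h" "gp \<tau> + h \<le> ?e"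
        using elim c gpe by (simp_all del: gp_less_iff gp_le_iff)
      ultimately show ?case unfolding in_P_iff[OF adj] gmr[symmetric] by blast
    qed
    have "((\<lambda>h. u (ch \<xi> (gp \<tau> + h))) \<longlongrightarrow> u (\<tau>, G \<tau>)) (at_right 0)"
      by (rule tendsto_along[OF cont path evP in_closure_eventually_at_right[OF path evP]])
    moreover have "u (\<tau>, G \<tau>) = 0" using pw \<tau>0 G_eq[of \<tau>] unfolding piecewise_solution_def by simp
    moreover have "((\<lambda>h. u (ch \<xi> (gp \<tau> + h))) \<longlongrightarrow> u (ch \<xi> ?e)) (at_right 0)"
      by (rule Lim_transform_eventually[OF tendsto_const])
         (use ev in \<open>auto elim!: eventually_mono simp: rep\<close>)
    ultimately have "u (ch \<xi> ?e) = 0" by (metis tendsto_unique trivial_limit_at_right_real)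
    moreover have "gp \<tau> < \<eta>"
    proof -
      note q = Q_D(4,3)[OF c(1)]
      have "gm ((\<eta> - \<xi>) / (2 * a)) < gm \<tau>" using q(2) \<tau> by simp
      then have "(\<eta> - \<xi>) / (2 * a) > \<tau>" unfolding gm_less_iff .
      then have "gp \<tau> < gp ((\<eta> - \<xi>) / (2 * a))" by simp
      then show ?thesis using q(1) by linarith
    qed
    ultimately show ?thesis using rep c by simp
  qed
qed

text \<open>The two edges that meet at the earliest point of the cell belong to cells on which \<open>u\<close> vanishes
already, and the parallelogram identity does the rest.\<close>

lemma zero_diagonal_cell:
  assumes z: "\<And>p. p \<in> closure (P (Suc i) i) \<Longrightarrow> u p = 0" "\<And>p. p \<in> closure (P i (Suc i)) \<Longrightarrow> u p = 0"
    and p: "p \<in> closure (P (Suc i) (Suc i))"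
  shows "u p = 0"
proof (rule zero_on_cellI[OF _ _ p])
  show adj: "adj (Suc i) (Suc i)" by (simp add: adj_def)
  have adj': "adj (Suc i) i" "adj i (Suc i)" by (simp_all add: adj_def)
  let ?e = "l + a * L i"
  have z': "u (ch \<xi> \<eta>) = 0" if "ch \<xi> \<eta> \<in> P (Suc i) i \<or> ch \<xi> \<eta> \<in> P i (Suc i)" for \<xi> \<eta>
    using z that closure_subset by blast
  have e: "?e = gp (r (Suc i))" by (simp add: gp_r_Suc)
  show "u (ch \<xi> \<eta>) = 0" if cell: "ch \<xi> \<eta> \<in> open_cell (Suc i) (Suc i)" for \<xi> \<eta>
  proof -
    have c: "gm (r (Suc i)) < \<xi>" "\<xi> < gm (r i)" "?e < \<eta>" "\<eta> < l + a * L (Suc i)"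
      using cell by (simp_all add: in_open_cell_iff gm_r gp_r_Suc)
    have sum: "gm (r i) + \<eta> < 2 * l" using c by (simp add: gm_r)
    have e0: "0 < ?e" using a_pos l_pos by (simp add: add_pos_nonneg)
    have inQ: "ch \<xi>' \<eta>' \<in> Q" if "\<xi> \<le> \<xi>'" "\<xi>' \<le> gm (r i)" "?e \<le> \<eta>'" "\<eta>' \<le> \<eta>" for \<xi>' \<eta>'
      using that e0 c sum e gm_nonpos[of "r i"] by (intro ch_in_Q[where \<tau>="r (Suc i)"]) auto
    have "u (ch \<xi> ?e) + u (ch (gm (r i)) \<eta>) = u (ch \<xi> \<eta>) + u (ch (gm (r i)) ?e)"
      using c by (intro cell_parallelogram[OF adj] inQ) (auto simp: gm_r gp_r_Suc)
    moreover have "ch \<xi> ?e \<in> P (Suc i) i"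
      using inQ[of \<xi> ?e] c gp_r_less[of i] by (subst in_P_iff[OF adj'(1)]) (auto simp: gm_r)
    moreover have "ch (gm (r i)) \<eta> \<in> P i (Suc i)" "ch (gm (r i)) ?e \<in> P i (Suc i)"
      using inQ[of "gm (r i)" \<eta>] inQ[of "gm (r i)" ?e] c gm_r_less[of i] e
      by (subst in_P_iff[OF adj'(2)]; simp)+
    ultimately show ?thesis using z' by simp
  qed
qed

text \<open>Since \<open>u\<close> vanishes on the edge \<open>\<eta> = e\<close> shared with the diagonal cell, here \<open>u = g(\<eta>)\<close>, and the
boundary condition at \<open>x = l\<close> becomes \<open>a\<^sup>2 g'' + b g' = 0\<close>. Continuity gives \<open>g(e) = 0\<close> and the
vanishing jump gives \<open>g'(e) = 0\<close>, so \<open>g = 0\<close>.\<close>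

lemma zero_right_cell:
  assumes z: "\<And>p. p \<in> closure (P i i) \<Longrightarrow> u p = 0" and p: "p \<in> closure (P i (Suc i))"
  shows "u p = 0"
proof (rule zero_on_cellI[OF _ _ p])
  show adj: "adj i (Suc i)" by (simp add: adj_def)
  have adj': "adj i i" by (simp add: adj_def)
  let ?S = "P i (Suc i)"
  let ?ut = "D_t ?S u" let ?ux = "D_x ?S u" let ?utt = "D_t ?S (D_t ?S u)"
  note C2 = cell_C2[OF adj]
  define \<alpha> where "\<alpha> = gm (r i)"
  define e where "e = l + a * L i"
  define top where "top = 2 * l - \<alpha>"
  have top: "top = l + a * L (Suc i)" by (simp add: top_def \<alpha>_def gm_r)
  have aL: "0 \<le> a * L i" using a_pos by simp
  have e2: "2 * l - e = l - a * L i" by (simp add: e_def)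
  have \<alpha>e: "\<alpha> < 2 * l - e" unfolding e2 \<alpha>_def by (rule gm_r_less)
  have inQ: "ch \<xi> \<eta> \<in> Q" if "\<alpha> \<le> \<xi>" "e \<le> \<eta>" "\<xi> + \<eta> < 2 * l" for \<xi> \<eta>
    using that gp_r_less[of i] aL by (intro ch_in_Q[where \<tau>="r i"]) (simp_all add: \<alpha>_def e_def)
  have inS: "ch \<xi> \<eta> \<in> ?S" if "\<alpha> \<le> \<xi>" "e \<le> \<eta>" "\<xi> + \<eta> < 2 * l" for \<xi> \<eta>
    using that inQ[OF that] e2 top unfolding in_P_iff[OF adj] gp_r_Suc e_def[symmetric] \<alpha>_def[symmetric]
    by (auto simp: top_def)
  have inI: "ch \<xi> \<eta> \<in> interior ?S" if "\<alpha> < \<xi>" "e < \<eta>" "\<xi> + \<eta> < 2 * l" for \<xi> \<eta>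
  proof -
    have "ch \<xi> \<eta> \<in> open_cell i (Suc i)"
      using that inQ[of \<xi> \<eta>] e2 top unfolding in_open_cell_iff gp_r_Suc e_def[symmetric] \<alpha>_def[symmetric]
      by (auto simp: top_def)
    then show ?thesis using open_cell_subset_interior[OF adj] by blast
  qed
  have edge: "u (ch \<xi> e) = 0" if "\<alpha> \<le> \<xi>" "\<xi> < 2 * l - e" for \<xi>
    using edge_point(1)[of i \<xi>] that z closure_subset unfolding e2 unfolding \<alpha>_def e_def by blast
  define g where "g \<eta> = u (ch \<alpha> \<eta>)" for \<eta>
  have rep: "u (ch \<xi> \<eta>) = g \<eta>" if b: "\<alpha> < \<xi>" "e < \<eta>" "\<xi> + \<eta> < 2 * l" for \<xi> \<eta>
  proof -
    have "u (ch \<alpha> e) + u (ch \<xi> \<eta>) = u (ch \<alpha> \<eta>) + u (ch \<xi> e)"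
    proof (rule cell_parallelogram[OF adj])
      show "gm (r i) \<le> \<alpha>" "\<xi> \<le> l - a * L i" "gp (r (Suc i)) \<le> e" "\<eta> \<le> l + a * L (Suc i)"
        using b e2 unfolding top[symmetric] gp_r_Suc by (auto simp: \<alpha>_def e_def top_def)
      show "ch \<xi>' \<eta>' \<in> Q" if "\<alpha> \<le> \<xi>'" "\<xi>' \<le> \<xi>" "e \<le> \<eta>'" "\<eta>' \<le> \<eta>" for \<xi>' \<eta>'
        using that b by (intro inQ) auto
    qed (use b in auto)
    then show ?thesis using edge[of \<alpha>] edge[of \<xi>] b \<alpha>e by (simp add: g_def)
  qed
  \<comment> \<open>the open triangle on which \<open>u\<close> is a function of \<open>\<eta>\<close> alone\<close>
  define U where "U = {(t, x). \<alpha> < x - a * t \<and> e < x + a * t \<and> x < l}"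
  have U: "open U"
  proof -
    have "U = {p. \<alpha> < snd p - a * fst p} \<inter> {p. e < snd p + a * fst p} \<inter> {p. snd p < l}"
      by (auto simp: U_def)
    also have "open \<dots>" by (intro open_Int open_Collect_less continuous_intros)
    finally show ?thesis .
  qed
  have UI: "(t, x) \<in> interior ?S" and repU: "u (t, x) = g (x + a * t)" if "(t, x) \<in> U" for t x
    using inI[of "x - a * t" "x + a * t"] rep[of "x - a * t" "x + a * t"] that
    by (auto simp: U_def ch_self)
  have dg: "(g has_real_derivative ?ux (t, x)) (at (x + a * t))" if tx: "(t, x) \<in> U" for t x
  proof -
    have "((\<lambda>y. u (t, y)) has_real_derivative ?ux (t, x)) (at x)"
      by (rule C1_on_D(5)[OF C2_on_D(1)[OF C2] UI[OF tx]])
    then have "((\<lambda>y. g (y + a * t)) has_real_derivative ?ux (t, x)) (at x)"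
      by (rule has_field_derivative_transform_within_open[OF _ open_slices(2)[OF U, of t]])
         (use tx repU in auto)
    then show ?thesis by (simp add: DERIV_shift)
  qed
  have ut: "?ut (t, x) = a * ?ux (t, x)" if tx: "(t, x) \<in> U" for t x
  proof -
    have "((\<lambda>s. u (s, x)) has_real_derivative ?ut (t, x)) (at t)"
      by (rule C1_on_D(4)[OF C2_on_D(1)[OF C2] UI[OF tx]])
    then have "((\<lambda>s. g (x + a * s)) has_real_derivative ?ut (t, x)) (at t)"
      by (rule has_field_derivative_transform_within_open[OF _ open_slices(1)[OF U, of x]])
         (use tx repU in auto)
    moreover have "((\<lambda>s. g (x + a * s)) has_real_derivative ?ux (t, x) * a) (at t)"
      by (rule DERIV_chain2[where f=g and g="\<lambda>s. x + a * s", OF dg[OF tx]]) (auto intro!: derivative_eq_intros)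
    ultimately have "?ut (t, x) = ?ux (t, x) * a" by (rule DERIV_unique)
    then show ?thesis by simp
  qed
  define g1 where "g1 = deriv g"
  have ux: "?ux (t, x) = g1 (x + a * t)" if tx: "(t, x) \<in> U" for t x
    unfolding g1_def using DERIV_imp_deriv[OF dg[OF tx]] by simp
  have dg1: "(g1 has_real_derivative ?utt (t, x) / a\<^sup>2) (at (x + a * t))" if tx: "(t, x) \<in> U" for t x
  proof -
    have "((\<lambda>s. ?ut (s, x)) has_real_derivative ?utt (t, x)) (at t)"
      by (rule C1_on_D(4)[OF C2_on_D(2)[OF C2] UI[OF tx]])
    then have 1: "((\<lambda>s. a * g1 (x + a * s)) has_real_derivative ?utt (t, x)) (at t)"
      by (rule has_field_derivative_transform_within_open[OF _ open_slices(1)[OF U, of x]])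
         (use tx ut ux in auto)
    have "((\<lambda>z. (z - x) / a) has_real_derivative 1 / a) (at (x + a * t))"
      using a_pos by (auto intro!: derivative_eq_intros)
    moreover have "(x + a * t - x) / a = t" using a_pos by simp
    ultimately have "((\<lambda>z. a * g1 (x + a * ((z - x) / a))) has_real_derivative ?utt (t, x) * (1 / a)) (at (x + a * t))"
      using DERIV_chain2[of "\<lambda>s. a * g1 (x + a * s)" _ "\<lambda>z. (z - x) / a"] 1 by metis
    from DERIV_cdivide[OF this, of a] show ?thesis using a_pos by (simp add: power2_eq_square)
  qed
  define m where "m = (\<alpha> + (2 * l - e)) / 2"
  have m: "\<alpha> < m" "m < 2 * l - e" using \<alpha>e by (auto simp: m_def)
  have ode: "(g1 has_real_derivative - b / a\<^sup>2 * g1 \<eta>) (at \<eta>) \<and> (g has_real_derivative g1 \<eta>) (at \<eta>)"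
    if \<eta>: "e < \<eta>" "\<eta> < top" for \<eta>
  proof -
    define t where "t = (\<eta> - l) / a"
    have \<eta>t: "\<eta> = l + a * t" using a_pos by (simp add: t_def)
    have t: "t \<in> {L i..L (Suc i)}" using \<eta> a_pos unfolding \<eta>t e_def top by auto
    have cl: "(t, l) \<in> closure ?S" by (rule right_in_closure_P[OF t])
    have ev: "\<forall>\<^sub>F s in at_right 0. s \<in> {0<..<2 * l - \<eta> - \<alpha>}"
      using \<eta> by (intro eventually_at_right_real) (simp add: top_def)
    \<comment> \<open>approach the boundary point along \<open>\<eta> = const\<close>, where the derivatives of \<open>u\<close> are constant\<close>
    define p where "p s = ch (2 * l - \<eta> + s * (- 1)) (\<eta> + s * 0)" for s
    have lim: "(p \<longlongrightarrow> (t, l)) (at_right 0)"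
      using ch_path_tendsto[of "2 * l - \<eta>" "- 1" \<eta> 0] ch_self[of l t] unfolding p_def
      by (simp add: \<eta>t)
    have evU: "\<forall>\<^sub>F s in at_right 0. p s \<in> U \<and> snd (p s) + a * fst (p s) = \<eta>"
      using ev
    proof eventually_elim
      case (elim s)
      have "snd (p s) - a * fst (p s) = 2 * l - \<eta> - s" "snd (p s) + a * fst (p s) = \<eta>"
        using char_pt_coords[of a "2 * l - \<eta> + s * (- 1)" "\<eta> + s * 0"] a_pos unfolding p_def by auto
      moreover have "snd (p s) < l" using elim by (simp add: p_def char_pt_def)
      ultimately show ?case using elim \<eta> by (auto simp: U_def split_beta)
    qed
    have evS: "\<forall>\<^sub>F s in at_right 0. p s \<in> ?S"
      using evU by eventually_elim (use UI interior_subset in \<open>metis prod.collapse subsetD\<close>)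
    have "\<exists>s. p s \<in> U \<and> snd (p s) + a * fst (p s) = \<eta>"
      using eventually_happens[OF evU] by simp
    then obtain D where D: "(g1 has_real_derivative D) (at \<eta>)" and g: "(g has_real_derivative g1 \<eta>) (at \<eta>)"
      using dg1 dg ux by (metis prod.collapse)
    have "?utt (p s) = a\<^sup>2 * D \<and> ?ux (p s) = g1 \<eta>" if "p s \<in> U" "snd (p s) + a * fst (p s) = \<eta>" for s
      using dg1[of "fst (p s)" "snd (p s)"] ux[of "fst (p s)" "snd (p s)"] that D a_pos
      by (auto dest: DERIV_unique)
    then have evD: "\<forall>\<^sub>F s in at_right 0. ?utt (p s) + b * ?ux (p s) = a\<^sup>2 * D + b * g1 \<eta>"
      using evU by (auto elim: eventually_mono)
    have "((\<lambda>s. ?utt (p s) + b * ?ux (p s)) \<longlongrightarrow> ?utt (t, l) + b * ?ux (t, l)) (at_right 0)"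
      by (intro tendsto_intros tendsto_along[OF _ lim evS cl] C1_on_D(2)[OF C2_on_D(2)[OF C2]]
          C1_on_D(3)[OF C2_on_D(1)[OF C2]])
    moreover have "?utt (t, l) + b * ?ux (t, l) = 0"
      using pw t unfolding piecewise_solution_def by blast
    ultimately have "((\<lambda>s. ?utt (p s) + b * ?ux (p s)) \<longlongrightarrow> 0) (at_right 0)" by simp
    moreover have "((\<lambda>s. ?utt (p s) + b * ?ux (p s)) \<longlongrightarrow> a\<^sup>2 * D + b * g1 \<eta>) (at_right 0)"
      by (rule tendsto_eventually[OF evD])
    ultimately have "0 = a\<^sup>2 * D + b * g1 \<eta>" by (rule tendsto_unique[OF trivial_limit_at_right_real])
    then have *: "a\<^sup>2 * D = - (b * g1 \<eta>)" by simp
    have "D = a\<^sup>2 * D / a\<^sup>2" using a_pos by simp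
    then have "D = - b / a\<^sup>2 * g1 \<eta>" unfolding * by simp
    then show ?thesis using D g by simp
  qed
  have ev: "\<forall>\<^sub>F h in at_right 0. h \<in> {0<..<2 * l - e - m}"
    using m by (intro eventually_at_right_real) simp
  have evS: "\<forall>\<^sub>F h in at_right 0. ch m (e + h) \<in> ?S"
    using ev by eventually_elim (use m in \<open>auto intro!: inS\<close>)
  have path: "((\<lambda>h. ch m (e + h)) \<longlongrightarrow> ch m e) (at_right 0)"
    using ch_path_tendsto[of m 0 e 1] by simp
  have mS: "ch m e \<in> closure ?S" using inS[of m e] m closure_subset by auto
  have lim_g: "((\<lambda>h. g (e + h)) \<longlongrightarrow> 0) (at_right 0)"
  proof (rule Lim_transform_eventually)
    show "((\<lambda>h. u (ch m (e + h))) \<longlongrightarrow> 0) (at_right 0)"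
      using tendsto_along[OF C1_on_D(1)[OF C2_on_D(1)[OF C2]] path evS mS] edge[of m] m by simp
    show "\<forall>\<^sub>F h in at_right 0. u (ch m (e + h)) = g (e + h)"
      using ev by eventually_elim (use m in \<open>auto intro!: rep\<close>)
  qed
  \<comment> \<open>the only place where the vanishing jump of the time derivative is used\<close>
  have lim_g1: "((\<lambda>h. g1 (e + h)) \<longlongrightarrow> 0) (at_right 0)"
  proof -
    have zero: "C1_on (P i i) (\<lambda>_. 0) (\<lambda>_. 0) (\<lambda>_. 0)" by (simp add: C1_on_def)
    have mi: "ch m e \<in> closure (P i i)"
      using edge_point(1)[of i m] m closure_subset[of "P i i"] unfolding e2 unfolding \<alpha>_def e_def by auto
    have "D_t (P i i) u (ch m e) = 0"
      by (rule D_eq_of_C1_on(1)[OF P_regular[OF adj'] zero _ mi]) (use z in auto)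
    moreover have "?ut (ch m e) - D_t (P i i) u (ch m e) = 0"
      using pw m unfolding piecewise_solution_def e2 unfolding \<alpha>_def e_def by blast
    ultimately have "?ut (ch m e) = 0" by simp
    then have "((\<lambda>h. ?ut (ch m (e + h)) / a) \<longlongrightarrow> 0 / a) (at_right 0)"
      using tendsto_along[OF C1_on_D(2)[OF C2_on_D(1)[OF C2]] path evS mS] a_pos
      by (intro tendsto_intros) auto
    then have "((\<lambda>h. ?ut (ch m (e + h)) / a) \<longlongrightarrow> 0) (at_right 0)" by simp
    then show ?thesis
    proof (rule Lim_transform_eventually)
      show "\<forall>\<^sub>F h in at_right 0. ?ut (ch m (e + h)) / a = g1 (e + h)"
        using ev
      proof eventually_elim
        case (elim h)
        let ?p = "ch m (e + h)"
        have "snd ?p - a * fst ?p = m" "snd ?p + a * fst ?p = e + h"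
          using char_pt_coords[of a m "e + h"] a_pos by auto
        moreover have "snd ?p < l" using elim by (simp add: char_pt_def)
        ultimately have "?p \<in> U" using elim m by (auto simp: U_def split_beta)
        then show ?case
          using ut[of "fst ?p" "snd ?p"] ux[of "fst ?p" "snd ?p"] a_pos
            \<open>snd ?p + a * fst ?p = e + h\<close> by simp
      qed
    qed
  qed
  have const_zero: "k \<eta> = 0" if \<eta>: "e < \<eta>" "\<eta> < top"
    and d: "\<And>\<eta>. e < \<eta> \<Longrightarrow> \<eta> < top \<Longrightarrow> (k has_real_derivative 0) (at \<eta>)"
    and lim: "((\<lambda>h. k (e + h)) \<longlongrightarrow> 0) (at_right 0)" for k \<eta>
  proof -
    have "((\<lambda>h. k (e + h)) \<longlongrightarrow> k \<eta>) (at_right 0)"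
    proof (rule Lim_transform_eventually[OF tendsto_const])
      have "\<forall>\<^sub>F h in at_right 0. h \<in> {0<..<top - e}" using \<eta> by (intro eventually_at_right_real) simp
      then show "\<forall>\<^sub>F h in at_right 0. k \<eta> = k (e + h)"
      proof eventually_elim
        case (elim h)
        then show ?case by (intro DERIV_isconst3[of e top]) (use \<eta> d in auto)
      qed
    qed
    then show ?thesis using lim by (rule tendsto_unique[OF trivial_limit_at_right_real])
  qed
  \<comment> \<open>first integral of the boundary equation, with constant 0 by the limits at \<open>e\<close>\<close>
  have first: "a\<^sup>2 * g1 \<eta> + b * g \<eta> = 0" if \<eta>: "e < \<eta>" "\<eta> < top" for \<eta>
  proof (rule const_zero[OF \<eta>])
    show "((\<lambda>\<eta>. a\<^sup>2 * g1 \<eta> + b * g \<eta>) has_real_derivative 0) (at \<eta>)" if "e < \<eta>" "\<eta> < top" for \<eta>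
    proof -
      have "((\<lambda>\<eta>. a\<^sup>2 * g1 \<eta> + b * g \<eta>) has_real_derivative a\<^sup>2 * (- b / a\<^sup>2 * g1 \<eta>) + b * g1 \<eta>) (at \<eta>)"
        using ode[OF that] by (intro DERIV_add DERIV_cmult) auto
      then show ?thesis using a_pos by simp
    qed
    have "((\<lambda>h. a\<^sup>2 * g1 (e + h) + b * g (e + h)) \<longlongrightarrow> a\<^sup>2 * 0 + b * 0) (at_right 0)"
      by (intro tendsto_intros lim_g lim_g1)
    then show "((\<lambda>h. a\<^sup>2 * g1 (e + h) + b * g (e + h)) \<longlongrightarrow> 0) (at_right 0)" by simp
  qed
  have "g \<eta> * exp (b / a\<^sup>2 * \<eta>) = 0" if \<eta>: "e < \<eta>" "\<eta> < top" for \<eta>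
  proof (rule const_zero[OF \<eta>])
    show "((\<lambda>\<eta>. g \<eta> * exp (b / a\<^sup>2 * \<eta>)) has_real_derivative 0) (at \<eta>)" if "e < \<eta>" "\<eta> < top" for \<eta>
    proof -
      have "((\<lambda>\<eta>. g \<eta> * exp (b / a\<^sup>2 * \<eta>)) has_real_derivative
          g1 \<eta> * exp (b / a\<^sup>2 * \<eta>) + (exp (b / a\<^sup>2 * \<eta>) * (b / a\<^sup>2)) * g \<eta>) (at \<eta>)"
      proof -
        have "((\<lambda>\<eta>. exp (k * \<eta>)) has_real_derivative exp (k * \<eta>) * k) (at \<eta>)" for k
          by (auto intro!: derivative_eq_intros)
        then show ?thesis by (rule DERIV_mult[OF conjunct2[OF ode[OF that]]])
      qed
      moreover have "g1 \<eta> * exp (b / a\<^sup>2 * \<eta>) + (exp (b / a\<^sup>2 * \<eta>) * (b / a\<^sup>2)) * g \<eta> =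
          exp (b / a\<^sup>2 * \<eta>) / a\<^sup>2 * (a\<^sup>2 * g1 \<eta> + b * g \<eta>)"
        using a_pos by (simp add: field_simps)
      ultimately show ?thesis using first[OF that] by simp
    qed
    have "((\<lambda>h. g (e + h) * exp (b / a\<^sup>2 * (e + h))) \<longlongrightarrow> 0 * exp (b / a\<^sup>2 * (e + 0))) (at_right 0)"
      by (intro tendsto_intros lim_g)
    then show "((\<lambda>h. g (e + h) * exp (b / a\<^sup>2 * (e + h))) \<longlongrightarrow> 0) (at_right 0)" by simp
  qed
  then have g0: "g \<eta> = 0" if "e < \<eta>" "\<eta> < top" for \<eta> using that by simp
  show "u (ch \<xi> \<eta>) = 0" if "ch \<xi> \<eta> \<in> open_cell i (Suc i)" for \<xi> \<eta>
  proof -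
    have "\<alpha> < \<xi>" "e < \<eta>" "\<xi> + \<eta> < 2 * l" "\<eta> < top"
      using that Q_D(2)[of \<xi> \<eta>] unfolding in_open_cell_iff gp_r_Suc
      by (auto simp: \<alpha>_def e_def top)
    then show ?thesis using rep g0 by simp
  qed
qed

lemma zero_diagonal: "p \<in> closure (P i i) \<Longrightarrow> u p = 0"
proof (induction i arbitrary: p)
  case 0
  then show ?case by (rule zero_first_cell)
next
  case (Suc i)
  show ?case
    by (rule zero_diagonal_cell[OF zero_wall_cell zero_right_cell Suc.prems]) (use Suc.IH in auto)
qed

lemma zero_on_cells:
  assumes "adj i j" "p \<in> closure (P i j)"
  shows "u p = 0"
proof -
  consider "i = j" | "i = Suc j" | "j = Suc i" using assms(1) unfolding adj_def by linarith
  then show ?thesis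
    using assms(2) zero_diagonal zero_wall_cell zero_right_cell by cases blast+
qed

text \<open>Near a point of the closure only finitely many cells meet the domain, because the reflection times
tend to infinity; so the point lies in the closure of one of the cells.\<close>

lemma piecewise_solution_zero:
  assumes p: "p \<in> closure Q"
  shows "u p = 0"
proof -
  define N where "N = fst p + 1"
  obtain n where n: "L n > N" using L_unbounded by blast
  define B where "B = {q :: real \<times> real. fst q < N}"
  have B: "open B" "p \<in> B" unfolding B_def N_def by (auto intro!: open_Collect_less continuous_intros)
  define I where "I = {(i, j). adj i j \<and> i \<le> n + 2 \<and> j \<le> n + 2}"
  have fin: "finite I"
    by (rule finite_subset[of _ "{..n + 2} \<times> {..n + 2}"]) (auto simp: I_def)
  have "Q \<inter> B \<subseteq> (\<Union>(i, j)\<in>I. P i j)"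
  proof
    fix q assume q: "q \<in> Q \<inter> B"
    then obtain i j where ij: "adj i j" "q \<in> P i j" using Q_covered by blast
    obtain t x where tx: "q = (t, x)" by (cases q)
    have d: "gm (r i) \<le> x - a * t" "gp (r j) \<le> x + a * t" "x - a * t \<le> l - a * L i"
      using ij closure_P_D[OF ij(1), of t x] closure_subset tx by auto
    have tN: "t < L n" "G t < x" "t > 0" "x < l" using q n G_eq[of t] by (auto simp: tx B_def Qdom_def)
    have "a * t < a * L n" using tN a_pos by simp
    then have "gp (r j) < gp (r (Suc n))" unfolding gp_r_Suc using d tN by linarith
    then have j: "j < Suc n" by simp
    have "gm (r (Suc n)) < gm t" using tN L_less_r[of n] by simp
    then have "a * L i < a * L (Suc (Suc n))" using d tN unfolding gm_r unfolding gm_def by linarith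
    then have "i < Suc (Suc n)" using a_pos by simp
    then show "q \<in> (\<Union>(i, j)\<in>I. P i j)" using ij j unfolding I_def by (intro UN_I[of "(i, j)"]) auto
  qed
  then have sub: "Q \<inter> B \<subseteq> (\<Union>(i, j)\<in>I. P i j)" .
  have "closure (Q \<inter> B) \<subseteq> (\<Union>(i, j)\<in>I. closure (P i j))"
  proof (rule closure_minimal)
    have "(\<Union>(i, j)\<in>I. P i j) \<subseteq> (\<Union>(i, j)\<in>I. closure (P i j))"
      by (intro UN_mono) (auto intro: subsetD[OF closure_subset])
    then show "Q \<inter> B \<subseteq> (\<Union>(i, j)\<in>I. closure (P i j))" using sub by (rule order_trans[rotated])
    show "closed (\<Union>(i, j)\<in>I. closure (P i j))" using fin by (intro closed_UN) auto
  qed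
  moreover have "p \<in> closure (Q \<inter> B)"
    using open_Int_closure_subset[OF B(1), of Q] B(2) p by (auto simp: Int_commute)
  ultimately obtain i j where "(i, j) \<in> I" "p \<in> closure (P i j)" by blast
  then show ?thesis using zero_on_cells[of i j p] by (simp add: I_def)
qed

end

end

section \<open>Gluing, and the successive reflections\<close>

text \<open>The function that equals \<open>h 0\<close> up to the node \<open>c 0\<close> and \<open>h (Suc i)\<close> between \<open>c i\<close> and \<open>c (Suc i)\<close>.\<close>

definition pick :: "(nat \<Rightarrow> real) \<Rightarrow> (nat \<Rightarrow> real \<Rightarrow> real) \<Rightarrow> real \<Rightarrow> real" where
  "pick c h x = h (LEAST i. x \<le> c i) x"

lemma pick_eq:
  assumes c: "strict_mono c" and match: "\<And>i. h (Suc i) (c i) = h i (c i)"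
    and x: "x \<le> c i" "\<And>k. i = Suc k \<Longrightarrow> c k \<le> x"
  shows "pick c h x = h i x"
proof (cases "\<exists>k. i = Suc k \<and> x = c k")
  case True
  then obtain k where k: "i = Suc k" "x = c k" by blast
  have "(LEAST i. x \<le> c i) = k"
    by (rule Least_equality) (use c k in \<open>auto simp: strict_mono_less_eq\<close>)
  then show ?thesis using match k by (simp add: pick_def)
next
  case False
  have "(LEAST i. x \<le> c i) = i"
  proof (rule Least_equality)
    show "x \<le> c i" by (rule x(1))
    fix m assume m: "x \<le> c m"
    show "i \<le> m"
    proof (cases i)
      case (Suc k)
      then have "c k \<noteq> x" "c k \<le> x" using False x(2)[OF Suc] by auto
      then have "c k < c m" using m by simp
      then show ?thesis using c Suc by (simp add: strict_mono_less)
    qed simp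
  qed
  then show ?thesis by (simp add: pick_def)
qed

text \<open>Around any point the glued function is a single piece \<open>k\<close> to the left and a single piece \<open>m\<close> to the
right. The indices do not depend on \<open>h\<close>, so they serve for a family and for its derivatives alike.\<close>

lemma pick_local:
  assumes c: "strict_mono c" and unb: "\<And>x. \<exists>i. x \<le> c i"
  obtains k m e where "e > 0" "m = k \<or> m = Suc k \<and> x = c k" "\<And>h. pick c h x = h k x"
    "\<And>h y. (\<And>i. h (Suc i) (c i) = h i (c i)) \<Longrightarrow> x - e < y \<Longrightarrow> y \<le> x \<Longrightarrow> pick c h y = h k y"
    "\<And>h y. (\<And>i. h (Suc i) (c i) = h i (c i)) \<Longrightarrow> x \<le> y \<Longrightarrow> y < x + e \<Longrightarrow> pick c h y = h m y"
proof -
  define k where "k = (LEAST i. x \<le> c i)"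
  have k: "x \<le> c k" unfolding k_def by (rule LeastI_ex[OF unb])
  have k': "c n < x" if "k = Suc n" for n
    using not_less_Least[of n "\<lambda>i. x \<le> c i", folded k_def] that by simp
  define d where "d = (case k of 0 \<Rightarrow> 1 | Suc n \<Rightarrow> x - c n)"
  have d: "d > 0" using k' by (auto simp: d_def split: nat.split)
  have left: "pick c h y = h k y"
    if "\<And>i. h (Suc i) (c i) = h i (c i)" "x - d < y" "y \<le> x" for h y
    by (rule pick_eq[OF c that(1)]) (use k that in \<open>auto simp: d_def\<close>)
  have px: "pick c h x = h k x" for h by (simp add: pick_def k_def)
  show thesis
  proof (cases "x = c k")
    case True
    have s: "c k < c (Suc k)" using c by (simp add: strict_mono_less)
    show thesis
    proof (rule that[of "min d (c (Suc k) - c k)" "Suc k" k])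
      show "pick c h y = h (Suc k) y"
        if "\<And>i. h (Suc i) (c i) = h i (c i)" "x \<le> y" "y < x + min d (c (Suc k) - c k)" for h y
        by (rule pick_eq[OF c that(1)]) (use True that in auto)
    qed (use d s True left px in auto)
  next
    case False
    show thesis
    proof (rule that[of "min d (c k - x)" k k])
      show "pick c h y = h k y"
        if "\<And>i. h (Suc i) (c i) = h i (c i)" "x \<le> y" "y < x + min d (c k - x)" for h y
        by (rule pick_eq[OF c that(1)]) (use k' that in \<open>auto intro: order_trans less_imp_le\<close>)
    qed (use d k False left px in auto)
  qed
qed

lemma continuous_on_pick:
  assumes c: "strict_mono c" and unb: "\<And>x. \<exists>i. x \<le> c i"
    and cont: "\<And>i. continuous_on UNIV (h i)" and match: "\<And>i. h (Suc i) (c i) = h i (c i)"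
  shows "continuous_on UNIV (pick c h)"
proof -
  have "(pick c h \<longlongrightarrow> pick c h x) (at x)" for x
  proof -
    have lim: "(h i \<longlongrightarrow> h i x) (at x within S)" for i S
      using cont[of i] by (auto simp: continuous_on_def intro: tendsto_within_subset)
    show ?thesis
    proof (cases rule: pick_local[OF c unb, of x])
      case (1 k m e)
      note e = 1(1) and km = 1(2) and px = 1(3) and l = 1(4) and r = 1(5)
      show ?thesis
      proof (rule filterlim_split_at)
      have "\<forall>\<^sub>F y in at_left x. y \<in> {x - e<..<x}" using e by (intro eventually_at_left_real) simp
      then have "\<forall>\<^sub>F y in at_left x. h k y = pick c h y"
        by (rule eventually_mono) (use l[OF match] in auto)
      from Lim_transform_eventually[OF lim this] show "(pick c h \<longlongrightarrow> pick c h x) (at_left x)"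
        by (simp add: px)
      have "\<forall>\<^sub>F y in at_right x. y \<in> {x<..<x + e}" using e by (intro eventually_at_right_real) simp
      then have "\<forall>\<^sub>F y in at_right x. h m y = pick c h y"
        by (rule eventually_mono) (use r[OF match] in auto)
      from Lim_transform_eventually[OF lim this] show "(pick c h \<longlongrightarrow> pick c h x) (at_right x)"
        using km match by (auto simp: px)
      qed
    qed
  qed
  then show ?thesis by (simp add: continuous_on_def)
qed

lemma DERIV_pick:
  assumes c: "strict_mono c" and unb: "\<And>x. \<exists>i. x \<le> c i"
    and d: "\<And>i x. (h i has_real_derivative h' i x) (at x)"
    and match: "\<And>i. h (Suc i) (c i) = h i (c i)" and match': "\<And>i. h' (Suc i) (c i) = h' i (c i)"
  shows "(pick c h has_real_derivative pick c h' x) (at x)"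
proof (cases rule: pick_local[OF c unb, of x])
  case (1 k m e)
  note e = 1(1) and km = 1(2) and px = 1(3) and l = 1(4) and r = 1(5)
  have hm: "h' m x = h' k x" using km match' by auto
  have L: "(pick c h has_real_derivative h' k x) (at x within {..x})"
    by (rule has_field_derivative_transform_within[OF has_field_derivative_at_within[OF d] e])
       (use l[OF match] in \<open>auto simp: dist_real_def\<close>)
  have R: "(pick c h has_real_derivative h' k x) (at x within {x..})"
    unfolding hm[symmetric]
    by (rule has_field_derivative_transform_within[OF has_field_derivative_at_within[OF d] e])
       (use r[OF match] in \<open>auto simp: dist_real_def\<close>)
  have "(pick c h has_real_derivative h' k x) (at_left x)" by (rule DERIV_subset[OF L]) auto
  moreover have "(pick c h has_real_derivative h' k x) (at_right x)" by (rule DERIV_subset[OF R]) auto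
  ultimately show ?thesis unfolding px has_field_derivative_iff by (rule filterlim_split_at)
qed

lemma C2_line_pick:
  assumes c: "strict_mono c" and unb: "\<And>x. \<exists>i. x \<le> c i" and h: "\<And>i. C2_line (h i)"
    and match: "\<And>i. h (Suc i) (c i) = h i (c i)" "\<And>i. deriv (h (Suc i)) (c i) = deriv (h i) (c i)"
      "\<And>i. deriv (deriv (h (Suc i))) (c i) = deriv (deriv (h i)) (c i)"
  shows "C2_line (pick c h)" "deriv (pick c h) = pick c (\<lambda>i. deriv (h i))"
    "deriv (deriv (pick c h)) = pick c (\<lambda>i. deriv (deriv (h i)))"
proof -
  have 1: "(pick c h has_real_derivative pick c (\<lambda>i. deriv (h i)) x) (at x)" for x
    using DERIV_pick[of c h "\<lambda>i. deriv (h i)", OF c unb C2_lineD(1)[OF h] match(1,2)] .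
  have 2: "(pick c (\<lambda>i. deriv (h i)) has_real_derivative pick c (\<lambda>i. deriv (deriv (h i))) x) (at x)" for x
    using DERIV_pick[of c "\<lambda>i. deriv (h i)" "\<lambda>i. deriv (deriv (h i))",
        OF c unb C2_lineD(2)[OF h] match(2,3)] .
  have 3: "continuous_on UNIV (pick c (\<lambda>i. deriv (deriv (h i))))"
    using continuous_on_pick[of c "\<lambda>i. deriv (deriv (h i))", OF c unb C2_lineD(3)[OF h] match(3)] .
  show "C2_line (pick c h)" "deriv (pick c h) = pick c (\<lambda>i. deriv (h i))"
    "deriv (deriv (pick c h)) = pick c (\<lambda>i. deriv (deriv (h i)))"
    by (fact C2_lineI[OF 1 2 3])+
qed

lemma C2_line_reflect:
  assumes "C2_line h"
  shows "C2_line (\<lambda>x. h (- x))" "deriv (\<lambda>x. h (- x)) = (\<lambda>x. - deriv h (- x))"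
    "deriv (deriv (\<lambda>x. h (- x))) = (\<lambda>x. deriv (deriv h) (- x))"
  using C2_line_comp[OF assms C2_line_affine(1)[of "- 1" 0]] C2_line_affine(2,3)[of "- 1" 0]
  by simp_all

lemma right_derivatives_equal:
  fixes K h :: "real \<Rightarrow> real"
  assumes d: "(K has_real_derivative k) (at x)" "(h has_real_derivative k') (at x)"
    and e: "e > 0" and eq: "\<And>y. x \<le> y \<Longrightarrow> y < x + e \<Longrightarrow> K y = h y"
  shows "k = k'"
proof -
  have "(K has_real_derivative k') (at x within {x..})"
    by (rule has_field_derivative_transform_within[OF has_field_derivative_at_within[OF d(2)] e])
       (use eq in \<open>auto simp: dist_real_def\<close>)
  then have "((\<lambda>y. (K y - K x) / (y - x)) \<longlongrightarrow> k') (at_right x)"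
    unfolding has_field_derivative_iff by (rule tendsto_within_subset) auto
  moreover have "((\<lambda>y. (K y - K x) / (y - x)) \<longlongrightarrow> k) (at_right x)"
    using d(1) unfolding has_field_derivative_iff by (rule tendsto_within_subset) auto
  ultimately show ?thesis by (intro tendsto_unique[OF trivial_limit_at_right_real])
qed

lemma left_derivatives_equal:
  fixes K h :: "real \<Rightarrow> real"
  assumes d: "(K has_real_derivative k) (at x)" "(h has_real_derivative k') (at x)"
    and e: "e > 0" and eq: "\<And>y. x - e < y \<Longrightarrow> y \<le> x \<Longrightarrow> K y = h y"
  shows "k = k'"
proof -
  have "((\<lambda>y. K (- y)) has_real_derivative - k) (at (- x))"
    "((\<lambda>y. h (- y)) has_real_derivative - k') (at (- x))"
    by (rule DERIV_mirror[THEN iffD1]; use d in simp)+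
  from right_derivatives_equal[OF this e] eq have "- k = - k'" by simp
  then show ?thesis by simp
qed

text \<open>The derivatives of \<open>K\<close> at \<open>c\<close> are two-sided, hence equal to those of either piece.\<close>

lemma C2_pieces_agree:
  fixes K K1 K2 h k :: "real \<Rightarrow> real"
  assumes e: "e > 0" and d: "\<And>x. c - e < x \<Longrightarrow> x < c + e \<Longrightarrow> (K has_real_derivative K1 x) (at x)"
    "\<And>x. c - e < x \<Longrightarrow> x < c + e \<Longrightarrow> (K1 has_real_derivative K2 x) (at x)"
    and h: "C2_line h" "\<And>x. c \<le> x \<Longrightarrow> x < c + e \<Longrightarrow> K x = h x"
    and k: "C2_line k" "\<And>x. c - e < x \<Longrightarrow> x \<le> c \<Longrightarrow> K x = k x"
  shows "deriv h c = deriv k c" "deriv (deriv h) c = deriv (deriv k) c"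
proof -
  have h1: "K1 x = deriv h x" if "c \<le> x" "x < c + e" for x
    by (rule right_derivatives_equal[OF d(1) C2_lineD(1)[OF h(1)], of x "c + e - x"]) (use that e h(2) in auto)
  have k1: "K1 x = deriv k x" if "c - e < x" "x \<le> c" for x
    by (rule left_derivatives_equal[OF d(1) C2_lineD(1)[OF k(1)], of x "x - (c - e)"]) (use that e k(2) in auto)
  show "deriv h c = deriv k c" using h1[of c] k1[of c] e by simp
  have "K2 c = deriv (deriv h) c"
    by (rule right_derivatives_equal[OF d(2) C2_lineD(2)[OF h(1)], of c e]) (use e h1 in auto)
  moreover have "K2 c = deriv (deriv k) c"
    by (rule left_derivatives_equal[OF d(2) C2_lineD(2)[OF k(1)], of c e]) (use e k1 in auto)
  ultimately show "deriv (deriv h) c = deriv (deriv k) c" by simp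
qed

lemma C2_line_along_curve:
  assumes v: "C2_on UNIV v vt vx vtt vtx vxt vxx" and G: "C2_line G"
  shows "C2_line (\<lambda>t. v (t, G t))" "deriv (\<lambda>t. v (t, G t)) = (\<lambda>t. vt (t, G t) + vx (t, G t) * deriv G t)"
    "deriv (deriv (\<lambda>t. v (t, G t))) = (\<lambda>t. vtt (t, G t) + vtx (t, G t) * deriv G t +
       ((vxt (t, G t) + vxx (t, G t) * deriv G t) * deriv G t + deriv (deriv G) t * vx (t, G t)))"
proof -
  have chain: "((\<lambda>t. w (t, G t)) has_real_derivative wt (t, G t) + wx (t, G t) * deriv G t) (at t)"
    if "C1_on UNIV w wt wx" for w wt wx t
    using C1_on_chain[OF that _ DERIV_ident C2_lineD(1)[OF G]] by simp
  have cont: "continuous_on UNIV (\<lambda>t. w (t, G t))" if "continuous_on UNIV w" for w :: "real \<times> real \<Rightarrow> real"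
    by (rule continuous_on_compose2[OF that]) (auto intro!: continuous_intros C2_lineD(5)[OF G])
  have 1: "((\<lambda>t. v (t, G t)) has_real_derivative vt (t, G t) + vx (t, G t) * deriv G t) (at t)" for t
    by (rule chain[OF C2_on_D(1)[OF v]])
  have 2: "((\<lambda>t. vt (t, G t) + vx (t, G t) * deriv G t) has_real_derivative
      vtt (t, G t) + vtx (t, G t) * deriv G t +
       ((vxt (t, G t) + vxx (t, G t) * deriv G t) * deriv G t + deriv (deriv G) t * vx (t, G t))) (at t)" for t
    by (intro DERIV_add DERIV_mult chain[OF C2_on_D(2)[OF v]] chain[OF C2_on_D(3)[OF v]] C2_lineD(2)[OF G])
  have 3: "continuous_on UNIV (\<lambda>t. vtt (t, G t) + vtx (t, G t) * deriv G t +
       ((vxt (t, G t) + vxx (t, G t) * deriv G t) * deriv G t + deriv (deriv G) t * vx (t, G t)))"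
    using C1_on_D(2,3)[OF C2_on_D(2)[OF v]] C1_on_D(2,3)[OF C2_on_D(3)[OF v]]
      C1_on_D(3)[OF C2_on_D(1)[OF v]]
    by (intro continuous_intros cont C2_lineD(3,4)[OF G]) simp_all
  note I = C2_lineI[OF 1 2 3]
  show "C2_line (\<lambda>t. v (t, G t))" "deriv (\<lambda>t. v (t, G t)) = (\<lambda>t. vt (t, G t) + vx (t, G t) * deriv G t)"
    "deriv (deriv (\<lambda>t. v (t, G t))) = (\<lambda>t. vtt (t, G t) + vtx (t, G t) * deriv G t +
       ((vxt (t, G t) + vxx (t, G t) * deriv G t) * deriv G t + deriv (deriv G) t * vx (t, G t)))"
    by (fact I)+
qed

text \<open>The successive reflections. \<open>N\<close> is the trace to be attained at the wall, \<open>M\<close> the source in the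
boundary condition at \<open>x = l\<close>; both recurrences are solved on the whole line, although only the range
of one row or column will be used, which keeps every piece globally of class C2.\<close>

lemma (in moving_wall) wave_sequence:
  assumes N: "C2_line N" and M: "continuous_on UNIV M" and p0: "C2_line p0" and g0: "C2_line g0"
  obtains p g where "p 0 = p0" "g 0 = g0" "\<And>i. C2_line (p i)" "\<And>i. C2_line (g i)"
    "\<And>i t. p (Suc i) (gm t) = N t - g i (gp t)"
    "\<And>j t. a\<^sup>2 * (deriv (deriv (p j)) (l - a * t) + deriv (deriv (g (Suc j))) (l + a * t)) +
       b * (deriv (p j) (l - a * t) + deriv (g (Suc j)) (l + a * t)) = M t"
    "\<And>j. g (Suc j) (l + a * L j) = g j (l + a * L j)"
    "\<And>j. deriv (g (Suc j)) (l + a * L j) = deriv (g j) (l + a * L j) + J j"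
proof -
  obtain \<Phi> where \<Phi>: "C2_line \<Phi>" "\<And>t. \<Phi> (gm t) = t"
  proof (rule C2_line_inverse[OF gm_C2(1)])
    show "deriv gm x < 0" for x using G_slope[of x] unfolding gm_C2(2) by simp
    show "surj gm" using G_surj by (simp add: gm_def[abs_def])
  qed blast
  define inv where "inv n w \<longleftrightarrow> C2_line (fst w) \<and> C2_line (snd w) \<and> (n = 0 \<longrightarrow> w = (p0, g0))"
    for n :: nat and w
  define step where "step n w w' \<longleftrightarrow> (\<forall>t. fst w' (gm t) = N t - snd w (gp t)) \<and>
    (\<forall>t. a\<^sup>2 * (deriv (deriv (fst w)) (l - a * t) + deriv (deriv (snd w')) (l + a * t)) +
       b * (deriv (fst w) (l - a * t) + deriv (snd w') (l + a * t)) = M t) \<and>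
    snd w' (l + a * L n) = snd w (l + a * L n) \<and>
    deriv (snd w') (l + a * L n) = deriv (snd w) (l + a * L n) + J n" for n w w'
  have "\<exists>F. \<forall>n. inv n (F n) \<and> step n (F n) (F (Suc n))"
  proof (rule dependent_nat_choice)
    show "\<exists>w. inv 0 w" using p0 g0 by (auto simp: inv_def)
  next
    fix w and n :: nat assume "inv n w"
    then have w: "C2_line (fst w)" "C2_line (snd w)" by (auto simp: inv_def)
    define P' where "P' \<xi> = N (\<Phi> \<xi>) - snd w (gp (\<Phi> \<xi>))" for \<xi>
    have P': "C2_line P'" unfolding P'_def
      by (rule C2_line_diff(1)[OF C2_line_comp(1)[OF N \<Phi>(1)]
            C2_line_comp(1)[OF w(2) C2_line_comp(1)[OF gp_C2(1) \<Phi>(1)]]])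
    define q where "q \<eta> = M ((\<eta> - l) / a) / a\<^sup>2 - deriv (deriv (fst w)) (2 * l - \<eta>) -
        b / a\<^sup>2 * deriv (fst w) (2 * l - \<eta>)" for \<eta>
    have q: "continuous_on UNIV q" unfolding q_def
      using a_pos by (intro continuous_intros C2_line_continuous_comp[OF w(1)]
            continuous_on_compose2[OF M]) auto
    obtain g' where g': "C2_line g'" "g' (l + a * L n) = snd w (l + a * L n)"
      "deriv g' (l + a * L n) = deriv (snd w) (l + a * L n) + J n"
      "\<And>x. deriv (deriv g') x + b / a\<^sup>2 * deriv g' x = q x"
      using damped_equation_solvable[OF q] by blast
    have ode: "a\<^sup>2 * (deriv (deriv (fst w)) (l - a * t) + deriv (deriv g') (l + a * t)) +
       b * (deriv (fst w) (l - a * t) + deriv g' (l + a * t)) = M t" for t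
    proof -
      have "2 * l - (l + a * t) = l - a * t" by simp
      then have "deriv (deriv g') (l + a * t) + b / a\<^sup>2 * deriv g' (l + a * t) =
         M t / a\<^sup>2 - deriv (deriv (fst w)) (l - a * t) - b / a\<^sup>2 * deriv (fst w) (l - a * t)"
        using g'(4)[of "l + a * t"] a_pos by (simp add: q_def)
      then have "a\<^sup>2 * (deriv (deriv g') (l + a * t) + b / a\<^sup>2 * deriv g' (l + a * t)) =
         a\<^sup>2 * (M t / a\<^sup>2 - deriv (deriv (fst w)) (l - a * t) - b / a\<^sup>2 * deriv (fst w) (l - a * t))"
        by simp
      then show ?thesis using a_pos by (simp add: ring_distribs)
    qed
    show "\<exists>w'. inv (Suc n) w' \<and> step n w w'"
      by (rule exI[of _ "(P', g')"]) (use P' g' ode \<Phi>(2) in \<open>auto simp: inv_def step_def P'_def\<close>)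
  qed
  then obtain F where F: "\<And>n. inv n (F n)" "\<And>n. step n (F n) (F (Suc n))" by blast
  show thesis
    by (rule that[of "\<lambda>n. fst (F n)" "\<lambda>n. snd (F n)"])
       (use F(1)[of 0] F in \<open>auto simp: inv_def step_def\<close>)
qed

section \<open>The piecewise solution and its regularity\<close>

text \<open>\<open>v\<close> is a solution of the inhomogeneous equation with vanishing Cauchy data, and the pieces \<open>p\<close> and \<open>g\<close>
arise from the reflections with the traces that \<open>v\<close> leaves over. The hypotheses \<open>\<phi>_eq\<close> and \<open>\<psi>_eq\<close> are
d'Alembert's formula, and \<open>compat\<close> makes the first two pieces of \<open>p\<close> fit together continuously.\<close>

locale wave_pieces = moving_wall +
  fixes b :: real and F v vt vx vtt vtx vxx :: "real \<times> real \<Rightarrow> real"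
    and \<phi> \<psi> \<mu>1 \<mu>2 :: "real \<Rightarrow> real" and J :: "nat \<Rightarrow> real" and p g :: "nat \<Rightarrow> real \<Rightarrow> real"
  assumes v_C2: "C2_on UNIV v vt vx vtt vtx vtx vxx"
    and v_eq: "\<And>q. vtt q - a\<^sup>2 * vxx q = F q"
    and v_0: "\<And>x. v (0, x) = 0" "\<And>x. vt (0, x) = 0" "\<And>x. vx (0, x) = 0" "\<And>x. vtx (0, x) = 0"
      "\<And>x. vxx (0, x) = 0"
    and \<mu>1_C2: "C2_line \<mu>1"
    and p_C2: "\<And>i. C2_line (p i)" and g_C2: "\<And>i. C2_line (g i)"
    and \<phi>_eq: "\<And>x. \<phi> x = p 0 x + g 0 x"
    and \<psi>_eq: "\<And>x. \<psi> x = a * (deriv (g 0) x - deriv (p 0) x)"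
    and p_Suc: "\<And>i t. p (Suc i) (gm t) = (\<mu>1 t - v (t, G t)) - g i (gp t)"
    and g_Suc: "\<And>j t. a\<^sup>2 * (deriv (deriv (p j)) (l - a * t) + deriv (deriv (g (Suc j))) (l + a * t)) +
       b * (deriv (p j) (l - a * t) + deriv (g (Suc j)) (l + a * t)) = \<mu>2 t - vtt (t, l) - b * vx (t, l)"
    and g_match: "\<And>j. g (Suc j) (l + a * L j) = g j (l + a * L j)"
    and g_jump: "\<And>j. deriv (g (Suc j)) (l + a * L j) = deriv (g j) (l + a * L j) + J j"
    and compat: "\<mu>1 0 = \<phi> 0"
begin

text \<open>The nodes of \<open>\<xi>\<close> decrease, so \<open>PP\<close> is glued after the reflection \<open>\<xi> \<mapsto> - \<xi>\<close>.\<close>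

definition PP :: "real \<Rightarrow> real" where "PP \<xi> = pick (\<lambda>i. - gm (r i)) (\<lambda>i y. p i (- y)) (- \<xi>)"
definition GG :: "real \<Rightarrow> real" where "GG = pick (\<lambda>j. l + a * L j) g"
definition U :: "real \<times> real \<Rightarrow> real" where "U = (\<lambda>(t, x). v (t, x) + (PP (x - a * t) + GG (x + a * t)))"

text \<open>The value of \<open>p (Suc i)\<close> at its upper node is given by \<open>g i\<close> and that of \<open>p i\<close> by the preceding piece
of \<open>g\<close>, at the same node of \<open>\<eta>\<close>; so continuity of \<open>p\<close> follows from that of \<open>g\<close>. At the first
node, where \<open>p 0\<close> comes from the initial data, it is the hypothesis \<open>compat\<close>.\<close>

lemma p_match: "p (Suc i) (gm (r i)) = p i (gm (r i))"
proof (cases i)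
  case 0
  have "p 1 (gm 0) = \<mu>1 0 - g 0 0" using p_Suc[of 0 0] v_0 by simp
  then show ?thesis using 0 compat \<phi>_eq[of 0] by simp
next
  case (Suc k)
  have "p (Suc i) (gm (r i)) - p i (gm (r i)) = g k (gp (r (Suc k))) - g (Suc k) (gp (r (Suc k)))"
    unfolding Suc p_Suc by simp
  then show ?thesis using g_match[of k] by (simp add: gp_r_Suc)
qed

lemma nodes: "strict_mono (\<lambda>i. - gm (r i))" "\<exists>i. x \<le> - gm (r i)"
    "strict_mono (\<lambda>j. l + a * L j)" "\<exists>j. x \<le> l + a * L j"
proof -
  show "strict_mono (\<lambda>i. - gm (r i))" by (simp add: strict_mono_def)
  show "strict_mono (\<lambda>j. l + a * L j)" using a_pos by (simp add: strict_mono_def)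
  obtain i where "gm (r i) \<le> min (- x) l" using row_exists[of "min (- x) l"] by auto
  then show "\<exists>i. x \<le> - gm (r i)" by (intro exI[of _ i]) simp
  obtain j where "max x 0 \<le> l + a * L j" using column_exists[of "max x 0"] by auto
  then show "\<exists>j. x \<le> l + a * L j" by (intro exI[of _ j]) simp
qed

lemma PP_eq:
  assumes "gm (r i) \<le> \<xi>" "i = 0 \<or> \<xi> \<le> l - a * L i"
  shows "PP \<xi> = p i \<xi>"
proof -
  have "pick (\<lambda>i. - gm (r i)) (\<lambda>i y. p i (- y)) (- \<xi>) = (\<lambda>i y. p i (- y)) i (- \<xi>)"
    by (rule pick_eq[OF nodes(1)]) (use assms p_match in \<open>auto simp: gm_r[symmetric]\<close>)
  then show ?thesis by (simp add: PP_def)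
qed

lemma GG_eq:
  assumes "j = 0 \<or> gp (r j) \<le> \<eta>" "\<eta> \<le> l + a * L j"
  shows "GG \<eta> = g j \<eta>"
  unfolding GG_def by (rule pick_eq[OF nodes(3)]) (use assms g_match in \<open>auto simp: gp_r_Suc\<close>)

lemma continuous_PP: "continuous_on UNIV PP" and continuous_GG: "continuous_on UNIV GG"
proof -
  have "continuous_on UNIV (pick (\<lambda>i. - gm (r i)) (\<lambda>i y. p i (- y)))"
    by (rule continuous_on_pick[OF nodes(1,2)])
       (use p_match in \<open>auto intro!: C2_line_continuous_comp[OF p_C2] continuous_intros\<close>)
  then show "continuous_on UNIV PP"
    unfolding PP_def by (rule continuous_on_compose2) (auto intro!: continuous_intros)
  show "continuous_on UNIV GG"
    unfolding GG_def by (rule continuous_on_pick[OF nodes(3,4) C2_lineD(5)[OF g_C2] g_match])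
qed

lemma C2_on_superposition:
  assumes "C2_line P'" "C2_line G'"
  shows "C2_on UNIV (\<lambda>(t, x). v (t, x) + (P' (x - a * t) + G' (x + a * t)))
    (\<lambda>(t, x). vt (t, x) + a * (deriv G' (x + a * t) - deriv P' (x - a * t)))
    (\<lambda>(t, x). vx (t, x) + (deriv P' (x - a * t) + deriv G' (x + a * t)))
    (\<lambda>(t, x). vtt (t, x) + a\<^sup>2 * (deriv (deriv P') (x - a * t) + deriv (deriv G') (x + a * t)))
    (\<lambda>(t, x). vtx (t, x) + a * (deriv (deriv G') (x + a * t) - deriv (deriv P') (x - a * t)))
    (\<lambda>(t, x). vtx (t, x) + a * (deriv (deriv G') (x + a * t) - deriv (deriv P') (x - a * t)))
    (\<lambda>(t, x). vxx (t, x) + (deriv (deriv P') (x - a * t) + deriv (deriv G') (x + a * t)))"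
  using C2_on_add[OF v_C2 C2_on_add[OF C2_on_travelling_wave[OF assms(1), of "- a"]
        C2_on_travelling_wave[OF assms(2), of a]]]
  by (simp add: split_beta' algebra_simps)

definition W where "W i j = (\<lambda>(t, x). v (t, x) + (p i (x - a * t) + g j (x + a * t)))"
definition Wt where "Wt i j = (\<lambda>(t, x). vt (t, x) + a * (deriv (g j) (x + a * t) - deriv (p i) (x - a * t)))"

lemmas W_C2 = C2_on_superposition[OF p_C2 g_C2, folded W_def Wt_def]

lemma U_eq_W:
  assumes "gm (r i) \<le> x - a * t" "i = 0 \<or> x - a * t \<le> l - a * L i"
    "j = 0 \<or> gp (r j) \<le> x + a * t" "x + a * t \<le> l + a * L j"
  shows "U (t, x) = W i j (t, x)"
  using PP_eq[of i "x - a * t"] GG_eq[of j "x + a * t"] assms by (simp add: U_def W_def)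

lemma U_cell:
  assumes ij: "adj i j"
  shows "Ck_closure 2 (P i j) U"
    and "(t, x) \<in> closure (P i j) \<Longrightarrow> D_t (P i j) U (t, x) = Wt i j (t, x)"
    and "(t, x) \<in> closure (P i j) \<Longrightarrow>
      D_x (P i j) U (t, x) = vx (t, x) + (deriv (p i) (x - a * t) + deriv (g j) (x + a * t))"
    and "(t, x) \<in> closure (P i j) \<Longrightarrow> D_t (P i j) (D_t (P i j) U) (t, x) =
      vtt (t, x) + a\<^sup>2 * (deriv (deriv (p i)) (x - a * t) + deriv (deriv (g j)) (x + a * t))"
    and "(t, x) \<in> closure (P i j) \<Longrightarrow> D_x (P i j) (D_x (P i j) U) (t, x) =
      vxx (t, x) + (deriv (deriv (p i)) (x - a * t) + deriv (deriv (g j)) (x + a * t))"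
proof -
  have eq: "U q = W i j q" if "q \<in> closure (P i j)" for q
    using closure_P_D[OF ij, of "fst q" "snd q"] U_eq_W[of i "snd q" "fst q" j] that by simp
  note C = C2_on_imp_Ck_closure[OF P_regular[OF ij] C2_on_subset[OF W_C2 subset_UNIV] eq]
  show "Ck_closure 2 (P i j) U" by (rule C(1))
  show "(t, x) \<in> closure (P i j) \<Longrightarrow> D_t (P i j) U (t, x) = Wt i j (t, x)"
    by (rule C(2))
  show "(t, x) \<in> closure (P i j) \<Longrightarrow>
      D_x (P i j) U (t, x) = vx (t, x) + (deriv (p i) (x - a * t) + deriv (g j) (x + a * t))"
    using C(3) by simp
  show "(t, x) \<in> closure (P i j) \<Longrightarrow> D_t (P i j) (D_t (P i j) U) (t, x) =
      vtt (t, x) + a\<^sup>2 * (deriv (deriv (p i)) (x - a * t) + deriv (deriv (g j)) (x + a * t))"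
    using C(4) by simp
  show "(t, x) \<in> closure (P i j) \<Longrightarrow> D_x (P i j) (D_x (P i j) U) (t, x) =
      vxx (t, x) + (deriv (deriv (p i)) (x - a * t) + deriv (deriv (g j)) (x + a * t))"
    using C(5) by simp
qed

lemma U_wave:
  assumes "adj i j" "q \<in> closure (P i j)"
  shows "D_t (P i j) (D_t (P i j) U) q - a\<^sup>2 * D_x (P i j) (D_x (P i j) U) q = F q"
  using U_cell(4,5)[OF assms(1), of "fst q" "snd q"] assms(2) v_eq[of q]
  by (simp add: algebra_simps)

lemma U_initial:
  assumes x: "x \<in> {0..l}"
  shows "U (0, x) = \<phi> x" "D_t (P 0 0) U (0, x) = \<psi> x"
  using U_cell(2)[of 0 0, OF _ initial_in_closure_P[OF x]] U_eq_W[of 0 x 0 0] x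
  by (simp_all add: adj_def W_def Wt_def v_0 \<phi>_eq \<psi>_eq)

lemma U_wall:
  assumes t: "t \<ge> 0"
  shows "U (t, \<gamma> t) = \<mu>1 t"
proof -
  define k where "k = (LEAST k. t \<le> r (Suc k))"
  have ex: "\<exists>k. t \<le> r (Suc k)"
    using r_unbounded[of t] by (meson less_imp_le order_trans r_le_iff le_Suc_eq order_refl)
  have k: "t \<le> r (Suc k)" unfolding k_def by (rule LeastI_ex[OF ex])
  have k': "r k \<le> t"
  proof (cases k)
    case (Suc m)
    then show ?thesis using not_less_Least[of m "\<lambda>k. t \<le> r (Suc k)", folded k_def] by simp
  qed (use t in simp)
  have gm: "gm (r (Suc k)) \<le> gm t" "gm t \<le> l - a * L (Suc k)" using k k' by (simp_all flip: gm_r)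
  have gp: "gp (r k) \<le> gp t" "gp t \<le> l + a * L k" using k k' by (simp_all flip: gp_r_Suc)
  have "U (t, G t) = W (Suc k) k (t, G t)"
    using gm gp by (intro U_eq_W) (simp_all add: gm_def gp_def)
  also have "\<dots> = v (t, G t) + (p (Suc k) (gm t) + g k (gp t))" by (simp add: W_def gm_def gp_def)
  also have "\<dots> = \<mu>1 t" unfolding p_Suc by simp
  finally show ?thesis using G_eq[OF t] by simp
qed

lemma U_right:
  assumes t: "t \<in> {L j..L (Suc j)}"
  shows "D_t (P j (Suc j)) (D_t (P j (Suc j)) U) (t, l) + b * D_x (P j (Suc j)) U (t, l) = \<mu>2 t"
  using U_cell(3,4)[of j "Suc j", OF _ right_in_closure_P[OF t]] g_Suc[of j t]
  by (simp add: adj_def algebra_simps)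

lemma U_piecewise_solution: "piecewise_solution b F \<phi> \<psi> \<mu>1 \<mu>2 (\<lambda>i. a * J i) U"
  unfolding piecewise_solution_def
proof (intro conjI allI impI ballI)
  fix i j assume ij: "adj i j"
  show "Ck_closure 2 (P i j) U" by (rule U_cell(1)[OF ij])
  show "D_t (P i j) (D_t (P i j) U) q - a\<^sup>2 * D_x (P i j) (D_x (P i j) U) q = F q"
    if "q \<in> open_cell i j" for q
    using that open_cell_subset_interior[OF ij] interior_subset[of "P i j"] closure_subset[of "P i j"]
    by (intro U_wave[OF ij]) blast
next
  fix i \<xi> assume \<xi>: "gm (r i) < \<xi> \<and> \<xi> < l - a * L i"
  let ?q = "ch \<xi> (l + a * L i)"
  have q: "?q \<in> closure (P i i)" "?q \<in> closure (P i (Suc i))"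
    using edge_point[of i \<xi>] \<xi> closure_subset[of "P i i"] closure_subset[of "P i (Suc i)"] by auto
  have "D_t (P i (Suc i)) U ?q = Wt i (Suc i) ?q" "D_t (P i i) U ?q = Wt i i ?q"
    using U_cell(2)[of i i "fst ?q" "snd ?q"] U_cell(2)[of i "Suc i" "fst ?q" "snd ?q"] q
    by (simp_all add: adj_def)
  then have "D_t (P i (Suc i)) U ?q - D_t (P i i) U ?q =
      a * (deriv (g (Suc i)) (snd ?q + a * fst ?q) - deriv (g i) (snd ?q + a * fst ?q))"
    by (simp add: Wt_def split_beta algebra_simps)
  then show "D_t (P i (Suc i)) U ?q - D_t (P i i) U ?q = a * J i"
    using char_pt_coords(2)[of a \<xi> "l + a * L i"] a_pos g_jump by simp
qed (use U_initial U_wall U_right in auto)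

lemma continuous_U: "continuous_on UNIV U"
  unfolding U_def split_beta
  by (intro continuous_intros continuous_on_compose2[OF continuous_PP]
      continuous_on_compose2[OF continuous_GG] continuous_on_compose2[OF C1_on_D(1)[OF C2_on_D(1)[OF v_C2]]])
     auto

lemma U_no_jump: "has_jump U t c 0"
proof -
  have "isCont (\<lambda>x. U (t, x)) c"
    using continuous_on_compose2[OF continuous_U, of UNIV "\<lambda>x. (t, x)"]
    by (auto simp: continuous_on_eq_continuous_at intro!: continuous_intros)
  then have "((\<lambda>x. U (t, x)) \<longlongrightarrow> U (t, c)) (at_left c)" "((\<lambda>x. U (t, x)) \<longlongrightarrow> U (t, c)) (at_right c)"
    by (auto simp: isCont_def filterlim_at_split)
  then show ?thesis unfolding has_jump_def by (intro exI conjI) auto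
qed

lemma pd_t_U:
  assumes "gm (r k) < x - a * t" "k = 0 \<or> x - a * t < l - a * L k"
    "j = 0 \<or> gp (r j) < x + a * t" "x + a * t < l + a * L j"
  shows "pd_t U (t, x) = Wt k j (t, x)"
proof -
  define S where "S = {s. gm (r k) < x - a * s} \<inter> {s. k = 0 \<or> x - a * s < l - a * L k} \<inter>
    {s. j = 0 \<or> gp (r j) < x + a * s} \<inter> {s. x + a * s < l + a * L j}"
  have op: "open {s. P' \<or> f s < g' s}" if "continuous_on UNIV f" "continuous_on UNIV g'"
    for P' and f g' :: "real \<Rightarrow> real"
    using that by (cases P') (auto intro: open_Collect_less)
  then have "open S" unfolding S_def by (intro open_Int op open_Collect_less continuous_intros)
  moreover have "t \<in> S" using assms by (simp add: S_def)
  moreover have "W k j (s, x) = U (s, x)" if "s \<in> S" for s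
    using that by (intro U_eq_W[symmetric]) (auto simp: S_def)
  ultimately have "((\<lambda>s. U (s, x)) has_real_derivative Wt k j (t, x)) (at t)"
    by (intro has_field_derivative_transform_within_open[OF C1_on_D(4)[OF C2_on_D(1)[OF W_C2]]]) auto
  then show ?thesis by (simp add: pd_t_def DERIV_imp_deriv)
qed

text \<open>On the two sides of the characteristic \<open>\<eta> = l + a L i\<close> the same piece of \<open>p\<close> is used, since the point
does not lie on a node of \<open>\<xi>\<close>; the jump is \<open>a\<close> times that of the derivative of \<open>g\<close>.\<close>

lemma U_jump:
  assumes Q: "(t, l + a * L i - a * t) \<in> Q"
    and off: "\<And>k. (l + a * L i - a * t) - a * t \<noteq> gm (r k)"
  shows "has_jump (pd_t U) t (l + a * L i - a * t) (a * J i)"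
proof -
  define c where "c = l + a * L i - a * t"
  have t: "t > 0" "c < l" using Q by (auto simp: Qdom_def c_def)
  then have "c - a * t \<le> l" using a_pos mult_pos_pos[of a t] by linarith
  then obtain k where k: "gm (r k) \<le> c - a * t" "k = 0 \<or> c - a * t < l - a * L k"
    using row_exists by blast
  have k1: "gm (r k) < c - a * t" using k(1) off[of k] unfolding c_def[symmetric] by linarith
  have cont: "((\<lambda>x. Wt k j (t, x)) \<longlongrightarrow> Wt k j (t, c)) (at c within S)" for j S
  proof -
    have "continuous_on UNIV (\<lambda>x. Wt k j (t, x))"
      by (rule continuous_on_compose2[OF C1_on_D(2)[OF C2_on_D(1)[OF W_C2]]])
         (auto intro!: continuous_intros)
    then show ?thesis by (auto simp: continuous_on_def intro: tendsto_within_subset)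
  qed
  define d where "d = (if k = 0 then 1 else l - a * L k - (c - a * t))"
  have d: "d > 0" using k(2) by (auto simp: d_def)
  have node: "c + a * t = l + a * L i" by (simp add: c_def)
  have up: "0 < a * L (Suc i) - a * L i" using a_pos by simp
  have dn: "0 < l + a * L i - gp (r i)" using gp_r_less[of i] by simp
  have "((\<lambda>x. pd_t U (t, x)) \<longlongrightarrow> Wt k (Suc i) (t, c)) (at_right c)"
  proof (rule Lim_transform_eventually[OF cont])
    have "\<forall>\<^sub>F x in at_right c. x \<in> {c<..<c + min d (a * L (Suc i) - a * L i)}"
      using d up by (intro eventually_at_right_real) simp
    then show "\<forall>\<^sub>F x in at_right c. Wt k (Suc i) (t, x) = pd_t U (t, x)"
    proof eventually_elim
      case (elim x)
      then show ?case
        using k1 node by (intro pd_t_U[symmetric]; cases "k = 0"; auto simp: d_def gp_r_Suc)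
    qed
  qed
  moreover have "((\<lambda>x. pd_t U (t, x)) \<longlongrightarrow> Wt k i (t, c)) (at_left c)"
  proof (rule Lim_transform_eventually[OF cont])
    have "\<forall>\<^sub>F x in at_left c. x \<in> {c - min (c - a * t - gm (r k)) (l + a * L i - gp (r i))<..<c}"
      using k1 dn by (intro eventually_at_left_real) simp
    then show "\<forall>\<^sub>F x in at_left c. Wt k i (t, x) = pd_t U (t, x)"
    proof eventually_elim
      case (elim x)
      then show ?case
        using k(2) node by (intro pd_t_U[symmetric]) auto
    qed
  qed
  moreover have "Wt k (Suc i) (t, c) - Wt k i (t, c) = a * J i"
    by (simp add: Wt_def node g_jump algebra_simps)
  ultimately show ?thesis unfolding has_jump_def c_def by blast
qed

lemma U_singular_part:
  assumes zero: "\<And>q. F q = 0" "\<And>x. \<phi> x = 0" "\<And>x. \<psi> x = 0" "\<And>t. \<mu>1 t = 0" "\<And>t. \<mu>2 t = 0"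
    and J: "\<And>i. J i = (if even i then C i else 0) / a"
  shows "singular_part a l b \<gamma> C U"
proof -
  have gmr: "gamma_minus a \<gamma> (r i) = gm (r i)" for i by (simp add: gamma_minus_def gm_def G_eq)
  have aJ: "a * J i = (if even i then C i else 0)" for i using a_pos by (simp add: J)
  show ?thesis
    unfolding singular_part_def Let_def gmr
  proof (intro conjI allI impI ballI)
    fix i j :: nat assume "i \<le> j + 1 \<and> j \<le> i + 1"
    then have ij: "adj i j" by (simp add: adj_def)
    show "Ck_closure 2 (P i j) U" by (rule U_cell(1)[OF ij])
    show "D_t (P i j) (D_t (P i j) U) q - a\<^sup>2 * D_x (P i j) (D_x (P i j) U) q = 0"
      if "q \<in> closure (P i j)" for q
      using U_wave[OF ij that] zero by simp
  next
    fix i t assume "(t, l + a * L i - a * t) \<in> Q \<and> (\<forall>k. l + a * L i - a * t - a * t \<noteq> gm (r k))"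
    then show "has_jump (pd_t U) t (l + a * L i - a * t) (if even i then C i else 0)"
      using U_jump[of t i] unfolding aJ by blast
  qed (use U_initial U_wall U_right U_no_jump zero in auto)
qed

lemma N_C2: "C2_line (\<lambda>t. \<mu>1 t - v (t, G t))"
  and N_deriv_0: "deriv (\<lambda>t. \<mu>1 t - v (t, G t)) 0 = deriv \<mu>1 0"
  and N_deriv2_0: "deriv (deriv (\<lambda>t. \<mu>1 t - v (t, G t))) 0 = deriv (deriv \<mu>1) 0 - F (0, 0)"
proof -
  note c = C2_line_along_curve[OF v_C2 G_C2]
  note N = C2_line_diff[OF \<mu>1_C2 c(1)]
  show "C2_line (\<lambda>t. \<mu>1 t - v (t, G t))" by (rule N(1))
  show "deriv (\<lambda>t. \<mu>1 t - v (t, G t)) 0 = deriv \<mu>1 0"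
    unfolding N(2) c(2) by (simp add: v_0)
  show "deriv (deriv (\<lambda>t. \<mu>1 t - v (t, G t))) 0 = deriv (deriv \<mu>1) 0 - F (0, 0)"
    unfolding N(3) c(3) using v_eq[of "(0, G 0)"] by (simp add: v_0 G_0)
qed

definition agree2 :: "(real \<Rightarrow> real) \<Rightarrow> (real \<Rightarrow> real) \<Rightarrow> real \<Rightarrow> bool" where
  "agree2 h k c \<longleftrightarrow> h c = k c \<and> deriv h c = deriv k c \<and> deriv (deriv h) c = deriv (deriv k) c"

text \<open>The wall condition differentiated once and twice in time.\<close>

lemma p_wall:
  shows "deriv (p (Suc i)) (gm t) * (deriv G t - a) =
      deriv (\<lambda>t. \<mu>1 t - v (t, G t)) t - deriv (g i) (gp t) * (deriv G t + a)"
    and "deriv (deriv (p (Suc i))) (gm t) * (deriv G t - a)\<^sup>2 + deriv (p (Suc i)) (gm t) * deriv (deriv G) t =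
      deriv (deriv (\<lambda>t. \<mu>1 t - v (t, G t))) t -
      (deriv (deriv (g i)) (gp t) * (deriv G t + a)\<^sup>2 + deriv (g i) (gp t) * deriv (deriv G) t)"
proof -
  have eq: "(\<lambda>t. p (Suc i) (gm t)) = (\<lambda>t. (\<mu>1 t - v (t, G t)) - g i (gp t))" using p_Suc by auto
  note P' = C2_line_comp[OF p_C2[of "Suc i"] gm_C2(1)]
  note G' = C2_line_comp[OF g_C2[of i] gp_C2(1)]
  note D = C2_line_diff[OF N_C2 G'(1)]
  have "(\<lambda>x. deriv (p (Suc i)) (gm x) * deriv gm x) =
     (\<lambda>x. deriv (\<lambda>t. \<mu>1 t - v (t, G t)) x - deriv (g i) (gp x) * deriv gp x)"
    using P'(2) D(2) G'(2) unfolding eq by simp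
  from fun_cong[OF this, of t] show "deriv (p (Suc i)) (gm t) * (deriv G t - a) =
      deriv (\<lambda>t. \<mu>1 t - v (t, G t)) t - deriv (g i) (gp t) * (deriv G t + a)"
    by (simp add: gm_C2(2) gp_C2(2))
  have "(\<lambda>x. deriv (deriv (p (Suc i))) (gm x) * (deriv gm x)\<^sup>2 + deriv (p (Suc i)) (gm x) * deriv (deriv gm) x) =
     (\<lambda>x. deriv (deriv (\<lambda>t. \<mu>1 t - v (t, G t))) x -
       (deriv (deriv (g i)) (gp x) * (deriv gp x)\<^sup>2 + deriv (g i) (gp x) * deriv (deriv gp) x))"
    using P'(3) D(3) G'(3) unfolding eq by simp
  from fun_cong[OF this, of t]
  show "deriv (deriv (p (Suc i))) (gm t) * (deriv G t - a)\<^sup>2 + deriv (p (Suc i)) (gm t) * deriv (deriv G) t =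
      deriv (deriv (\<lambda>t. \<mu>1 t - v (t, G t))) t -
      (deriv (deriv (g i)) (gp t) * (deriv G t + a)\<^sup>2 + deriv (g i) (gp t) * deriv (deriv G) t)"
    unfolding gm_C2(3) gp_C2(3) unfolding gm_C2(2) gp_C2(2) .
qed

lemma slope_minus_ne: "deriv G t - a \<noteq> 0"
  using G_slope[of t] by auto

text \<open>At time 0 compare the wall relation for \<open>p 1\<close> with the expression obtained by inserting \<open>p 0\<close>; the
coefficient of the derivative of \<open>p\<close> is a power of \<open>G' - a\<close>, which is not zero.\<close>

lemma agree_wall_iff:
  "deriv (p 1) 0 = deriv (p 0) 0 \<and> deriv (deriv (p 1)) 0 = deriv (deriv (p 0)) 0 \<longleftrightarrow>
   deriv \<mu>1 0 = deriv (p 0) 0 * (deriv G 0 - a) + deriv (g 0) 0 * (deriv G 0 + a) \<and>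
   deriv (deriv \<mu>1) 0 - F (0, 0) =
     deriv (deriv (p 0)) 0 * (deriv G 0 - a)\<^sup>2 + deriv (deriv (g 0)) 0 * (deriv G 0 + a)\<^sup>2 +
     (deriv (p 0) 0 + deriv (g 0) 0) * deriv (deriv G) 0"
proof -
  note w = p_wall[of 0 0, unfolded N_deriv_0 N_deriv2_0 gm_0 gp_0 One_nat_def[symmetric]]
  have 1: "deriv (p 1) 0 = deriv (p 0) 0 \<longleftrightarrow>
      deriv \<mu>1 0 = deriv (p 0) 0 * (deriv G 0 - a) + deriv (g 0) 0 * (deriv G 0 + a)"
    using w(1) slope_minus_ne[of 0] mult_right_cancel[of "deriv G 0 - a" "deriv (p 1) 0" "deriv (p 0) 0"]
    by linarith
  have 2: "deriv (deriv (p 1)) 0 = deriv (deriv (p 0)) 0 \<longleftrightarrow>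
     deriv (deriv \<mu>1) 0 - F (0, 0) =
     deriv (deriv (p 0)) 0 * (deriv G 0 - a)\<^sup>2 + deriv (deriv (g 0)) 0 * (deriv G 0 + a)\<^sup>2 +
     (deriv (p 0) 0 + deriv (g 0) 0) * deriv (deriv G) 0" if e: "deriv (p 1) 0 = deriv (p 0) 0"
    using w(2) slope_minus_ne[of 0]
      mult_right_cancel[of "(deriv G 0 - a)\<^sup>2" "deriv (deriv (p 1)) 0" "deriv (deriv (p 0)) 0"]
    unfolding e ring_distribs by (smt (verit) zero_eq_power2)
  show ?thesis using 1 2 by blast
qed

text \<open>The boundary condition at \<open>t = 0\<close>, \<open>x = l\<close> is the differential equation of \<open>g 1\<close> at its initial point,
where value and derivative agree with those of \<open>g 0\<close>.\<close>

lemma agree_right_iff: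
  assumes "J 0 = 0"
  shows "deriv (deriv (g 1)) l = deriv (deriv (g 0)) l \<longleftrightarrow>
    \<mu>2 0 - F (0, l) = a\<^sup>2 * (deriv (deriv (p 0)) l + deriv (deriv (g 0)) l) +
      b * (deriv (p 0) l + deriv (g 0) l)"
proof -
  have d: "deriv (g 1) l = deriv (g 0) l" using g_jump[of 0] assms by simp
  have "vtt (0, l) = F (0, l)" using v_eq[of "(0, l)"] by (simp add: v_0)
  then have "a\<^sup>2 * deriv (deriv (p 0)) l + a\<^sup>2 * deriv (deriv (g 1)) l + b * (deriv (p 0) l + deriv (g 0) l) =
      \<mu>2 0 - F (0, l)"
    using g_Suc[of 0 0] d by (simp add: v_0 distrib_left)
  then have "\<mu>2 0 - F (0, l) = a\<^sup>2 * (deriv (deriv (p 0)) l + deriv (deriv (g 0)) l) +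
      b * (deriv (p 0) l + deriv (g 0) l) \<longleftrightarrow>
      a\<^sup>2 * deriv (deriv (g 1)) l = a\<^sup>2 * deriv (deriv (g 0)) l"
    unfolding distrib_left[of "a\<^sup>2"] by linarith
  then show ?thesis using a_pos by simp
qed

context
  assumes J0: "\<And>i. J i = 0"
    and first_p: "deriv (p 1) 0 = deriv (p 0) 0" "deriv (deriv (p 1)) 0 = deriv (deriv (p 0)) 0"
    and first_g: "deriv (deriv (g 1)) l = deriv (deriv (g 0)) l"
begin

text \<open>Agreement of \<open>g (Suc i)\<close> and \<open>g i\<close> is carried by the wall relation to the next node of \<open>\<xi>\<close>, and
agreement of \<open>p (Suc i)\<close> and \<open>p i\<close> is carried by the boundary condition at \<open>x = l\<close> to the next node
of \<open>\<eta>\<close>.\<close>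

lemma pieces_agree: "agree2 (p (Suc i)) (p i) (gm (r i)) \<and> agree2 (g (Suc i)) (g i) (l + a * L i)"
proof (induction i)
  case 0
  show ?case using p_match[of 0] g_match[of 0] g_jump[of 0] first_p first_g J0
    by (simp add: agree2_def)
next
  case (Suc i)
  let ?t = "r (Suc i)" let ?c = "deriv G ?t - a"
  have gi: "deriv (g (Suc i)) (gp ?t) = deriv (g i) (gp ?t)"
    "deriv (deriv (g (Suc i))) (gp ?t) = deriv (deriv (g i)) (gp ?t)"
    using Suc by (simp_all add: agree2_def gp_r_Suc)
  have "deriv (p (Suc (Suc i))) (gm ?t) * ?c = deriv (p (Suc i)) (gm ?t) * ?c"
    unfolding p_wall gi ..
  then have p1: "deriv (p (Suc (Suc i))) (gm ?t) = deriv (p (Suc i)) (gm ?t)"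
    using slope_minus_ne by simp
  have "deriv (deriv (p (Suc (Suc i)))) (gm ?t) * ?c\<^sup>2 + deriv (p (Suc (Suc i))) (gm ?t) * deriv (deriv G) ?t =
    deriv (deriv (p (Suc i))) (gm ?t) * ?c\<^sup>2 + deriv (p (Suc i)) (gm ?t) * deriv (deriv G) ?t"
    unfolding p_wall gi ..
  then have p2: "deriv (deriv (p (Suc (Suc i)))) (gm ?t) = deriv (deriv (p (Suc i))) (gm ?t)"
    using slope_minus_ne unfolding p1 by simp
  let ?s = "L (Suc i)"
  have ls: "l - a * ?s = gm (r i)" by (simp add: gm_r)
  have g1: "deriv (g (Suc (Suc i))) (l + a * ?s) = deriv (g (Suc i)) (l + a * ?s)"
    using g_jump[of "Suc i"] J0 by simp
  have pi: "deriv (p (Suc i)) (gm (r i)) = deriv (p i) (gm (r i))"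
    "deriv (deriv (p (Suc i))) (gm (r i)) = deriv (deriv (p i)) (gm (r i))"
    using Suc by (simp_all add: agree2_def)
  have "a\<^sup>2 * (deriv (deriv (p i)) (gm (r i)) + deriv (deriv (g (Suc (Suc i)))) (l + a * ?s)) +
     b * (deriv (p i) (gm (r i)) + deriv (g (Suc i)) (l + a * ?s)) =
     a\<^sup>2 * (deriv (deriv (p i)) (gm (r i)) + deriv (deriv (g (Suc i))) (l + a * ?s)) +
     b * (deriv (p i) (gm (r i)) + deriv (g (Suc i)) (l + a * ?s))"
    using g_Suc[of "Suc i" ?s] g_Suc[of i ?s] unfolding ls pi g1 by simp
  then have g2: "deriv (deriv (g (Suc (Suc i)))) (l + a * ?s) = deriv (deriv (g (Suc i))) (l + a * ?s)"
    using a_pos by simp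
  show ?case using p_match g_match p1 p2 g1 g2 by (simp add: agree2_def)
qed

lemma PP_C2: "C2_line PP"
  and PP_deriv: "gm (r i) \<le> \<xi> \<Longrightarrow> i = 0 \<or> \<xi> \<le> l - a * L i \<Longrightarrow> deriv PP \<xi> = deriv (p i) \<xi>"
  and PP_deriv2: "gm (r i) \<le> \<xi> \<Longrightarrow> i = 0 \<or> \<xi> \<le> l - a * L i \<Longrightarrow> deriv (deriv PP) \<xi> = deriv (deriv (p i)) \<xi>"
proof -
  let ?c = "\<lambda>i. - gm (r i)" let ?h = "\<lambda>i y. p i (- y)"
  note h = C2_line_reflect[OF p_C2]
  have m1: "?h (Suc i) (?c i) = ?h i (?c i)" for i
    using pieces_agree[of i] by (simp add: agree2_def)
  have m2: "deriv (?h (Suc i)) (?c i) = deriv (?h i) (?c i)" for i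
    unfolding h(2) using pieces_agree[of i] by (simp add: agree2_def)
  have m3: "deriv (deriv (?h (Suc i))) (?c i) = deriv (deriv (?h i)) (?c i)" for i
    unfolding h(3) using pieces_agree[of i] by (simp add: agree2_def)
  note m = m1 m2 m3
  note k = C2_line_pick[of ?c ?h, OF nodes(1,2) h(1) m]
  have PP: "PP = (\<lambda>\<xi>. pick ?c ?h (- \<xi>))" by (auto simp: PP_def)
  note R = C2_line_reflect[OF k(1), folded PP]
  show "C2_line PP" by (rule R(1))
  assume i: "gm (r i) \<le> \<xi>" "i = 0 \<or> \<xi> \<le> l - a * L i"
  have s: "- \<xi> \<le> - gm (r i)" "\<And>k. i = Suc k \<Longrightarrow> - gm (r k) \<le> - \<xi>"
    using i by (auto simp: gm_r[symmetric])
  have 1: "pick ?c (\<lambda>i. deriv (?h i)) (- \<xi>) = deriv (?h i) (- \<xi>)"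
    by (rule pick_eq[of ?c "\<lambda>i. deriv (?h i)", OF nodes(1) m(2) s])
  show "deriv PP \<xi> = deriv (p i) \<xi>" unfolding R(2) k(2) 1 by (simp add: h(2))
  have 2: "pick ?c (\<lambda>i. deriv (deriv (?h i))) (- \<xi>) = deriv (deriv (?h i)) (- \<xi>)"
    by (rule pick_eq[of ?c "\<lambda>i. deriv (deriv (?h i))", OF nodes(1) m(3) s])
  show "deriv (deriv PP) \<xi> = deriv (deriv (p i)) \<xi>" unfolding R(3) k(3) 2 by (simp add: h(3))
qed

lemma GG_C2: "C2_line GG"
  and GG_deriv: "j = 0 \<or> gp (r j) \<le> \<eta> \<Longrightarrow> \<eta> \<le> l + a * L j \<Longrightarrow> deriv GG \<eta> = deriv (g j) \<eta>"
  and GG_deriv2: "j = 0 \<or> gp (r j) \<le> \<eta> \<Longrightarrow> \<eta> \<le> l + a * L j \<Longrightarrow> deriv (deriv GG) \<eta> = deriv (deriv (g j)) \<eta>"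
proof -
  let ?c = "\<lambda>j. l + a * L j"
  have m: "g (Suc i) (?c i) = g i (?c i)" "deriv (g (Suc i)) (?c i) = deriv (g i) (?c i)"
    "deriv (deriv (g (Suc i))) (?c i) = deriv (deriv (g i)) (?c i)" for i
    using pieces_agree[of i] by (simp_all add: agree2_def)
  note k = C2_line_pick[of ?c g, OF nodes(3,4) g_C2 m]
  show "C2_line GG" unfolding GG_def by (rule k(1))
  assume j: "j = 0 \<or> gp (r j) \<le> \<eta>" "\<eta> \<le> l + a * L j"
  have s: "\<And>k. j = Suc k \<Longrightarrow> l + a * L k \<le> \<eta>" using j by (auto simp: gp_r_Suc)
  show "deriv GG \<eta> = deriv (g j) \<eta>" unfolding GG_def k(2)
    by (rule pick_eq[of ?c "\<lambda>i. deriv (g i)", OF nodes(3) m(2) j(2) s])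
  show "deriv (deriv GG) \<eta> = deriv (deriv (g j)) \<eta>" unfolding GG_def k(3)
    by (rule pick_eq[of ?c "\<lambda>i. deriv (deriv (g i))", OF nodes(3) m(3) j(2) s])
qed

lemma U_C2_solution:
  assumes data: "\<And>q. q \<in> Q \<Longrightarrow> F q = f q" "\<And>x. x \<in> {0..l} \<Longrightarrow> \<phi> x = \<phi>' x" "\<And>x. x \<in> {0..l} \<Longrightarrow> \<psi> x = \<psi>' x"
    "\<And>t. t \<ge> 0 \<Longrightarrow> \<mu>1 t = \<mu>1' t" "\<And>t. t \<ge> 0 \<Longrightarrow> \<mu>2 t = \<mu>2' t"
  shows "C2_solution a l b 0 \<gamma> \<phi>' \<psi>' \<mu>1' \<mu>2' f U"
proof -
  have reg: "Q \<subseteq> closure (interior Q)" using open_Q by (simp add: interior_open closure_subset)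
  have U2: "C2_on Q U
    (\<lambda>(t, x). vt (t, x) + a * (deriv GG (x + a * t) - deriv PP (x - a * t)))
    (\<lambda>(t, x). vx (t, x) + (deriv PP (x - a * t) + deriv GG (x + a * t)))
    (\<lambda>(t, x). vtt (t, x) + a\<^sup>2 * (deriv (deriv PP) (x - a * t) + deriv (deriv GG) (x + a * t)))
    (\<lambda>(t, x). vtx (t, x) + a * (deriv (deriv GG) (x + a * t) - deriv (deriv PP) (x - a * t)))
    (\<lambda>(t, x). vtx (t, x) + a * (deriv (deriv GG) (x + a * t) - deriv (deriv PP) (x - a * t)))
    (\<lambda>(t, x). vxx (t, x) + (deriv (deriv PP) (x - a * t) + deriv (deriv GG) (x + a * t)))"
    unfolding U_def by (rule C2_on_subset[OF C2_on_superposition[OF PP_C2 GG_C2] subset_UNIV])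
  note C = C2_on_imp_Ck_closure[OF reg U2 refl]
  have cl: "(t, x) \<in> closure Q" if "t \<ge> 0" "\<gamma> t \<le> x" "x \<le> l" for t x
    using in_closure_Qdom[OF cont_G G_eq _ that] G_less G_eq by metis
  show ?thesis
    unfolding C2_solution_def Let_def
  proof (intro conjI ballI allI impI)
    show "Ck_closure 2 Q U" by (rule C(1))
    show "D_t Q (D_t Q U) q - a\<^sup>2 * D_x Q (D_x Q U) q = f q" if q: "q \<in> Q" for q
    proof -
      have q': "q \<in> closure Q" using q closure_subset by blast
      show ?thesis unfolding C(4)[OF q'] C(5)[OF q'] data(1)[OF q, symmetric] v_eq[of q, symmetric]
        by (simp add: split_beta algebra_simps)
    qed
    fix x assume x: "x \<in> {0..l}"
    show "U (0, x) = \<phi>' x" using U_initial(1)[OF x] data(2)[OF x] by simp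
    have c0: "(0, x) \<in> closure Q" using x G_eq[of 0] G_0 by (intro cl) auto
    have "deriv PP x = deriv (p 0) x" "deriv GG x = deriv (g 0) x"
      using PP_deriv[of 0 x] GG_deriv[of 0 x] x by simp_all
    then show "D_t Q U (0, x) = \<psi>' x + (if x = l then 0 else 0)"
      using C(2)[OF c0] \<psi>_eq[of x] data(3)[OF x] by (simp add: v_0)
  next
    fix t :: real assume t: "t \<ge> 0"
    show "U (t, \<gamma> t) = \<mu>1' t" using U_wall[OF t] data(4)[OF t] by simp
    have "l - a * t \<le> l" using t a_pos by simp
    then obtain j where j: "gm (r j) \<le> l - a * t" "l - a * t \<le> l - a * L j" by (rule row_exists)
    then have j': "gp (r (Suc j)) \<le> l + a * t" "l + a * t \<le> l + a * L (Suc j)"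
      by (simp_all add: gm_r gp_r_Suc)
    have c: "(t, l) \<in> closure Q" using t G_less[of t] G_eq[of t] by (intro cl) auto
    have "D_t Q (D_t Q U) (t, l) + b * D_x Q U (t, l) = \<mu>2 t"
      using C(3)[OF c] C(4)[OF c] g_Suc[of j t] PP_deriv[of j "l - a * t"] PP_deriv2[of j "l - a * t"]
        GG_deriv[of "Suc j" "l + a * t"] GG_deriv2[of "Suc j" "l + a * t"] j j'
      by (simp add: algebra_simps)
    then show "D_t Q (D_t Q U) (t, l) + b * D_x Q U (t, l) = \<mu>2' t" using data(5)[OF t] by simp
  qed
qed

end

text \<open>Fix a small time and cross the characteristics \<open>\<xi> = 0\<close> and \<open>\<eta> = l\<close> in the direction of \<open>x\<close>. Near
each of them only one of the two glued functions changes its piece, and after subtracting the other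
terms it is seen to be twice differentiable there.\<close>

lemma C2_solution_forces_agreement:
  assumes u: "Ck_closure 2 Q u" and eq: "\<And>q. q \<in> Q \<Longrightarrow> u q = U q"
  shows "deriv (p 1) 0 = deriv (p 0) 0" "deriv (deriv (p 1)) 0 = deriv (deriv (p 0)) 0"
    "deriv (deriv (g 1)) l = deriv (deriv (g 0)) l"
proof -
  have opQ: "interior Q = Q" by (rule interior_open[OF open_Q])
  have C2: "C2_on Q u (D_t Q u) (D_x Q u) (D_t Q (D_t Q u)) (D_x Q (D_t Q u)) (D_t Q (D_x Q u)) (D_x Q (D_x Q u))"
    using u by (simp only: Ck_closure_2_iff)
  \<comment> \<open>at this time the two characteristics pass through \<open>x = l / 4\<close> and \<open>x = 3 l / 4\<close>\<close>
  define t where "t = l / (4 * a)"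
  have at: "a * t = l / 4" using a_pos by (simp add: t_def)
  have t: "t > 0" using a_pos l_pos by (simp add: t_def)
  have inQ: "(t, x) \<in> Q" if "gm t < x - l / 4" "x < l" for x
    using that t G_eq[of t] by (simp add: Qdom_def gm_def at)
  have gmt: "gm t < 0" using gm_strict[OF t] by simp
  have gmr1: "gm (r 1) < 0" using gm_strict[of 0 "r 1"] r_less_iff[of 0 1] by simp
  define e where "e = min (- gm t) (min (l / 4) (- gm (r 1)))"
  have e: "e > 0" using gmt gmr1 l_pos by (simp add: e_def)
  have shift: "((\<lambda>\<xi>. w (t, \<xi> + c)) has_real_derivative wx (t, \<xi> + c)) (at \<xi>)"
    if "C1_on S w wt wx" "(t, \<xi> + c) \<in> interior S" for S w wt wx \<xi> c
  proof -
    have "((\<lambda>\<xi>. \<xi> + c) has_real_derivative 1) (at \<xi>)" by (auto intro!: derivative_eq_intros)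
    from DERIV_chain2[OF C1_on_D(5)[OF that] this] show ?thesis by simp
  qed
  have shift': "((\<lambda>\<xi>. h (\<xi> + c)) has_real_derivative h' (\<xi> + c)) (at \<xi>)"
    if "\<And>x. (h has_real_derivative h' x) (at x)" for h h' \<xi> c
    using DERIV_shift[of h "h' (\<xi> + c)" \<xi> c] that by simp
  define K where "K \<xi> = u (t, \<xi> + l / 4) - v (t, \<xi> + l / 4) - g 0 (\<xi> + l / 2)" for \<xi>
  have K: "K \<xi> = PP \<xi>" if "- e < \<xi>" "\<xi> < e" for \<xi>
  proof -
    have q: "(t, \<xi> + l / 4) \<in> Q" using that by (intro inQ) (auto simp: e_def)
    have s: "\<xi> + l / 4 + l / 4 = \<xi> + l / 2" by simp
    have "GG (\<xi> + l / 2) = g 0 (\<xi> + l / 2)" using that by (intro GG_eq) (auto simp: e_def)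
    then show ?thesis unfolding K_def eq[OF q] U_def split at s by simp
  qed
  have Q0: "(t, \<xi> + l / 4) \<in> interior Q" if "0 - e < \<xi>" "\<xi> < 0 + e" for \<xi>
    unfolding opQ using that by (intro inQ) (auto simp: e_def)
  have dK: "(K has_real_derivative D_x Q u (t, \<xi> + l / 4) - vx (t, \<xi> + l / 4) - deriv (g 0) (\<xi> + l / 2)) (at \<xi>)"
    if "0 - e < \<xi>" "\<xi> < 0 + e" for \<xi>
    unfolding K_def
    by (intro DERIV_diff shift[OF C2_on_D(1)[OF C2]] shift[OF C2_on_D(1)[OF v_C2]] shift' C2_lineD(1)[OF g_C2] Q0 that)
       simp
  have dK1: "((\<lambda>\<xi>. D_x Q u (t, \<xi> + l / 4) - vx (t, \<xi> + l / 4) - deriv (g 0) (\<xi> + l / 2)) has_real_derivative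
      D_x Q (D_x Q u) (t, \<xi> + l / 4) - vxx (t, \<xi> + l / 4) - deriv (deriv (g 0)) (\<xi> + l / 2)) (at \<xi>)"
    if "0 - e < \<xi>" "\<xi> < 0 + e" for \<xi>
    by (intro DERIV_diff shift[OF C2_on_D(3)[OF C2]] shift[OF C2_on_D(3)[OF v_C2]] shift' C2_lineD(2)[OF g_C2] Q0 that)
       simp
  have Kp: "K \<xi> = p 0 \<xi>" if "0 \<le> \<xi>" "\<xi> < 0 + e" for \<xi>
    using K[of \<xi>] PP_eq[of 0 \<xi>] that e by simp
  have Kp1: "K \<xi> = p 1 \<xi>" if "0 - e < \<xi>" "\<xi> \<le> 0" for \<xi>
    using K[of \<xi>] PP_eq[of 1 \<xi>] gm_r[of 0] that e by (simp add: e_def)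
  note A = C2_pieces_agree[OF e dK dK1 p_C2 Kp p_C2 Kp1]
  show "deriv (p 1) 0 = deriv (p 0) 0" "deriv (deriv (p 1)) 0 = deriv (deriv (p 0)) 0"
    using A by simp_all
  define H where "H \<eta> = u (t, \<eta> + (- l / 4)) - v (t, \<eta> + (- l / 4)) - p 0 (\<eta> + (- l / 2))" for \<eta>
  have L1: "a * L 1 = l" using gm_r[of 0] by simp
  have e': "l / 4 > 0" using l_pos by simp
  have Q1: "(t, \<eta> + (- l / 4)) \<in> Q" if "l - l / 4 < \<eta>" "\<eta> < l + l / 4" for \<eta>
    using that gmt l_pos by (intro inQ) (auto simp: field_simps)
  have H: "H \<eta> = GG \<eta>" if "l - l / 4 < \<eta>" "\<eta> < l + l / 4" for \<eta>
  proof -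
    have "PP (\<eta> + (- l / 2)) = p 0 (\<eta> + (- l / 2))" using that l_pos by (intro PP_eq) (auto simp: field_simps)
    moreover have "\<eta> + (- l / 4) - l / 4 = \<eta> + (- l / 2)" "\<eta> + (- l / 4) + l / 4 = \<eta>" by simp_all
    ultimately show ?thesis unfolding H_def eq[OF Q1[OF that]] U_def split at by simp
  qed
  have dH: "(H has_real_derivative D_x Q u (t, \<eta> + (- l / 4)) - vx (t, \<eta> + (- l / 4)) - deriv (p 0) (\<eta> + (- l / 2))) (at \<eta>)"
    if "l - l / 4 < \<eta>" "\<eta> < l + l / 4" for \<eta>
    unfolding H_def
    by (intro DERIV_diff shift[OF C2_on_D(1)[OF C2]] shift[OF C2_on_D(1)[OF v_C2]] shift' C2_lineD(1)[OF p_C2])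
       (use Q1[OF that] in \<open>simp_all add: opQ\<close>)
  have dH1: "((\<lambda>\<eta>. D_x Q u (t, \<eta> + (- l / 4)) - vx (t, \<eta> + (- l / 4)) - deriv (p 0) (\<eta> + (- l / 2))) has_real_derivative
      D_x Q (D_x Q u) (t, \<eta> + (- l / 4)) - vxx (t, \<eta> + (- l / 4)) - deriv (deriv (p 0)) (\<eta> + (- l / 2))) (at \<eta>)"
    if "l - l / 4 < \<eta>" "\<eta> < l + l / 4" for \<eta>
    by (intro DERIV_diff shift[OF C2_on_D(3)[OF C2]] shift[OF C2_on_D(3)[OF v_C2]] shift' C2_lineD(2)[OF p_C2])
       (use Q1[OF that] in \<open>simp_all add: opQ\<close>)
  have Hg1: "H \<eta> = g 1 \<eta>" if "l \<le> \<eta>" "\<eta> < l + l / 4" for \<eta>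
    using H[of \<eta>] GG_eq[of 1 \<eta>] gp_r_Suc[of 0] that l_pos L1 by simp
  have Hg0: "H \<eta> = g 0 \<eta>" if "l - l / 4 < \<eta>" "\<eta> \<le> l" for \<eta>
    using H[of \<eta>] GG_eq[of 0 \<eta>] that l_pos by simp
  show "deriv (deriv (g 1)) l = deriv (deriv (g 0)) l"
    by (rule C2_pieces_agree(2)[OF e' dH dH1 g_C2 Hg1 g_C2 Hg0])
qed

end

section \<open>The theorem\<close>

context moving_wall
begin

lemma P_subset_Q: "adj i j \<Longrightarrow> P i j \<subseteq> Q"
  using P_eq by blast

lemma D_t_open_cell:
  assumes "adj i j" "q \<in> open_cell i j"
  shows "D_t (P i j) u q = pd_t u q"
  using open_cell_subset_interior[OF assms(1)] assms(2) by (auto simp: D_t_def bd_ext_def)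

text \<open>Between \<open>gm (r i)\<close> and \<open>l - a * L i\<close>, which is the previous node or \<open>l\<close>, there is no node of \<open>\<xi>\<close>.\<close>

lemma edge_off_nodes:
  assumes "gm (r i) < \<xi>" "\<xi> < l - a * L i"
  shows "\<xi> \<noteq> gm (r k)"
proof
  assume \<xi>: "\<xi> = gm (r k)"
  then have ki: "k < i" using assms(1) by simp
  then obtain m where m: "i = Suc m" by (cases i) auto
  have "gm (r k) < gm (r m)" using assms(2) unfolding \<xi> m by (simp only: gm_r[symmetric])
  then show False using ki m by simp
qed

text \<open>The limits in \<open>has_jump\<close> are taken at a fixed time along points of the adjacent open cells, where the
ordinary time derivative equals the one within the cell; by continuity the limits are the values of
the latter.\<close>

lemma singular_part_piecewise_solution:
  assumes u: "singular_part a l b \<gamma> C u"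
  shows "piecewise_solution b (\<lambda>_. 0) (\<lambda>_. 0) (\<lambda>_. 0) (\<lambda>_. 0) (\<lambda>_. 0) (\<lambda>i. if even i then C i else 0) u"
proof -
  have gmr: "gamma_minus a \<gamma> (r i) = gm (r i)" for i by (simp add: gamma_minus_def gm_def G_eq)
  note s = u[unfolded singular_part_def Let_def gmr]
  have cells: "Ck_closure 2 (P i j) u \<and> (\<forall>p\<in>closure (P i j).
      D_t (P i j) (D_t (P i j) u) p - a\<^sup>2 * D_x (P i j) (D_x (P i j) u) p = 0)" if "adj i j" for i j
    using s that unfolding adj_def by blast
  show ?thesis
    unfolding piecewise_solution_def
  proof (intro conjI allI impI ballI)
    fix i j assume ij: "adj i j"
    show "Ck_closure 2 (P i j) u" using cells[OF ij] by blast
    show "D_t (P i j) (D_t (P i j) u) q - a\<^sup>2 * D_x (P i j) (D_x (P i j) u) q = 0" if "q \<in> open_cell i j" for q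
      using that cells[OF ij] open_cell_subset_interior[OF ij] interior_subset[of "P i j"]
        closure_subset[of "P i j"] by blast
  next
    fix i \<xi> assume \<xi>: "gm (r i) < \<xi> \<and> \<xi> < l - a * L i"
    let ?q = "ch \<xi> (l + a * L i)"
    obtain t c where q: "?q = (t, c)" by (cases ?q)
    have tc: "c - a * t = \<xi>" "c + a * t = l + a * L i"
      using char_pt_coords[of a \<xi> "l + a * L i"] a_pos q by simp_all
    have c: "c = l + a * L i - a * t" using tc by simp
    have adj: "adj i i" "adj i (Suc i)" by (simp_all add: adj_def)
    have qP: "(t, c) \<in> P i i" "(t, c) \<in> P i (Suc i)" using edge_point[of i \<xi>] \<xi> q by auto
    then have qQ: "(t, c) \<in> Q" using P_subset_Q[OF adj(1)] by blast
    then have Q: "t > 0" "G t < c" "c < l" using G_eq[of t] by (auto simp: Qdom_def)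
    have inQ: "(t, x) \<in> Q" if "G t < x" "x < l" for x using that Q G_eq[of t] by (simp add: Qdom_def)
    have "has_jump (pd_t u) t c (if even i then C i else 0)"
      using s qQ edge_off_nodes[of i \<xi>] \<xi> tc unfolding c by blast
    then obtain hp hm where h: "((\<lambda>x. pd_t u (t, x)) \<longlongrightarrow> hp) (at_right c)"
      "((\<lambda>x. pd_t u (t, x)) \<longlongrightarrow> hm) (at_left c)" "hp - hm = (if even i then C i else 0)"
      unfolding has_jump_def by blast
    have lim: "hp = D_t (P i j) u (t, c)"
      if ij: "adj i j" "(t, c) \<in> P i j" and F: "F \<noteq> bot" "((\<lambda>x. pd_t u (t, x)) \<longlongrightarrow> hp) F"
        "((\<lambda>x. x) \<longlongrightarrow> c) F" "\<forall>\<^sub>F x in F. (t, x) \<in> open_cell i j" for hp j F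
    proof -
      have cont: "continuous_on (closure (P i j)) (D_t (P i j) u)"
        using cells[OF ij(1)] unfolding Ck_closure_2_iff by (blast dest: C2_on_D(1) C1_on_D(2))
      have "((\<lambda>x. (t, x)) \<longlongrightarrow> (t, c)) F" using F(3) by (intro tendsto_intros)
      then have "((\<lambda>x. D_t (P i j) u (t, x)) \<longlongrightarrow> D_t (P i j) u (t, c)) F"
      proof (rule tendsto_along[OF cont])
        show "\<forall>\<^sub>F x in F. (t, x) \<in> P i j"
          by (rule eventually_mono[OF F(4)])
             (use open_cell_subset_interior[OF ij(1)] interior_subset in blast)
        show "(t, c) \<in> closure (P i j)" using ij(2) closure_subset by blast
      qed
      then have "((\<lambda>x. pd_t u (t, x)) \<longlongrightarrow> D_t (P i j) u (t, c)) F"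
        by (rule Lim_transform_eventually)
           (rule eventually_mono[OF F(4)], rule D_t_open_cell[OF ij(1)])
      then show ?thesis using F(1,2) by (intro tendsto_unique)
    qed
    have oc: "(t, x) \<in> open_cell i j \<longleftrightarrow> (t, x) \<in> Q \<and> gm (r i) < x - a * t \<and> x - a * t < l - a * L i \<and>
       gp (r j) < x + a * t \<and> x + a * t < l + a * L j" for x j
      using in_open_cell_iff[of "x - a * t" "x + a * t" i j] unfolding ch_self .
    have "hp = D_t (P i (Suc i)) u (t, c)"
    proof (rule lim[OF adj(2) qP(2) _ h(1)])
      have up: "a * L i < a * L (Suc i)" using a_pos by simp
      have "\<forall>\<^sub>F x in at_right c. x \<in> {c<..<min l (c + min (l - a * L i - \<xi>) (a * L (Suc i) - a * L i))}"
        using Q \<xi> up by (intro eventually_at_right_real) simp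
      then show "\<forall>\<^sub>F x in at_right c. (t, x) \<in> open_cell i (Suc i)"
      proof eventually_elim
        case (elim x)
        then show ?case unfolding oc gp_r_Suc using tc \<xi> Q by (auto intro!: inQ)
      qed
    qed (auto intro: tendsto_ident_at)
    moreover have "hm = D_t (P i i) u (t, c)"
    proof (rule lim[OF adj(1) qP(1) _ h(2)])
      have "\<forall>\<^sub>F x in at_left c. x \<in> {max (G t) (c - min (\<xi> - gm (r i)) (l + a * L i - gp (r i)))<..<c}"
        using Q \<xi> gp_r_less[of i] by (intro eventually_at_left_real) simp
      then show "\<forall>\<^sub>F x in at_left c. (t, x) \<in> open_cell i i"
      proof eventually_elim
        case (elim x)
        then show ?case unfolding oc using tc \<xi> Q by (auto intro!: inQ)
      qed
    qed (auto intro: tendsto_ident_at)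
    ultimately show "D_t (P i (Suc i)) u ?q - D_t (P i i) u ?q = (if even i then C i else 0)"
      using h(3) q by simp
  qed (use s in blast)+
qed

lemma C2_solution_piecewise_solution:
  assumes u: "C2_solution a l b 0 \<gamma> \<phi> \<psi> \<mu>1 \<mu>2 f u"
  shows "piecewise_solution b f \<phi> \<psi> \<mu>1 \<mu>2 (\<lambda>_. 0) u"
proof -
  note s = u[unfolded C2_solution_def Let_def]
  have C2: "C2_on Q u (D_t Q u) (D_x Q u) (D_t Q (D_t Q u)) (D_x Q (D_t Q u)) (D_t Q (D_x Q u)) (D_x Q (D_x Q u))"
    using s unfolding Ck_closure_2_iff by blast
  note C = C2_on_imp_Ck_closure[OF P_regular C2_on_subset[OF C2 P_subset_Q] refl]
  have adj: "adj 0 0" "adj i i" "adj i (Suc i)" for i by (simp_all add: adj_def)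
  show ?thesis
    unfolding piecewise_solution_def
  proof (intro conjI allI impI ballI)
    fix i j assume ij: "adj i j"
    show "Ck_closure 2 (P i j) u" by (rule C(1)[OF ij ij])
    fix q assume q: "q \<in> open_cell i j"
    then have "q \<in> P i j" using open_cell_subset_interior[OF ij] interior_subset[of "P i j"] by blast
    then have "q \<in> closure (P i j)" "q \<in> Q" using closure_subset P_subset_Q[OF ij] by blast+
    then show "D_t (P i j) (D_t (P i j) u) q - a\<^sup>2 * D_x (P i j) (D_x (P i j) u) q = f q"
      using C(4,5)[OF ij ij] s by simp
  next
    fix x assume x: "x \<in> {0..l}"
    show "u (0, x) = \<phi> x" using s x by blast
    show "D_t (P 0 0) u (0, x) = \<psi> x"
      using C(2)[OF adj(1) adj(1) initial_in_closure_P[OF x]] s x by simp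
  next
    fix t :: real assume "t \<ge> 0"
    then show "u (t, \<gamma> t) = \<mu>1 t" using s by blast
  next
    fix j t assume t: "t \<in> {L j..L (Suc j)}"
    then have "t \<ge> 0" using L_nonneg[of j] by (simp only: atLeastAtMost_iff) linarith
    then show "D_t (P j (Suc j)) (D_t (P j (Suc j)) u) (t, l) + b * D_x (P j (Suc j)) u (t, l) = \<mu>2 t"
      using C(3,4)[OF adj(3) adj(3) right_in_closure_P[OF t]] s by simp
  next
    fix i \<xi> assume \<xi>: "gm (r i) < \<xi> \<and> \<xi> < l - a * L i"
    then have "ch \<xi> (l + a * L i) \<in> closure (P i i)" "ch \<xi> (l + a * L i) \<in> closure (P i (Suc i))"
      using edge_point[of i \<xi>] closure_subset[of "P i i"] closure_subset[of "P i (Suc i)"] by auto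
    then show "D_t (P i (Suc i)) u (ch \<xi> (l + a * L i)) - D_t (P i i) u (ch \<xi> (l + a * L i)) = 0"
      using C(2)[OF adj(2) adj(2)] C(2)[OF adj(3) adj(3)] by simp
  qed
qed

lemma piecewise_solution_unique:
  assumes u: "piecewise_solution b F \<phi> \<psi> \<mu>1 \<mu>2 J u" and w: "piecewise_solution b F' \<phi>' \<psi>' \<mu>1' \<mu>2' J' w"
    and data: "\<And>q. q \<in> Q \<Longrightarrow> F q = F' q" "\<And>x. x \<in> {0..l} \<Longrightarrow> \<phi> x = \<phi>' x" "\<And>x. x \<in> {0..l} \<Longrightarrow> \<psi> x = \<psi>' x"
      "\<And>t. t \<ge> 0 \<Longrightarrow> \<mu>1 t = \<mu>1' t" "\<And>t. t \<ge> 0 \<Longrightarrow> \<mu>2 t = \<mu>2' t" "\<And>i. J i = J' i"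
    and q: "q \<in> closure Q"
  shows "u q = w q"
proof -
  have t: "t \<ge> 0" if "t \<in> {L j..L (Suc j)}" for t j
    using that L_nonneg[of j] by (simp only: atLeastAtMost_iff) linarith
  have "piecewise_solution b (\<lambda>_. 0) (\<lambda>_. 0) (\<lambda>_. 0) (\<lambda>_. 0) (\<lambda>_. 0) (\<lambda>_. 0) (\<lambda>p. u p - w p)"
    using piecewise_solution_diff[OF u w] data t unfolding piecewise_solution_def
    by (simp add: open_cell_def)
  from piecewise_solution_zero[OF this q] show ?thesis by simp
qed

lemma singular_part_unique:
  assumes "singular_part a l b \<gamma> C u" "singular_part a l b \<gamma> C w" "q \<in> closure Q"
  shows "u q = w q"
  by (rule piecewise_solution_unique[OF assms(1,2)[THEN singular_part_piecewise_solution] _ _ _ _ _ _ assms(3)])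
     auto

lemma C2_solution_unique:
  assumes "C2_solution a l b 0 \<gamma> \<phi> \<psi> \<mu>1 \<mu>2 f u" "C2_solution a l b 0 \<gamma> \<phi> \<psi> \<mu>1 \<mu>2 f w" "q \<in> closure Q"
  shows "u q = w q"
  by (rule piecewise_solution_unique[OF assms(1,2)[THEN C2_solution_piecewise_solution] _ _ _ _ _ _ assms(3)])
     auto

text \<open>The piecewise solution with zero data; dividing by \<open>a\<close> converts jumps of the time derivative into
jumps of the derivative of \<open>g\<close>.\<close>

lemma singular_part_exists: "\<exists>u. singular_part a l b \<gamma> C u"
proof -
  have z: "C2_line (\<lambda>_. 0)" "deriv (\<lambda>_. 0 :: real) = (\<lambda>_. 0 :: real)"
    using C2_line_affine[of 0 0] by simp_all
  define J where "J i = (if even i then C i else 0) / a" for i :: nat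
  obtain p g where pg: "p 0 = (\<lambda>_. 0)" "g 0 = (\<lambda>_. 0)" "\<And>i. C2_line (p i)" "\<And>i. C2_line (g i)"
    "\<And>i t. p (Suc i) (gm t) = 0 - g i (gp t)"
    "\<And>j t. a\<^sup>2 * (deriv (deriv (p j)) (l - a * t) + deriv (deriv (g (Suc j))) (l + a * t)) +
       b * (deriv (p j) (l - a * t) + deriv (g (Suc j)) (l + a * t)) = 0"
    "\<And>j. g (Suc j) (l + a * L j) = g j (l + a * L j)"
    "\<And>j. deriv (g (Suc j)) (l + a * L j) = deriv (g j) (l + a * L j) + J j"
    using wave_sequence[OF z(1) continuous_on_const[of UNIV 0] z(1) z(1), where b=b and J=J] by blast
  interpret wave_pieces a l \<gamma> G b "\<lambda>_. 0" "\<lambda>_. 0" "\<lambda>_. 0" "\<lambda>_. 0" "\<lambda>_. 0" "\<lambda>_. 0" "\<lambda>_. 0"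
    "\<lambda>_. 0" "\<lambda>_. 0" "\<lambda>_. 0" "\<lambda>_. 0" J p g
    by unfold_locales (use pg z in \<open>auto simp: C2_on_def C1_on_def\<close>)
  show ?thesis using U_singular_part[of C] by (auto simp: J_def)
qed

text \<open>The functions with suffix \<open>e\<close> are extensions of the data to the line. The initial pieces come from
d'Alembert's formula, and inserting them turns second-order agreement at the first nodes into the
matching conditions.\<close>

lemma C2_solution_exists_iff:
  assumes \<phi>: "C2_line \<phi>e" "\<And>x. x \<in> {0..l} \<Longrightarrow> \<phi>e x = \<phi> x"
    and \<psi>: "\<And>x. (\<psi>e has_real_derivative deriv \<psi>e x) (at x)" "continuous_on UNIV (deriv \<psi>e)"
      "\<And>x. x \<in> {0..l} \<Longrightarrow> \<psi>e x = \<psi> x"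
    and \<mu>1: "C2_line \<mu>1e" "\<And>t. t \<ge> 0 \<Longrightarrow> \<mu>1e t = \<mu>1 t"
    and \<mu>2: "continuous_on UNIV \<mu>2e" "\<And>t. t \<ge> 0 \<Longrightarrow> \<mu>2e t = \<mu>2 t"
    and f: "Ck_closure 1 Q f"
  shows "(\<exists>u. C2_solution a l b 0 \<gamma> \<phi> \<psi> \<mu>1 \<mu>2 f u) \<longleftrightarrow>
    \<mu>1e 0 = \<phi>e 0 \<and> deriv \<mu>1e 0 = \<psi>e 0 + deriv G 0 * deriv \<phi>e 0 \<and>
    deriv (deriv \<mu>1e) 0 - f (0, 0) = (a\<^sup>2 + (deriv G 0)\<^sup>2) * deriv (deriv \<phi>e) 0 +
      2 * deriv G 0 * deriv \<psi>e 0 + deriv (deriv G) 0 * deriv \<phi>e 0 \<and>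
    \<mu>2e 0 - f (0, l) = a\<^sup>2 * deriv (deriv \<phi>e) l + b * deriv \<phi>e l"
    (is "_ \<longleftrightarrow> ?compat \<and> ?wall1 \<and> ?wall2 \<and> ?right")
proof -
  have gl: "\<And>t. t \<ge> 0 \<Longrightarrow> \<gamma> t < l" using G_less G_eq by metis
  obtain F Fx where F: "continuous_on UNIV F" "continuous_on UNIV Fx"
    "\<And>t x. ((\<lambda>y. F (t, y)) has_real_derivative Fx (t, x)) (at x)" "\<And>q. q \<in> closure Q \<Longrightarrow> F q = f q"
    using extend_source[OF cont_G G_eq gl f] by blast
  have FQ: "F q = f q" if "q \<in> Q" for q by (rule F(4)[OF subsetD[OF closure_subset that]])
  have F0: "F (0, 0) = f (0, 0)" "F (0, l) = f (0, l)"
    using l_pos G_eq[of 0] G_0 by (auto intro!: F(4) in_closure_Qdom[OF cont_G G_eq gl])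
  obtain v vt vx vtt vtx vxx where v: "C2_on UNIV v vt vx vtt vtx vtx vxx"
    "\<And>q. vtt q - a\<^sup>2 * vxx q = F q"
    "\<And>x. v (0, x) = 0" "\<And>x. vt (0, x) = 0" "\<And>x. vx (0, x) = 0" "\<And>x. vtx (0, x) = 0"
    "\<And>x. vxx (0, x) = 0"
    using duhamel[OF a_pos F(1-3)] by blast
  note \<Psi> = C2_line_prim[OF \<psi>(1,2)]
  define p0 where "p0 x = 1 / 2 * \<phi>e x - 1 / (2 * a) * prim \<psi>e x" for x
  define g0 where "g0 x = 1 / 2 * \<phi>e x + 1 / (2 * a) * prim \<psi>e x" for x
  note c = C2_line_cmul[OF \<phi>(1), of "1 / 2"] C2_line_cmul[OF \<Psi>(1), of "1 / (2 * a)"]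
  have p0: "C2_line p0" "deriv p0 = (\<lambda>x. 1 / 2 * deriv \<phi>e x - 1 / (2 * a) * \<psi>e x)"
    "deriv (deriv p0) = (\<lambda>x. 1 / 2 * deriv (deriv \<phi>e) x - 1 / (2 * a) * deriv \<psi>e x)"
    using C2_line_diff[OF c(1,4)] \<Psi> c by (simp_all add: p0_def[abs_def])
  have g0: "C2_line g0" "deriv g0 = (\<lambda>x. 1 / 2 * deriv \<phi>e x + 1 / (2 * a) * \<psi>e x)"
    "deriv (deriv g0) = (\<lambda>x. 1 / 2 * deriv (deriv \<phi>e) x + 1 / (2 * a) * deriv \<psi>e x)"
    using C2_line_add[OF c(1,4)] \<Psi> c by (simp_all add: g0_def[abs_def])
  have N: "C2_line (\<lambda>t. \<mu>1e t - v (t, G t))"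
    by (rule C2_line_diff(1)[OF \<mu>1(1) C2_line_along_curve(1)[OF v(1) G_C2]])
  have M: "continuous_on UNIV (\<lambda>t. \<mu>2e t - vtt (t, l) - b * vx (t, l))"
    using C1_on_D(2)[OF C2_on_D(2)[OF v(1)]] C1_on_D(3)[OF C2_on_D(1)[OF v(1)]]
    by (intro continuous_intros \<mu>2(1)) (auto intro!: continuous_intros elim!: continuous_on_compose2)
  obtain p g where pg: "p 0 = p0" "g 0 = g0" "\<And>i. C2_line (p i)" "\<And>i. C2_line (g i)"
    "\<And>i t. p (Suc i) (gm t) = (\<mu>1e t - v (t, G t)) - g i (gp t)"
    "\<And>j t. a\<^sup>2 * (deriv (deriv (p j)) (l - a * t) + deriv (deriv (g (Suc j))) (l + a * t)) +
       b * (deriv (p j) (l - a * t) + deriv (g (Suc j)) (l + a * t)) = \<mu>2e t - vtt (t, l) - b * vx (t, l)"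
    "\<And>j. g (Suc j) (l + a * L j) = g j (l + a * L j)"
    "\<And>j. deriv (g (Suc j)) (l + a * L j) = deriv (g j) (l + a * L j) + 0"
    using wave_sequence[OF N M p0(1) g0(1), where b=b and J="\<lambda>_. 0"] by blast
  have wp: "wave_pieces a l \<gamma> G b F v vt vx vtt vtx vxx \<phi>e \<psi>e \<mu>1e \<mu>2e (\<lambda>_. 0) p g"
    if ?compat
  proof unfold_locales
    show "\<phi>e x = p 0 x + g 0 x" for x by (simp add: pg p0_def g0_def)
    show "\<psi>e x = a * (deriv (g 0) x - deriv (p 0) x)" for x
      using a_pos unfolding pg(1,2) p0(2) g0(2) by (simp add: field_simps)
  qed (use v \<mu>1(1) pg that in blast)+
  let ?c = "deriv G 0"
  have wall_iff: "deriv (p 1) 0 = deriv (p 0) 0 \<and> deriv (deriv (p 1)) 0 = deriv (deriv (p 0)) 0 \<longleftrightarrow>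
    ?wall1 \<and> ?wall2"
    and right_iff: "deriv (deriv (g 1)) l = deriv (deriv (g 0)) l \<longleftrightarrow>
    ?right" if ?compat
  proof -
    interpret wave_pieces a l \<gamma> G b F v vt vx vtt vtx vxx \<phi>e \<psi>e \<mu>1e \<mu>2e "\<lambda>_. 0" p g
      by (rule wp[OF that])
    have 1: "deriv (p 0) 0 * (?c - a) + deriv (g 0) 0 * (?c + a) = \<psi>e 0 + ?c * deriv \<phi>e 0"
      using a_pos unfolding pg(1,2) p0(2) g0(2) by (simp add: field_simps)
    have "deriv (deriv (p 0)) 0 * (?c - a)\<^sup>2 + deriv (deriv (g 0)) 0 * (?c + a)\<^sup>2 =
        (a\<^sup>2 + ?c\<^sup>2) * deriv (deriv \<phi>e) 0 + 2 * ?c * deriv \<psi>e 0"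
      using a_pos unfolding pg(1,2) p0(3) g0(3) by (simp add: field_simps power2_eq_square)
    moreover have "deriv (p 0) 0 + deriv (g 0) 0 = deriv \<phi>e 0"
      unfolding pg(1,2) p0(2) g0(2) by simp
    ultimately have 2: "deriv (deriv (p 0)) 0 * (?c - a)\<^sup>2 + deriv (deriv (g 0)) 0 * (?c + a)\<^sup>2 +
      (deriv (p 0) 0 + deriv (g 0) 0) * deriv (deriv G) 0 = (a\<^sup>2 + ?c\<^sup>2) * deriv (deriv \<phi>e) 0 +
      2 * ?c * deriv \<psi>e 0 + deriv (deriv G) 0 * deriv \<phi>e 0" by simp
    show "deriv (p 1) 0 = deriv (p 0) 0 \<and> deriv (deriv (p 1)) 0 = deriv (deriv (p 0)) 0 \<longleftrightarrow>
      ?wall1 \<and> ?wall2"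
      using agree_wall_iff unfolding 1 2 F0 .
    have 3: "deriv (deriv (p 0)) l + deriv (deriv (g 0)) l = deriv (deriv \<phi>e) l"
      "deriv (p 0) l + deriv (g 0) l = deriv \<phi>e l"
      unfolding pg(1,2) p0(3) g0(3) unfolding p0(2) g0(2) by simp_all
    show "deriv (deriv (g 1)) l = deriv (deriv (g 0)) l \<longleftrightarrow>
      ?right"
      using agree_right_iff unfolding 3 F0 by simp
  qed
  show ?thesis
  proof
    assume "\<exists>u. C2_solution a l b 0 \<gamma> \<phi> \<psi> \<mu>1 \<mu>2 f u"
    then obtain u where u: "C2_solution a l b 0 \<gamma> \<phi> \<psi> \<mu>1 \<mu>2 f u" by blast
    have Cu: "Ck_closure 2 Q u" using u unfolding C2_solution_def Let_def by blast
    have "u (0, 0) = \<phi> 0" using u l_pos by (simp add: C2_solution_def Let_def)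
    moreover have "u (0, \<gamma> 0) = \<mu>1 0" using u unfolding C2_solution_def Let_def by blast
    ultimately have compat: ?compat
      using \<phi>(2)[of 0] \<mu>1(2)[of 0] l_pos G_eq[of 0] G_0 by simp
    interpret wave_pieces a l \<gamma> G b F v vt vx vtt vtx vxx \<phi>e \<psi>e \<mu>1e \<mu>2e "\<lambda>_. 0" p g
      by (rule wp[OF compat])
    have "u q = U q" if "q \<in> Q" for q
      by (rule piecewise_solution_unique[OF C2_solution_piecewise_solution[OF u] U_piecewise_solution
            _ _ _ _ _ _ subsetD[OF closure_subset that]])
         (use FQ \<phi>(2) \<psi>(3) \<mu>1(2) \<mu>2(2) in auto)
    from C2_solution_forces_agreement[OF Cu this]
    show "?compat \<and> ?wall1 \<and> ?wall2 \<and> ?right"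
      using wall_iff[OF compat] right_iff[OF compat] compat by blast
  next
    assume m: "?compat \<and> ?wall1 \<and> ?wall2 \<and> ?right"
    then have compat: ?compat by blast
    interpret wave_pieces a l \<gamma> G b F v vt vx vtt vtx vxx \<phi>e \<psi>e \<mu>1e \<mu>2e "\<lambda>_. 0" p g
      by (rule wp[OF compat])
    have w: "deriv (p 1) 0 = deriv (p 0) 0" "deriv (deriv (p 1)) 0 = deriv (deriv (p 0)) 0"
      "deriv (deriv (g 1)) l = deriv (deriv (g 0)) l"
      using wall_iff[OF compat] right_iff[OF compat] m by blast+
    have "C2_solution a l b 0 \<gamma> \<phi> \<psi> \<mu>1 \<mu>2 f U"
      using FQ \<phi>(2) \<psi>(3) \<mu>1(2) \<mu>2(2) by (intro U_C2_solution w) auto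
    then show "\<exists>u. C2_solution a l b 0 \<gamma> \<phi> \<psi> \<mu>1 \<mu>2 f u" by blast
  qed
qed

text \<open>The singular part exists and is unique, so classical solutions correspond to regular parts, of which
there is at most one.\<close>

lemma has_unique_classical_solution_iff:
  "has_unique_classical_solution a l b v \<gamma> \<phi> \<psi> \<mu>1 \<mu>2 f C \<longleftrightarrow> (\<exists>u. C2_solution a l b 0 \<gamma> \<phi> \<psi> \<mu>1 \<mu>2 f u)"
proof
  assume "has_unique_classical_solution a l b v \<gamma> \<phi> \<psi> \<mu>1 \<mu>2 f C"
  then show "\<exists>u. C2_solution a l b 0 \<gamma> \<phi> \<psi> \<mu>1 \<mu>2 f u"
    unfolding has_unique_classical_solution_def classical_solution_def by blast
next
  assume "\<exists>u. C2_solution a l b 0 \<gamma> \<phi> \<psi> \<mu>1 \<mu>2 f u"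
  then obtain u1 where u1: "C2_solution a l b 0 \<gamma> \<phi> \<psi> \<mu>1 \<mu>2 f u1" by blast
  obtain u2 where u2: "singular_part a l b \<gamma> C u2" using singular_part_exists by blast
  have only: "u q = u1 q + u2 q" if u: "classical_solution a l b v \<gamma> \<phi> \<psi> \<mu>1 \<mu>2 f C u" and q: "q \<in> closure Q" for u q
  proof -
    obtain w1 w2 where w: "C2_solution a l b 0 \<gamma> \<phi> \<psi> \<mu>1 \<mu>2 f w1" "singular_part a l b \<gamma> C w2"
      "u q = w1 q + w2 q"
      using u q unfolding classical_solution_def by blast
    then show ?thesis using C2_solution_unique[OF w(1) u1 q] singular_part_unique[OF w(2) u2 q] by simp
  qed
  have "classical_solution a l b v \<gamma> \<phi> \<psi> \<mu>1 \<mu>2 f C (\<lambda>q. u1 q + u2 q)"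
    unfolding classical_solution_def using u1 u2 by blast
  moreover have "u q = w q" if "classical_solution a l b v \<gamma> \<phi> \<psi> \<mu>1 \<mu>2 f C u"
    "classical_solution a l b v \<gamma> \<phi> \<psi> \<mu>1 \<mu>2 f C w" "q \<in> closure Q" for u w q
    unfolding only[OF that(1,3)] only[OF that(2,3)] ..
  ultimately show "has_unique_classical_solution a l b v \<gamma> \<phi> \<psi> \<mu>1 \<mu>2 f C"
    unfolding has_unique_classical_solution_def by blast
qed

end

theorem theorem2:
  fixes a l b v :: real
    and \<gamma> \<phi> \<psi> \<mu>1 \<mu>2 :: "real \<Rightarrow> real"
    and f :: "real \<times> real \<Rightarrow> real"
    and C :: "nat \<Rightarrow> real"
  assumes "a > 0" and "l > 0"
    and "Ck_on 2 {0..} \<gamma>" and "\<gamma> 0 = 0"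
    and "\<And>t. t \<ge> 0 \<Longrightarrow> deriv_on {0..} \<gamma> t \<in> {-a<..<a}"
    and "\<And>t. t \<ge> 0 \<Longrightarrow> \<gamma> t < l"
    and "filterlim (\<lambda>t. \<gamma> t + a * t) at_top at_top"
    and "filterlim (\<lambda>t. \<gamma> t - a * t) at_bot at_top"
    and "Ck_on 2 {0..l} \<phi>" and "Ck_on 1 {0..l} \<psi>"
    and "Ck_on 2 {0..} \<mu>1" and "Ck_on 0 {0..} \<mu>2"
    and "Ck_closure 1 (Qdom l \<gamma>) f"
  shows "has_unique_classical_solution a l b v \<gamma> \<phi> \<psi> \<mu>1 \<mu>2 f C \<longleftrightarrow>
    (let \<gamma>' = deriv_on {0..} \<gamma>; \<gamma>'' = deriv_on {0..} \<gamma>';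
         \<mu>1' = deriv_on {0..} \<mu>1; \<mu>1'' = deriv_on {0..} \<mu>1';
         \<phi>' = deriv_on {0..l} \<phi>; \<phi>'' = deriv_on {0..l} \<phi>';
         \<psi>' = deriv_on {0..l} \<psi>
     in \<mu>1 0 - \<phi> 0 = 0 \<and>
        \<mu>1' 0 - \<psi> 0 - \<gamma>' 0 * \<phi>' 0 = 0 \<and>
        \<mu>1'' 0 - (a\<^sup>2 + (\<gamma>' 0)\<^sup>2) * \<phi>'' 0 - f (0, 0) - 2 * \<gamma>' 0 * \<psi>' 0 - \<gamma>'' 0 * \<phi>' 0 = 0 \<and>
        \<mu>2 0 - f (0, l) - b * \<phi>' l - a\<^sup>2 * \<phi>'' l = 0)"
proof -
  obtain G where G: "C2_line G" "\<And>t. t \<ge> 0 \<Longrightarrow> G t = \<gamma> t"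
    "\<And>t. t \<ge> 0 \<Longrightarrow> deriv G t = deriv_on {0..} \<gamma> t"
    "\<And>t. t \<ge> 0 \<Longrightarrow> deriv (deriv G) t = deriv_on {0..} (deriv_on {0..} \<gamma>) t"
    "\<And>t. deriv G t \<in> {-a<..<a}" "surj (\<lambda>t. G t - a * t)"
    using extend_wall[OF assms(1,3,5,8)] by blast
  have top: "filterlim (\<lambda>t. G t + a * t) at_top at_top"
  proof (rule filterlim_cong[THEN iffD1, OF refl refl _ assms(7)])
    show "\<forall>\<^sub>F t in at_top. \<gamma> t + a * t = G t + a * t"
      using eventually_ge_at_top[of 0] by eventually_elim (simp add: G(2))
  qed
  interpret moving_wall a l \<gamma> G
    by unfold_locales (use assms G top in auto)
  have I: "convex {0..l}" "closed {0..l}" "0 \<in> {0..l}" "convex {0::real..}" "closed {0::real..}" "(0::real) \<in> {0..}"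
    using assms(2) by auto
  obtain \<phi>e where \<phi>e: "C2_line \<phi>e" "\<And>x. x \<in> {0..l} \<Longrightarrow> \<phi>e x = \<phi> x"
    "\<And>x. x \<in> {0..l} \<Longrightarrow> deriv \<phi>e x = deriv_on {0..l} \<phi> x"
    "\<And>x. x \<in> {0..l} \<Longrightarrow> deriv (deriv \<phi>e) x = deriv_on {0..l} (deriv_on {0..l} \<phi>) x"
    using extend_C2[OF I(1-3) assms(9)] by blast
  obtain \<psi>e where \<psi>e: "\<And>x. (\<psi>e has_real_derivative deriv \<psi>e x) (at x)" "continuous_on UNIV (deriv \<psi>e)"
    "\<And>x. x \<in> {0..l} \<Longrightarrow> \<psi>e x = \<psi> x" "\<And>x. x \<in> {0..l} \<Longrightarrow> deriv \<psi>e x = deriv_on {0..l} \<psi> x"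
    using extend_C1[OF I(1-3) assms(10)] by blast
  obtain \<mu>1e where \<mu>1e: "C2_line \<mu>1e" "\<And>x. x \<in> {0..} \<Longrightarrow> \<mu>1e x = \<mu>1 x"
    "\<And>x. x \<in> {0..} \<Longrightarrow> deriv \<mu>1e x = deriv_on {0..} \<mu>1 x"
    "\<And>x. x \<in> {0..} \<Longrightarrow> deriv (deriv \<mu>1e) x = deriv_on {0..} (deriv_on {0..} \<mu>1) x"
    using extend_C2[OF I(4-6) assms(11)] by blast
  obtain \<mu>2e where \<mu>2e: "continuous_on UNIV \<mu>2e" "\<And>x. x \<in> {0..} \<Longrightarrow> \<mu>2e x = \<mu>2 x"
    using clamp_extension[OF I(4-6)] assms(12) by auto
  have end0: "\<phi>e 0 = \<phi> 0" "deriv \<phi>e 0 = deriv_on {0..l} \<phi> 0"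
    "deriv (deriv \<phi>e) 0 = deriv_on {0..l} (deriv_on {0..l} \<phi>) 0"
    "\<psi>e 0 = \<psi> 0" "deriv \<psi>e 0 = deriv_on {0..l} \<psi> 0"
    using assms(2) by (auto intro!: \<phi>e \<psi>e)
  have endl: "deriv \<phi>e l = deriv_on {0..l} \<phi> l"
    "deriv (deriv \<phi>e) l = deriv_on {0..l} (deriv_on {0..l} \<phi>) l"
    using assms(2) by (auto intro!: \<phi>e)
  have start: "\<mu>1e 0 = \<mu>1 0" "deriv \<mu>1e 0 = deriv_on {0..} \<mu>1 0"
    "deriv (deriv \<mu>1e) 0 = deriv_on {0..} (deriv_on {0..} \<mu>1) 0" "\<mu>2e 0 = \<mu>2 0"
    "deriv G 0 = deriv_on {0..} \<gamma> 0" "deriv (deriv G) 0 = deriv_on {0..} (deriv_on {0..} \<gamma>) 0"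
    by (auto intro!: \<mu>1e \<mu>2e G)
  have "(\<exists>u. C2_solution a l b 0 \<gamma> \<phi> \<psi> \<mu>1 \<mu>2 f u) \<longleftrightarrow>
    \<mu>1e 0 = \<phi>e 0 \<and> deriv \<mu>1e 0 = \<psi>e 0 + deriv G 0 * deriv \<phi>e 0 \<and>
    deriv (deriv \<mu>1e) 0 - f (0, 0) = (a\<^sup>2 + (deriv G 0)\<^sup>2) * deriv (deriv \<phi>e) 0 +
      2 * deriv G 0 * deriv \<psi>e 0 + deriv (deriv G) 0 * deriv \<phi>e 0 \<and>
    \<mu>2e 0 - f (0, l) = a\<^sup>2 * deriv (deriv \<phi>e) l + b * deriv \<phi>e l"
    by (rule C2_solution_exists_iff[OF \<phi>e(1,2) \<psi>e(1-3) \<mu>1e(1) _ \<mu>2e(1) _ assms(13)])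
       (use \<mu>1e(2) \<mu>2e(2) in auto)
  then show ?thesis
    unfolding has_unique_classical_solution_iff Let_def end0 endl start
    by (simp add: algebra_simps)
qed

end
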